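(* Let $\mathbb{K}$ be a field of characteristic zero and let $B=B_0+B_1$ be a finite dimensional associative superalgebra over $\mathbb{K}$. Fix a basis $\{u_1,\dots,u_r\}$ of $B_0$ and a basis $\{v_1,\dots,v_s\}$ of $B_1$. Let $X=\{x_j^{(i)}\mid i\in\mathbb{N},\ 1\le j\le r\}$ and $Y=\{y_j^{(i)}\mid i\in\mathbb{N},\ 1\le j\le s\}$, let $\mathbb{K}[X;Y]$ be the free supercommutative algebra on $X$ (even) and $Y$ (odd), and for each $i\in\mathbb{N}$ put $$\xi_i=\sum_{j=1}^r u_j\otimes x_j^{(i)}+\sum_{j=1}^s v_j\otimes y_j^{(i)}\in B\otimes\mathbb{K}[X;Y].$$ Let $n\in\mathbb{N}$, and let $\mathbb{K}[\xi_1,\xi_2,\dots]$ and $\mathbb{K}[\xi_1,\dots,\xi_n]$ be the subalgebras of $B\otimes \mathbb{K}[X;Y]$ generated by $\xi_1,\xi_2,\dots$ and by $\xi_1,\dots,\xi_n$, respectively. Then $$\mathbb{K}[\xi_1,\xi_2,\dots]\cong F(G(B))\quad\text{and}\quad \mathbb{K}[\xi_1,\dots,\xi_n]\cong F_n(G(B)).$$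
   Context: Algebras are associative and unital, and (sub)algebras generated by a set contain the unit. A superalgebra is a $\mathbb{Z}_2$-graded algebra $B=B_0+B_1$. $G=G_0+G_1$ is the Grassmann algebra (with unit) of a countably infinite dimensional $\mathbb{K}$-vector space with its canonical $\mathbb{Z}_2$-grading. The Grassmann envelope of $B$ is the ordinary algebra $G(B)=G_0\otimes B_0+G_1\otimes B_1\subseteq G\otimes B$ (ordinary tensor product; it may be identified with a subalgebra of $B\otimes G$). The free supercommutative algebra $\mathbb{K}[X;Y]$ is the quotient of the free unital associative algebra $\mathbb{K}\langle X\cup Y\rangle$, graded by $\deg x=0$ for $x\in X$ and $\deg y=1$ for $y\in Y$, by the ideal generated by all $ab-(-1)^{\deg a\deg b}ba$ with $a,b\in X\cup Y$. The tensor product $B\otimes\mathbb{K}[X;Y]$ is the ordinary (ungraded) tensor product of algebras. For an algebra $A$, $T(A)$ is the T-ideal of all polynomials in the free unital associative algebra on countably many variables that vanish under all substitutions of elements of $A$. $F(A)$ denotes the relatively free algebra of countably infinite rank of the variety generated by $A$, i.e. $\mathbb{K}\langle t_1,t_2,\dots\rangle/T(A)$, and $F_n(A)$ denotes the relatively free algebra of rank $n$, i.e. $\mathbb{K}\langle t_1,\dots,t_n\rangle/(T(A)\cap\mathbb{K}\langle t_1,\dots,t_n\rangle)$. *)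

theory Defs
  imports
    "HOL-Algebra.QuotRing"
    "HOL-Algebra.Subrings"
    "HOL-Algebra.Module"
    "HOL-Algebra.Algebraic_Closure_Type"
    "HOL-Library.Poly_Mapping"
begin

section \<open>Associative unital algebras\<close>

text \<open>
  The ground field is a type \<open>'k\<close>; an algebra is a record of type \<open>('k, 'a) module\<close>, whose ring
  part carries the multiplication. The locale \<open>algebra\<close> of HOL-Algebra is not usable here because
  it requires commutativity. The zero algebra is admitted.
\<close>

locale assoc_algebra =
  ring A + module "ring_of_type_algebra :: 'k ring" A
  for A :: "('k::field, 'a) module" (structure) +
  assumes smult_mult_left:
      "x \<in> carrier A \<Longrightarrow> y \<in> carrier A \<Longrightarrow> (c \<odot> x) \<otimes> y = c \<odot> (x \<otimes> y)"
    and smult_mult_right: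
      "x \<in> carrier A \<Longrightarrow> y \<in> carrier A \<Longrightarrow> x \<otimes> (c \<odot> y) = c \<odot> (x \<otimes> y)"

definition subspace_of :: "'a set \<Rightarrow> ('k::field, 'a) module \<Rightarrow> bool" where
  "subspace_of W A \<longleftrightarrow> submodule W (ring_of_type_algebra :: 'k ring) A"

definition span_of :: "('k::field, 'a) module \<Rightarrow> 'a set \<Rightarrow> 'a set" where
  "span_of A S = \<Inter> {W. subspace_of W A \<and> S \<subseteq> W}"

definition basis_of ::
    "('k::field, 'a) module \<Rightarrow> 'a set \<Rightarrow> nat \<Rightarrow> (nat \<Rightarrow> 'a) \<Rightarrow> bool" where
  "basis_of A W m w \<longleftrightarrow>
     (\<forall>j\<in>{1..m}. w j \<in> W) \<and>
     (\<forall>c. (\<Oplus>\<^bsub>A\<^esub>j\<in>{1..m}. c j \<odot>\<^bsub>A\<^esub> w j) = \<zero>\<^bsub>A\<^esub> \<longrightarrow> (\<forall>j\<in>{1..m}. c j = 0)) \<and>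
     (\<forall>b\<in>W. \<exists>c. b = (\<Oplus>\<^bsub>A\<^esub>j\<in>{1..m}. c j \<odot>\<^bsub>A\<^esub> w j))"

definition finite_dimensional :: "('k::field, 'a) module \<Rightarrow> bool" where
  "finite_dimensional A \<longleftrightarrow> (\<exists>m w. basis_of A (carrier A) m w)"

text \<open>The subalgebra (with the unit of the ambient algebra) generated by a set.\<close>

definition generated_subalgebra :: "('k::field, 'a) module \<Rightarrow> 'a set \<Rightarrow> ('k, 'a) module" where
  "generated_subalgebra A S =
     A\<lparr>carrier := \<Inter> {C. subring C A \<and> subspace_of C A \<and> S \<subseteq> C}\<rparr>"

text \<open>
  The union in \<open>smult\<close> is the coset of \<open>c \<odot> x\<close> for any representative \<open>x\<close>; the plain elementwise
  multiple of a coset would be wrong for \<open>c = 0\<close>.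
\<close>

definition quotient_algebra ::
    "('k::field, 'a) module \<Rightarrow> 'a set \<Rightarrow> ('k, 'a set) module" (infixl \<open>Quota\<close> 65) where
  "A Quota I =
     \<lparr>carrier = carrier (A Quot I), monoid.mult = monoid.mult (A Quot I), one = \<one>\<^bsub>A Quot I\<^esub>,
      ring.zero = \<zero>\<^bsub>A Quot I\<^esub>, add = add (A Quot I),
      module.smult = (\<lambda>c C. \<Union>x\<in>C. I +>\<^bsub>A\<^esub> (c \<odot>\<^bsub>A\<^esub> x))\<rparr>"

definition algebra_isomorphic ::
    "('k::field, 'a) module \<Rightarrow> ('k, 'b) module \<Rightarrow> bool" (infix \<open>\<cong>\<^sub>a\<close> 60) where
  "A \<cong>\<^sub>a B \<longleftrightarrow>
     (\<exists>h \<in> ring_iso A B. \<forall>c. \<forall>x\<in>carrier A. h (c \<odot>\<^bsub>A\<^esub> x) = c \<odot>\<^bsub>B\<^esub> h x)"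

section \<open>Monoid algebras, free algebras, tensor products\<close>

definition monoid_algebra ::
    "('m, 'x) monoid_scheme \<Rightarrow> ('k::field, 'm \<Rightarrow>\<^sub>0 'k) module" where
  "monoid_algebra M =
     \<lparr>carrier = {f. Poly_Mapping.keys f \<subseteq> carrier M},
      monoid.mult = (\<lambda>f g. \<Sum>a\<in>Poly_Mapping.keys f. \<Sum>b\<in>Poly_Mapping.keys g.
                Poly_Mapping.single (a \<otimes>\<^bsub>M\<^esub> b) (Poly_Mapping.lookup f a * Poly_Mapping.lookup g b)),
      one = Poly_Mapping.single \<one>\<^bsub>M\<^esub> 1,
      ring.zero = 0,
      add = (+),
      module.smult = (\<lambda>c f. Poly_Mapping.map ((*) c) f)\<rparr>"

definition word_monoid :: "'v set \<Rightarrow> 'v list monoid" where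
  "word_monoid V = \<lparr>carrier = lists V, monoid.mult = (@), one = []\<rparr>"

definition free_algebra :: "'v set \<Rightarrow> ('k::field, 'v list \<Rightarrow>\<^sub>0 'k) module" where
  "free_algebra V = monoid_algebra (word_monoid V)"

text \<open>
  The monoid algebra of \<open>A \<times>\<times> B\<close> is the vector space with basis the set of pairs
  \<open>(a, b)\<close>, with \<open>(a, b) (a', b') = (a a', b b')\<close>. The bilinearity relators are stable, up to
  forming relators again, under multiplication by pairs, so the ideal they generate is just their
  linear span and the quotient is the ordinary tensor product over the ground field.
\<close>

definition tensor_ideal ::
    "('k::field, 'a) module \<Rightarrow> ('k, 'b) module \<Rightarrow> ('a \<times> 'b \<Rightarrow>\<^sub>0 'k) set" where
  "tensor_ideal A B = Idl\<^bsub>monoid_algebra (A \<times>\<times> B)\<^esub>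
    ({Poly_Mapping.single (a \<oplus>\<^bsub>A\<^esub> a', b) 1 - Poly_Mapping.single (a, b) 1
        - Poly_Mapping.single (a', b) 1
        | a a' b. a \<in> carrier A \<and> a' \<in> carrier A \<and> b \<in> carrier B}
   \<union> {Poly_Mapping.single (a, b \<oplus>\<^bsub>B\<^esub> b') 1 - Poly_Mapping.single (a, b) 1
        - Poly_Mapping.single (a, b') 1
        | a b b'. a \<in> carrier A \<and> b \<in> carrier B \<and> b' \<in> carrier B}
   \<union> {Poly_Mapping.single (c \<odot>\<^bsub>A\<^esub> a, b) 1 - Poly_Mapping.single (a, b) c
        | c a b. a \<in> carrier A \<and> b \<in> carrier B}
   \<union> {Poly_Mapping.single (a, c \<odot>\<^bsub>B\<^esub> b) 1 - Poly_Mapping.single (a, b) c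
        | c a b. a \<in> carrier A \<and> b \<in> carrier B})"

definition tensor_algebra ::
    "('k::field, 'a) module \<Rightarrow> ('k, 'b) module \<Rightarrow> ('k, ('a \<times> 'b \<Rightarrow>\<^sub>0 'k) set) module" where
  "tensor_algebra A B = monoid_algebra (A \<times>\<times> B) Quota tensor_ideal A B"

definition pure_tensor ::
    "('k::field, 'a) module \<Rightarrow> ('k, 'b) module \<Rightarrow> 'a \<Rightarrow> 'b \<Rightarrow> ('a \<times> 'b \<Rightarrow>\<^sub>0 'k) set" where
  "pure_tensor A B a b =
     tensor_ideal A B +>\<^bsub>monoid_algebra (A \<times>\<times> B)\<^esub> Poly_Mapping.single (a, b) 1"

section \<open>Superalgebras and the Grassmann envelope\<close>

locale superalgebra = assoc_algebra B
  for B :: "('k::field, 'b) module" (structure) and B0 B1 :: "'b set" +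
  assumes even_subspace: "subspace_of B0 B"
    and odd_subspace: "subspace_of B1 B"
    and sum_parts: "B0 <+>\<^bsub>B\<^esub> B1 = carrier B"
    and direct_parts: "B0 \<inter> B1 = {\<zero>}"
    and even_even: "x \<in> B0 \<Longrightarrow> y \<in> B0 \<Longrightarrow> x \<otimes> y \<in> B0"
    and even_odd: "x \<in> B0 \<Longrightarrow> y \<in> B1 \<Longrightarrow> x \<otimes> y \<in> B1"
    and odd_even: "x \<in> B1 \<Longrightarrow> y \<in> B0 \<Longrightarrow> x \<otimes> y \<in> B1"
    and odd_odd: "x \<in> B1 \<Longrightarrow> y \<in> B1 \<Longrightarrow> x \<otimes> y \<in> B0"

text \<open>
  Grassmann algebra of the space \<open>V\<close> with basis \<open>e\<^sub>0, e\<^sub>1, \<dots>\<close>: the tensor algebra of \<open>V\<close>, i.e. the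
  free algebra on the \<open>e\<^sub>i\<close>, modulo the ideal generated by all \<open>v v\<close> with \<open>v \<in> V\<close>; here \<open>V\<close> consists
  of the elements supported on words of length 1.
\<close>

definition grassmann_ideal :: "(nat list \<Rightarrow>\<^sub>0 'k::field) set" where
  "grassmann_ideal = Idl\<^bsub>free_algebra UNIV\<^esub>
     {v \<otimes>\<^bsub>free_algebra UNIV\<^esub> v | v. \<forall>w\<in>Poly_Mapping.keys v. length w = 1}"

definition grassmann :: "('k::field, (nat list \<Rightarrow>\<^sub>0 'k) set) module" where
  "grassmann = free_algebra UNIV Quota grassmann_ideal"

definition grassmann_even :: "(nat list \<Rightarrow>\<^sub>0 'k::field) set set" where
  "grassmann_even =
     {grassmann_ideal +>\<^bsub>free_algebra UNIV\<^esub> f | f. \<forall>w\<in>Poly_Mapping.keys f. even (length w)}"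

definition grassmann_odd :: "(nat list \<Rightarrow>\<^sub>0 'k::field) set set" where
  "grassmann_odd =
     {grassmann_ideal +>\<^bsub>free_algebra UNIV\<^esub> f | f. \<forall>w\<in>Poly_Mapping.keys f. odd (length w)}"

definition tensor_subspace ::
    "('k::field, 'a) module \<Rightarrow> ('k, 'b) module \<Rightarrow> 'a set \<Rightarrow> 'b set \<Rightarrow> ('a \<times> 'b \<Rightarrow>\<^sub>0 'k) set set" where
  "tensor_subspace A B U W =
     span_of (tensor_algebra A B) {pure_tensor A B a b | a b. a \<in> U \<and> b \<in> W}"

definition grassmann_envelope ::
    "('k::field, 'b) module \<Rightarrow> 'b set \<Rightarrow> 'b set
      \<Rightarrow> ('k, ((nat list \<Rightarrow>\<^sub>0 'k) set \<times> 'b \<Rightarrow>\<^sub>0 'k) set) module" where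
  "grassmann_envelope B B0 B1 = (tensor_algebra grassmann B)
     \<lparr>carrier := tensor_subspace grassmann B grassmann_even B0
                   <+>\<^bsub>tensor_algebra grassmann B\<^esub> tensor_subspace grassmann B grassmann_odd B1\<rparr>"

section \<open>The free supercommutative algebra\<close>

text \<open>
  Even generators are tagged with \<open>Inl\<close>, odd ones with \<open>Inr\<close>. The relator for generators \<open>a\<close>, \<open>b\<close> is
  \<open>ab - (-1)^(deg a * deg b) ba\<close>, written with the words \<open>[a, b]\<close> and \<open>[b, a]\<close>.
\<close>

definition gen_degree :: "'x + 'y \<Rightarrow> nat" where
  "gen_degree z = (case z of Inl _ \<Rightarrow> 0 | Inr _ \<Rightarrow> 1)"

definition supercomm_ideal :: "'x set \<Rightarrow> 'y set \<Rightarrow> (('x + 'y) list \<Rightarrow>\<^sub>0 'k::field) set" where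
  "supercomm_ideal Xs Ys = Idl\<^bsub>free_algebra (Sum_Type.Plus Xs Ys)\<^esub>
     {Poly_Mapping.single [a, b] 1
        - Poly_Mapping.single [b, a] ((- 1) ^ (gen_degree a * gen_degree b))
        | a b. a \<in> Sum_Type.Plus Xs Ys \<and> b \<in> Sum_Type.Plus Xs Ys}"

definition free_supercomm ::
    "'x set \<Rightarrow> 'y set \<Rightarrow> ('k::field, (('x + 'y) list \<Rightarrow>\<^sub>0 'k) set) module" where
  "free_supercomm Xs Ys = free_algebra (Sum_Type.Plus Xs Ys) Quota supercomm_ideal Xs Ys"

definition supercomm_gen ::
    "'x set \<Rightarrow> 'y set \<Rightarrow> 'x + 'y \<Rightarrow> (('x + 'y) list \<Rightarrow>\<^sub>0 'k::field) set" where
  "supercomm_gen Xs Ys z =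
     supercomm_ideal Xs Ys +>\<^bsub>free_algebra (Sum_Type.Plus Xs Ys)\<^esub> Poly_Mapping.single [z] 1"

section \<open>T-ideals and relatively free algebras\<close>

text \<open>The variables \<open>t\<^sub>1, t\<^sub>2, \<dots>\<close> are represented by the indices \<open>1, 2, \<dots>\<close>.\<close>

definition eval_poly ::
    "('k::field, 'a) module \<Rightarrow> ('v \<Rightarrow> 'a) \<Rightarrow> ('v list \<Rightarrow>\<^sub>0 'k) \<Rightarrow> 'a" where
  "eval_poly A \<phi> f =
     (\<Oplus>\<^bsub>A\<^esub>w\<in>Poly_Mapping.keys f. Poly_Mapping.lookup f w \<odot>\<^bsub>A\<^esub> foldr (\<lambda>t a. \<phi> t \<otimes>\<^bsub>A\<^esub> a) w \<one>\<^bsub>A\<^esub>)"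

definition T_ideal :: "('k::field, 'a) module \<Rightarrow> (nat list \<Rightarrow>\<^sub>0 'k) set" where
  "T_ideal A = {f \<in> carrier (free_algebra {1..}).
                  \<forall>\<phi> \<in> {1..} \<rightarrow> carrier A. eval_poly A \<phi> f = \<zero>\<^bsub>A\<^esub>}"

definition relatively_free ::
    "('k::field, 'a) module \<Rightarrow> ('k, (nat list \<Rightarrow>\<^sub>0 'k) set) module" where
  "relatively_free A = free_algebra {1..} Quota T_ideal A"

definition relatively_free_rank ::
    "nat \<Rightarrow> ('k::field, 'a) module \<Rightarrow> ('k, (nat list \<Rightarrow>\<^sub>0 'k) set) module" where
  "relatively_free_rank n A =
     free_algebra {1..n} Quota (T_ideal A \<inter> carrier (free_algebra {1..n}))"

section \<open>Generic elements\<close>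

text \<open>The index pair \<open>(i, j)\<close> stands for the variable with upper index \<open>i\<close> and lower index \<open>j\<close>.\<close>

abbreviation gen_indices :: "nat \<Rightarrow> (nat \<times> nat) set" where
  "gen_indices m \<equiv> {1..} \<times> {1..m}"

abbreviation generic_coeffs ::
    "nat \<Rightarrow> nat \<Rightarrow> ('k::field, ((nat \<times> nat + nat \<times> nat) list \<Rightarrow>\<^sub>0 'k) set) module" where
  "generic_coeffs r s \<equiv> free_supercomm (gen_indices r) (gen_indices s)"

definition generic_element ::
    "('k::field, 'b) module \<Rightarrow> nat \<Rightarrow> (nat \<Rightarrow> 'b) \<Rightarrow> nat \<Rightarrow> (nat \<Rightarrow> 'b) \<Rightarrow> nat
      \<Rightarrow> ('b \<times> ((nat \<times> nat + nat \<times> nat) list \<Rightarrow>\<^sub>0 'k) set \<Rightarrow>\<^sub>0 'k) set" where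
  "generic_element B r u s v i =
     (let P = generic_coeffs r s;
          T = tensor_algebra B P;
          x = (\<lambda>j. supercomm_gen (gen_indices r) (gen_indices s) (Inl (i, j)));
          y = (\<lambda>j. supercomm_gen (gen_indices r) (gen_indices s) (Inr (i, j)))
      in (\<Oplus>\<^bsub>T\<^esub>j\<in>{1..r}. pure_tensor B P (u j) (x j)) \<oplus>\<^bsub>T\<^esub>
         (\<Oplus>\<^bsub>T\<^esub>j\<in>{1..s}. pure_tensor B P (v j) (y j)))"

end

theory Submission
  imports Defs "HOL-Library.Countable" "HOL-Library.Infinite_Set"
begin

text \<open>
  Multiplying elements \<open>\<Sum>\<^sub>j b\<^sub>j \<otimes> a\<^sub>j\<close> of \<open>B \<otimes> A\<close>, with \<open>b\<^sub>j\<close> a basis of \<open>B\<close>, uses only the structure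
  constants of \<open>B\<close> and the multiplication of \<open>A\<close>. Hence for a polynomial \<open>f\<close> there are polynomials
  \<open>p\<^sub>j\<close> (\<open>coord_poly\<close>) in the letters \<open>x\<^sup>(\<^sup>i\<^sup>)\<^sub>j\<close>, \<open>y\<^sup>(\<^sup>i\<^sup>)\<^sub>j\<close>, depending only on \<open>f\<close> and \<open>B\<close>, that give the
  coordinates of every value of \<open>f\<close> (\<open>eval_poly_comb\<close>). Applied to \<open>B \<otimes> K[X;Y]\<close> this says that
  \<open>f(\<xi>\<^sub>1, \<xi>\<^sub>2, \<dots>) = 0\<close> iff all \<open>p\<^sub>j\<close> vanish in \<open>K[X;Y]\<close>; applied to \<open>G \<otimes> B\<close> it says that \<open>f\<close> is an
  identity of the Grassmann envelope iff all \<open>p\<^sub>j\<close> vanish whenever even elements of \<open>G\<close> are substituted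
  for the \<open>x\<close> and odd ones for the \<open>y\<close>.

  So everything reduces to the statement that the graded identities of \<open>G\<close> are exactly the
  consequences of supercommutativity (\<open>supercomm_ideal_iff_grassmann_identity\<close>). Supercommutativity of
  \<open>G\<close> gives one half. For the other half let \<open>q\<close> be a graded identity. Substitute for each \<open>x\<close> the
  \<open>k\<close>-th power of a prime of its own, and for each \<open>y\<close> a generator of \<open>G\<close> of its own. A word \<open>w\<close>
  becomes \<open>N\<^sub>w\<^sup>k\<close> times the word of its odd letters, where the integer \<open>N\<^sub>w\<close> encodes the multiset of its
  even letters. In characteristic other than 2 the squares of odd linear forms vanish in
  \<open>K[X;Y]\<close>, so the generators of \<open>G\<close> can be sent back to the \<open>y\<close>; the result is one linear relation in
  \<open>K[X;Y]\<close> for each \<open>k\<close>. Since different \<open>N\<^sub>w\<close> are different elements of a field of characteristic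
  zero, these relations hold separately for the words with each given \<open>N\<^sub>w\<close>
  (\<open>power_sums_coefficients\<close>), and multiplying by the common even part recovers \<open>q = 0\<close>.

  Consequently the T-ideal of the envelope is the kernel of \<open>t\<^sub>i \<mapsto> \<xi>\<^sub>i\<close> (\<open>T_ideal_envelope\<close>), and the two
  isomorphisms are instances of the first isomorphism theorem, for the variables \<open>t\<^sub>1, t\<^sub>2, \<dots>\<close> and
  for \<open>t\<^sub>1, \<dots>, t\<^sub>n\<close>.
\<close>

section \<open>Algebras over a field\<close>

abbreviation keys :: "('w \<Rightarrow>\<^sub>0 'k::zero) \<Rightarrow> 'w set" where "keys \<equiv> Poly_Mapping.keys"
abbreviation lookup :: "('w \<Rightarrow>\<^sub>0 'k::zero) \<Rightarrow> 'w \<Rightarrow> 'k" where "lookup \<equiv> Poly_Mapping.lookup"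
abbreviation single :: "'w \<Rightarrow> 'k \<Rightarrow> ('w \<Rightarrow>\<^sub>0 'k::zero)" where "single \<equiv> Poly_Mapping.single"

lemma carrier_type_algebra [simp]: "carrier (ring_of_type_algebra :: 'k::field ring) = UNIV"
  and add_type_algebra [simp]: "c \<oplus>\<^bsub>(ring_of_type_algebra :: 'k::field ring)\<^esub> d = c + d"
  and mult_type_algebra [simp]: "c \<otimes>\<^bsub>(ring_of_type_algebra :: 'k::field ring)\<^esub> d = c * d"
  and zero_type_algebra [simp]: "\<zero>\<^bsub>(ring_of_type_algebra :: 'k::field ring)\<^esub> = 0"
  and one_type_algebra [simp]: "\<one>\<^bsub>(ring_of_type_algebra :: 'k::field ring)\<^esub> = 1"
  by (simp_all add: ring_of_type_algebra_def)

lemma (in abelian_monoid) finsum_swap: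
  assumes "finite S" "finite S'" "\<And>i j. i \<in> S \<Longrightarrow> j \<in> S' \<Longrightarrow> f i j \<in> carrier G"
  shows "(\<Oplus>i\<in>S. \<Oplus>j\<in>S'. f i j) = (\<Oplus>j\<in>S'. \<Oplus>i\<in>S. f i j)"
  using assms(1,3)
proof (induction S)
  case empty
  then show ?case by simp
next
  case (insert x F)
  have "(\<Oplus>i\<in>insert x F. \<Oplus>j\<in>S'. f i j) = (\<Oplus>j\<in>S'. f x j) \<oplus> (\<Oplus>j\<in>S'. \<Oplus>i\<in>F. f i j)"
    using insert by (subst finsum_insert) (auto intro!: finsum_closed)
  also have "\<dots> = (\<Oplus>j\<in>S'. f x j \<oplus> (\<Oplus>i\<in>F. f i j))"
    using insert by (subst finsum_addf) (auto intro!: finsum_closed)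
  also have "\<dots> = (\<Oplus>j\<in>S'. \<Oplus>i\<in>insert x F. f i j)"
    using insert by (intro finsum_cong') (auto intro!: finsum_closed finsum_insert[symmetric])
  finally show ?case .
qed

lemma (in ring) finsum_product:
  assumes "finite S" "finite S'" "x \<in> S \<rightarrow> carrier R" "y \<in> S' \<rightarrow> carrier R"
  shows "(\<Oplus>i\<in>S. x i) \<otimes> (\<Oplus>j\<in>S'. y j) = (\<Oplus>i\<in>S. \<Oplus>j\<in>S'. x i \<otimes> y j)"
proof -
  have cl: "x i \<in> carrier R" if "i \<in> S" for i using assms(3) that by blast
  have "(\<Oplus>i\<in>S. x i) \<otimes> (\<Oplus>j\<in>S'. y j) = (\<Oplus>i\<in>S. x i \<otimes> (\<Oplus>j\<in>S'. y j))"
    by (intro finsum_ldistr finsum_closed assms)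
  also have "\<dots> = (\<Oplus>i\<in>S. \<Oplus>j\<in>S'. x i \<otimes> y j)"
    using cl assms(4) by (intro finsum_cong' refl finsum_rdistr assms) (auto intro!: finsum_closed)
  finally show ?thesis .
qed

lemma (in abelian_monoid) finsum_delta:
  assumes "finite S" "x \<in> carrier G"
  shows "(\<Oplus>j\<in>S. if i = j then x else \<zero>) = (if i \<in> S then x else \<zero>)"
proof (cases "i \<in> S")
  case True
  then show ?thesis using finsum_singleton[of i S "\<lambda>_. x"] assms by simp
next
  case False
  then have "(\<Oplus>j\<in>S. if i = j then x else \<zero>) = (\<Oplus>j\<in>S. \<zero>)"
    using assms by (intro finsum_cong') auto
  with False show ?thesis by simp
qed

text \<open>
  The axioms of an associative algebra without the scalar ring as a record. In \<open>assoc_algebra\<close> two rings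
  are in scope, and unqualified facts such as \<open>m_assoc\<close> speak of the scalars; here they speak of \<open>A\<close>.
\<close>

locale kalgebra = ring A
  for A :: "('k::field, 'a) module" (structure) +
  assumes smult_in [simp, intro]: "x \<in> carrier A \<Longrightarrow> c \<odot> x \<in> carrier A"
    and smult_add_left: "x \<in> carrier A \<Longrightarrow> (c + d) \<odot> x = c \<odot> x \<oplus> d \<odot> x"
    and smult_add_right: "x \<in> carrier A \<Longrightarrow> y \<in> carrier A \<Longrightarrow> c \<odot> (x \<oplus> y) = c \<odot> x \<oplus> c \<odot> y"
    and smult_smult: "x \<in> carrier A \<Longrightarrow> c \<odot> (d \<odot> x) = (c * d) \<odot> x"
    and one_smult [simp]: "x \<in> carrier A \<Longrightarrow> 1 \<odot> x = x"
    and smult_mult_left: "x \<in> carrier A \<Longrightarrow> y \<in> carrier A \<Longrightarrow> (c \<odot> x) \<otimes> y = c \<odot> (x \<otimes> y)"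
    and smult_mult_right: "x \<in> carrier A \<Longrightarrow> y \<in> carrier A \<Longrightarrow> x \<otimes> (c \<odot> y) = c \<odot> (x \<otimes> y)"

lemma assoc_algebra_iff_kalgebra: "assoc_algebra A \<longleftrightarrow> kalgebra (A :: ('k::field, 'a) module)"
proof
  assume "assoc_algebra A"
  then interpret assoc_algebra A .
  show "kalgebra A"
    using assoc_algebra.axioms(1)[OF assoc_algebra_axioms]
      smult_closed smult_l_distr smult_r_distr smult_assoc1 smult_one
      smult_mult_left smult_mult_right
    by (simp add: kalgebra_def kalgebra_axioms_def)
next
  assume "kalgebra A"
  then interpret kalgebra A .
  have "module (ring_of_type_algebra :: 'k ring) A"
    by (rule moduleI)
      (auto simp: cring_from_type_algebra is_abelian_group smult_add_left smult_add_right smult_smult)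
  then show "assoc_algebra A"
    by (simp add: assoc_algebra_def assoc_algebra_axioms_def ring_axioms
        smult_mult_left smult_mult_right)
qed

context kalgebra
begin

lemma module_axioms': "module (ring_of_type_algebra :: 'k ring) A"
  using assoc_algebra.axioms(2) kalgebra_axioms assoc_algebra_iff_kalgebra by blast

lemma zero_smult [simp]: "x \<in> carrier A \<Longrightarrow> 0 \<odot> x = \<zero>"
  and smult_zero [simp]: "c \<odot> \<zero> = \<zero>"
  using module.smult_l_null[OF module_axioms', of x] module.smult_r_null[OF module_axioms', of c] by simp_all

lemma uminus_smult: "x \<in> carrier A \<Longrightarrow> (- 1) \<odot> x = \<ominus> x"
  using module.smult_l_minus[OF module_axioms', of 1 x]
  by (metis add.inv_equality one_smult smult_add_left smult_in zero_smult add.left_inverse)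

lemma smult_finsum:
  "finite S \<Longrightarrow> f \<in> S \<rightarrow> carrier A \<Longrightarrow> c \<odot> (\<Oplus>i\<in>S. f i) = (\<Oplus>i\<in>S. c \<odot> f i)"
  by (rule module.finsum_smult_ldistr[OF module_axioms']) auto

lemma smult_eq_zeroD:
  assumes "x \<in> carrier A" "c \<odot> x = \<zero>" "c \<noteq> 0"
  shows "x = \<zero>"
proof -
  have "x = (inverse c * c) \<odot> x" using assms by simp
  also have "\<dots> = inverse c \<odot> (c \<odot> x)" using assms(1) smult_smult by simp
  finally show ?thesis using assms by simp
qed

lemma subspace_ofI:
  assumes "W \<subseteq> carrier A" "\<zero> \<in> W" "\<And>x y. x \<in> W \<Longrightarrow> y \<in> W \<Longrightarrow> x \<oplus> y \<in> W"
    and smW: "\<And>c x. x \<in> W \<Longrightarrow> c \<odot> x \<in> W"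
  shows "subspace_of W A"
  unfolding subspace_of_def
proof (rule module.submoduleI[OF module_axioms'])
  fix a assume "a \<in> W"
  then show "\<ominus> a \<in> W" using smW[of a "-1"] uminus_smult assms(1) by auto
qed (use assms in auto)

lemma subspace_of_subset: "subspace_of W A \<Longrightarrow> W \<subseteq> carrier A"
  and subspace_of_zero: "subspace_of W A \<Longrightarrow> \<zero> \<in> W"
  and subspace_of_add: "subspace_of W A \<Longrightarrow> x \<in> W \<Longrightarrow> y \<in> W \<Longrightarrow> x \<oplus> y \<in> W"
  and subspace_of_smult: "subspace_of W A \<Longrightarrow> x \<in> W \<Longrightarrow> c \<odot> x \<in> W"
  unfolding subspace_of_def submodule_def submodule_axioms_def
  using subgroup.subset[of W "add_monoid A"]
  by (auto dest: subgroup.one_closed subgroup.m_closed)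

lemma subspace_of_finsum:
  assumes "subspace_of W A" "finite S" "f \<in> S \<rightarrow> W"
  shows "(\<Oplus>i\<in>S. f i) \<in> W"
  using assms(2,3)
proof (induction S)
  case (insert x F)
  then show ?case using subspace_of_subset[OF assms(1)]
    by (subst finsum_insert) (auto intro!: subspace_of_add[OF assms(1)])
qed (simp add: subspace_of_zero[OF assms(1)])

text \<open>Scaling by \<open>c\<close> is multiplication by \<open>c \<odot> \<one>\<close>, so ideals are closed under it.\<close>

lemma ideal_subspace_of:
  assumes "ideal I A"
  shows "subspace_of I A"
proof -
  interpret I: ideal I A by fact
  show ?thesis
  proof (rule subspace_ofI)
    fix c x assume x: "x \<in> I"
    then have "c \<odot> x = (c \<odot> \<one>) \<otimes> x" using I.a_subset by (subst smult_mult_left) auto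
    then show "c \<odot> x \<in> I" using I.I_l_closed[OF x, of "c \<odot> \<one>"] by simp
  qed (use I.a_subset in auto)
qed

lemma subalgebra_kalgebra:
  assumes "subring C A" "subspace_of C A"
  shows "kalgebra (A\<lparr>carrier := C\<rparr>)"
proof -
  have "ring (A\<lparr>carrier := C\<rparr>)" using subring_is_ring assms(1) by blast
  then show ?thesis
    unfolding kalgebra_def kalgebra_axioms_def
    using subspace_of_subset[OF assms(2)] subspace_of_smult[OF assms(2)]
    by (auto simp: smult_add_left smult_add_right smult_smult smult_mult_left smult_mult_right subset_iff)
qed

end

section \<open>Linear extension\<close>

text \<open>
  Evaluation of polynomials, the coset maps of the free algebras and the linear maps that a bilinear map
  induces on a tensor product are all of this form.
\<close>

definition lin_ext :: "('k::field, 'a) module \<Rightarrow> ('w \<Rightarrow> 'a) \<Rightarrow> ('w \<Rightarrow>\<^sub>0 'k) \<Rightarrow> 'a" where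
  "lin_ext A h f = (\<Oplus>\<^bsub>A\<^esub>w\<in>keys f. lookup f w \<odot>\<^bsub>A\<^esub> h w)"

abbreviation scale :: "'k::field \<Rightarrow> ('w \<Rightarrow>\<^sub>0 'k) \<Rightarrow> ('w \<Rightarrow>\<^sub>0 'k)" where
  "scale c f \<equiv> Poly_Mapping.map ((*) c) f"

lemma lookup_scale [simp]: "lookup (scale c f) w = c * lookup f w"
  by transfer (simp add: when_def)

lemma keys_scale: "keys (scale c f) \<subseteq> keys f"
  by (auto simp: in_keys_iff)

lemma scale_add: "scale c (f + g) = scale c f + scale c g"
  by (rule poly_mapping_eqI) (simp add: lookup_add algebra_simps)

lemma scale_single [simp]: "scale c (single w d) = single w (c * d)"
  by (rule poly_mapping_eqI) (simp add: lookup_single when_def)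

lemma poly_mapping_sum_single:
  "finite S \<Longrightarrow> keys f \<subseteq> S \<Longrightarrow> f = (\<Sum>w\<in>S. single w (lookup f w))"
proof (rule poly_mapping_eqI)
  fix k assume S: "finite S" "keys f \<subseteq> S"
  have "(\<Sum>w\<in>S. lookup (single w (lookup f w)) k)
      = (\<Sum>w\<in>S. if w = k then lookup f k else 0)"
    by (rule sum.cong) (auto simp: lookup_single when_def)
  then show "lookup f k = lookup (\<Sum>w\<in>S. single w (lookup f w)) k"
    using S by (auto simp: lookup_sum in_keys_iff)
qed

text \<open>Induction for properties that are additive: it is the way to extend facts about words by linearity.\<close>

lemma poly_mapping_single_induct [consumes 1, case_names zero single add]:
  fixes f :: "'w \<Rightarrow>\<^sub>0 'k::comm_monoid_add"
  assumes "keys f \<subseteq> V"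
    and "P 0"
    and single: "\<And>w c. w \<in> V \<Longrightarrow> P (single w c)"
    and add: "\<And>f g. keys f \<subseteq> V \<Longrightarrow> keys g \<subseteq> V \<Longrightarrow> P f \<Longrightarrow> P g \<Longrightarrow> P (f + g)"
  shows "P f"
proof -
  have "P (\<Sum>w\<in>S. single w (lookup f w))
      \<and> keys (\<Sum>w\<in>S. single w (lookup f w)) \<subseteq> V"
    if "finite S" "S \<subseteq> V" for S
    using that
  proof (induction S)
    case empty
    then show ?case using assms(2) by simp
  next
    case (insert x F)
    then show ?case
      using keys_add[of "single x (lookup f x)"
          "\<Sum>w\<in>F. single w (lookup f w)"] single[of x]
      by (auto intro!: add split: if_splits)
  qed
  from this[of "keys f"] assms(1) show ?thesis
    using poly_mapping_sum_single[of "keys f" f] by simp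
qed

context kalgebra
begin

lemma lin_ext_superset:
  assumes "finite S" "keys f \<subseteq> S" "h \<in> S \<rightarrow> carrier A"
  shows "lin_ext A h f = (\<Oplus>w\<in>S. lookup f w \<odot> h w)"
  unfolding lin_ext_def using assms
  by (intro add.finprod_mono_neutral_cong_left) (auto simp: in_keys_iff Pi_iff)

lemma lin_ext_closed [intro]:
  "h \<in> keys f \<rightarrow> carrier A \<Longrightarrow> lin_ext A h f \<in> carrier A"
  unfolding lin_ext_def by (rule finsum_closed) auto

lemma lin_ext_zero [simp]: "lin_ext A h 0 = \<zero>"
  by (simp add: lin_ext_def)

lemma lin_ext_add:
  assumes "h \<in> keys f \<union> keys g \<rightarrow> carrier A"
  shows "lin_ext A h (f + g) = lin_ext A h f \<oplus> lin_ext A h g"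
proof -
  let ?S = "keys f \<union> keys g"
  have "lin_ext A h (f + g) = (\<Oplus>w\<in>?S. lookup f w \<odot> h w \<oplus> lookup g w \<odot> h w)"
    using assms keys_add[of f g]
    by (subst lin_ext_superset[of ?S])
      (auto simp: lookup_add smult_add_left Pi_iff simp del: finsum_addf intro!: finsum_cong')
  also have "\<dots> = (\<Oplus>w\<in>?S. lookup f w \<odot> h w) \<oplus> (\<Oplus>w\<in>?S. lookup g w \<odot> h w)"
    using assms by (intro finsum_addf) (auto simp: Pi_iff)
  also have "\<dots> = lin_ext A h f \<oplus> lin_ext A h g"
    using assms by (subst (1 2) lin_ext_superset[of ?S]) auto
  finally show ?thesis .
qed

lemma lin_ext_scale:
  assumes "h \<in> keys f \<rightarrow> carrier A"
  shows "lin_ext A h (scale c f) = c \<odot> lin_ext A h f"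
proof -
  have "lin_ext A h (scale c f) = (\<Oplus>w\<in>keys f. c \<odot> (lookup f w \<odot> h w))"
    using assms keys_scale[of c f]
    by (subst lin_ext_superset[of "keys f"]) (auto simp: smult_smult Pi_iff intro!: finsum_cong')
  also have "\<dots> = c \<odot> lin_ext A h f"
    unfolding lin_ext_def using assms by (intro smult_finsum[symmetric]) auto
  finally show ?thesis .
qed

lemma lin_ext_single [simp]:
  assumes "h w \<in> carrier A"
  shows "lin_ext A h (single w c) = c \<odot> h w"
  using assms by (subst lin_ext_superset[of "{w}"]) (auto split: if_splits)

lemma lin_ext_diff:
  assumes "h \<in> keys f \<union> keys g \<rightarrow> carrier A"
  shows "lin_ext A h (f - g) = lin_ext A h f \<ominus> lin_ext A h g"
proof -
  have e: "f - g = f + scale (- 1) g"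
    by (rule poly_mapping_eqI) (simp add: lookup_minus lookup_add)
  have "lin_ext A h (scale (- 1) g) = \<ominus> lin_ext A h g"
    using assms by (subst lin_ext_scale) (auto intro!: uminus_smult)
  moreover have "lin_ext A h (f + scale (- 1) g) = lin_ext A h f \<oplus> lin_ext A h (scale (- 1) g)"
    using assms keys_scale[of "-1" g] by (intro lin_ext_add) auto
  ultimately show ?thesis unfolding e by (simp add: minus_eq)
qed

lemma lin_ext_sum:
  assumes "finite S" "\<And>i. i \<in> S \<Longrightarrow> keys (f i) \<subseteq> V" "h \<in> V \<rightarrow> carrier A"
  shows "lin_ext A h (\<Sum>i\<in>S. f i) = (\<Oplus>i\<in>S. lin_ext A h (f i))"
  using assms(1,2)
proof (induction S)
  case (insert x F)
  have "keys (\<Sum>i\<in>F. f i) \<subseteq> V"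
    using insert keys_sum[of f F] by blast
  then have "lin_ext A h (f x + (\<Sum>i\<in>F. f i)) = lin_ext A h (f x) \<oplus> lin_ext A h (\<Sum>i\<in>F. f i)"
    using insert.prems[of x] assms(3) by (intro lin_ext_add) auto
  moreover have "lin_ext A h (f i) \<in> carrier A" if "i \<in> insert x F" for i
    using insert.prems[OF that] assms(3) by (intro lin_ext_closed) auto
  ultimately show ?case
    using insert by (subst finsum_insert) auto
qed simp

lemma lin_ext_cong:
  assumes "\<And>w. w \<in> keys f \<Longrightarrow> h w = h' w" "h' \<in> keys f \<rightarrow> carrier A"
  shows "lin_ext A h f = lin_ext A h' f"
  unfolding lin_ext_def using assms by (intro finsum_cong') auto

end

section \<open>Homomorphisms of algebras\<close>

locale algebra_hom = A: kalgebra A + C: kalgebra C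
  for A :: "('k::field, 'a) module" and C :: "('k, 'c) module" and h +
  assumes hom: "h \<in> ring_hom A C"
    and hom_smult: "x \<in> carrier A \<Longrightarrow> h (c \<odot>\<^bsub>A\<^esub> x) = c \<odot>\<^bsub>C\<^esub> h x"
begin

sublocale ring_hom_ring A C h
  by (rule ring_hom_ringI2) (use hom A.ring_axioms C.ring_axioms in auto)

lemma hom_finsum_closed:
  assumes "finite S" "f \<in> S \<rightarrow> carrier A"
  shows "h (\<Oplus>\<^bsub>A\<^esub>i\<in>S. f i) = (\<Oplus>\<^bsub>C\<^esub>i\<in>S. h (f i))"
  using assms
proof (induction S)
  case (insert x F)
  then show ?case using hom_closed
    by (subst A.finsum_insert, simp_all, subst C.finsum_insert) (auto simp: Pi_iff)
qed simp

lemma hom_lin_ext: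
  assumes "g \<in> keys f \<rightarrow> carrier A"
  shows "h (lin_ext A g f) = lin_ext C (\<lambda>w. h (g w)) f"
  unfolding lin_ext_def using assms
  by (subst hom_finsum_closed) (auto simp: hom_smult Pi_iff intro!: C.finsum_cong')

end

abbreviation word_prod :: "('k::field, 'a) module \<Rightarrow> ('v \<Rightarrow> 'a) \<Rightarrow> 'v list \<Rightarrow> 'a" where
  "word_prod A \<phi> w \<equiv> foldr (\<lambda>t a. \<phi> t \<otimes>\<^bsub>A\<^esub> a) w \<one>\<^bsub>A\<^esub>"

lemma eval_poly_lin_ext: "eval_poly A \<phi> = lin_ext A (word_prod A \<phi>)"
  by (simp add: eval_poly_def lin_ext_def fun_eq_iff)

context kalgebra
begin

lemma word_prod_closed:
  "\<phi> \<in> V \<rightarrow> carrier A \<Longrightarrow> w \<in> lists V \<Longrightarrow> word_prod A \<phi> w \<in> carrier A"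
  by (induction w) auto

lemma word_prod_append:
  assumes "\<phi> \<in> V \<rightarrow> carrier A"
  shows "w \<in> lists V \<Longrightarrow> w' \<in> lists V
    \<Longrightarrow> word_prod A \<phi> (w @ w') = word_prod A \<phi> w \<otimes> word_prod A \<phi> w'"
proof (induction w)
  case Nil
  then show ?case using word_prod_closed[OF assms] by (simp del: foldr.simps(2))
next
  case (Cons t w)
  then have "word_prod A \<phi> w \<in> carrier A" "word_prod A \<phi> w' \<in> carrier A" "\<phi> t \<in> carrier A"
    using word_prod_closed[OF assms] assms by auto
  with Cons show ?case by (simp add: m_assoc)
qed

end

lemma (in algebra_hom) hom_word_prod:
  "\<phi> \<in> V \<rightarrow> carrier A \<Longrightarrow> w \<in> lists V \<Longrightarrow> h (word_prod A \<phi> w) = word_prod C (\<lambda>t. h (\<phi> t)) w"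
proof (induction w)
  case (Cons t w)
  then have "word_prod A \<phi> w \<in> carrier A" "\<phi> t \<in> carrier A"
    using A.word_prod_closed[of \<phi> V w] by auto
  with Cons show ?case by simp
qed simp

lemma (in algebra_hom) hom_eval_poly:
  assumes "\<phi> \<in> V \<rightarrow> carrier A" "keys f \<subseteq> lists V"
  shows "h (eval_poly A \<phi> f) = eval_poly C (\<lambda>t. h (\<phi> t)) f"
proof -
  have "h (eval_poly A \<phi> f) = lin_ext C (\<lambda>w. h (word_prod A \<phi> w)) f"
    unfolding eval_poly_lin_ext using A.word_prod_closed[OF assms(1)] assms(2)
    by (intro hom_lin_ext) blast
  also have "\<dots> = lin_ext C (word_prod C (\<lambda>t. h (\<phi> t))) f"
  proof (rule C.lin_ext_cong)
    fix w assume "w \<in> keys f"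
    then have w: "w \<in> lists V" using assms(2) by blast
    show "h (word_prod A \<phi> w) = word_prod C (\<lambda>t. h (\<phi> t)) w"
      by (rule hom_word_prod[OF assms(1) w])
  next
    show "word_prod C (\<lambda>t. h (\<phi> t)) \<in> keys f \<rightarrow> carrier C"
      using assms C.word_prod_closed[of "\<lambda>t. h (\<phi> t)" V] hom_closed
      by (simp add: Pi_iff) blast
  qed
  finally show ?thesis by (simp add: eval_poly_lin_ext)
qed

section \<open>Monoid algebras\<close>

lemma monoid_algebra_carrier [simp]: "carrier (monoid_algebra M) = {f. keys f \<subseteq> carrier M}"
  and monoid_algebra_one [simp]: "\<one>\<^bsub>monoid_algebra M\<^esub> = single \<one>\<^bsub>M\<^esub> 1"
  and monoid_algebra_zero [simp]: "\<zero>\<^bsub>monoid_algebra M\<^esub> = 0"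
  and monoid_algebra_add [simp]: "f \<oplus>\<^bsub>monoid_algebra M\<^esub> g = f + g"
  and monoid_algebra_smult [simp]: "c \<odot>\<^bsub>monoid_algebra M\<^esub> f = scale c f"
  by (simp_all add: monoid_algebra_def)

text \<open>Enlarging the index sets to common supersets makes the product visibly bilinear.\<close>

lemma monoid_algebra_mult_superset:
  assumes "finite S" "finite S'" "keys f \<subseteq> S" "keys g \<subseteq> S'"
  shows "f \<otimes>\<^bsub>monoid_algebra M\<^esub> g = (\<Sum>a\<in>S. \<Sum>b\<in>S'.
    single (a \<otimes>\<^bsub>M\<^esub> b) (lookup f a * lookup g b))"
proof -
  have "f \<otimes>\<^bsub>monoid_algebra M\<^esub> g = (\<Sum>a\<in>keys f. \<Sum>b\<in>keys g.
      single (a \<otimes>\<^bsub>M\<^esub> b) (lookup f a * lookup g b))"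
    by (simp add: monoid_algebra_def)
  also have "\<dots> = (\<Sum>a\<in>keys f. \<Sum>b\<in>S'.
      single (a \<otimes>\<^bsub>M\<^esub> b) (lookup f a * lookup g b))"
    using assms by (intro sum.cong sum.mono_neutral_left) (auto simp: in_keys_iff)
  also have "\<dots> = (\<Sum>a\<in>S. \<Sum>b\<in>S'.
      single (a \<otimes>\<^bsub>M\<^esub> b) (lookup f a * lookup g b))"
    using assms by (intro sum.mono_neutral_left) (auto simp: in_keys_iff)
  finally show ?thesis .
qed

lemma monoid_algebra_mult_single [simp]:
  "single a c \<otimes>\<^bsub>monoid_algebra M\<^esub> single b d
    = single (a \<otimes>\<^bsub>M\<^esub> b) (c * d)"
  by (subst monoid_algebra_mult_superset[of "{a}" "{b}"]) (auto split: if_splits)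

lemma monoid_algebra_mult_add_left:
  "(f + f') \<otimes>\<^bsub>monoid_algebra M\<^esub> g = f \<otimes>\<^bsub>monoid_algebra M\<^esub> g + f' \<otimes>\<^bsub>monoid_algebra M\<^esub> g"
proof -
  let ?S = "keys f \<union> keys f'"
  show ?thesis
    using keys_add[of f f']
    by (subst (1 2 3) monoid_algebra_mult_superset[of ?S "keys g"])
      (auto simp: lookup_add single_add algebra_simps sum.distrib)
qed

lemma monoid_algebra_mult_add_right:
  "g \<otimes>\<^bsub>monoid_algebra M\<^esub> (f + f') = g \<otimes>\<^bsub>monoid_algebra M\<^esub> f + g \<otimes>\<^bsub>monoid_algebra M\<^esub> f'"
proof -
  let ?S = "keys f \<union> keys f'"
  show ?thesis
    using keys_add[of f f']
    by (subst (1 2 3) monoid_algebra_mult_superset[of "keys g" ?S])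
      (auto simp: lookup_add single_add algebra_simps sum.distrib)
qed

lemma monoid_algebra_mult_zero [simp]:
  "0 \<otimes>\<^bsub>monoid_algebra M\<^esub> g = 0" "g \<otimes>\<^bsub>monoid_algebra M\<^esub> 0 = 0"
  by (simp_all add: monoid_algebra_def)

lemma scale_sum: "scale c (\<Sum>i\<in>S. f i) = (\<Sum>i\<in>S. scale c (f i))"
  by (rule poly_mapping_eqI) (simp add: lookup_sum sum_distrib_left)

lemma keys_uminus [simp]:
  fixes f :: "'w \<Rightarrow>\<^sub>0 'k::ab_group_add"
  shows "keys (- f) = keys f"
  by (simp add: set_eq_iff in_keys_iff)

lemma keys_add_subset: "keys f \<subseteq> V \<Longrightarrow> keys g \<subseteq> V \<Longrightarrow> keys (f + g) \<subseteq> V"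
  using keys_add[of f g] by blast

lemma keys_scale_subset: "keys f \<subseteq> V \<Longrightarrow> keys (scale c f) \<subseteq> V"
  using keys_scale[of c f] by blast

lemma keys_sum_subset:
  "(\<And>i. i \<in> S \<Longrightarrow> keys (f i) \<subseteq> V) \<Longrightarrow> keys (\<Sum>i\<in>S. f i) \<subseteq> V"
  using keys_sum[of f S] by blast

context Group.monoid
begin

lemma monoid_algebra_mult_closed:
  assumes "keys f \<subseteq> carrier G" "keys g \<subseteq> carrier G"
  shows "keys (f \<otimes>\<^bsub>monoid_algebra G\<^esub> g) \<subseteq> carrier G"
  using assms
  by (subst monoid_algebra_mult_superset[OF finite_keys finite_keys order.refl order.refl])
    (auto intro!: keys_sum_subset m_closed split: if_splits)

lemma monoid_algebra_assoc:
  assumes "keys f \<subseteq> carrier G" "keys g \<subseteq> carrier G"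
    "keys k \<subseteq> carrier G"
  shows "(f \<otimes>\<^bsub>monoid_algebra G\<^esub> g) \<otimes>\<^bsub>monoid_algebra G\<^esub> k
    = f \<otimes>\<^bsub>monoid_algebra G\<^esub> (g \<otimes>\<^bsub>monoid_algebra G\<^esub> k)"
  using assms(1)
proof (induction f rule: poly_mapping_single_induct)
  case (single w c)
  show ?case using assms(2)
  proof (induction g rule: poly_mapping_single_induct)
    case (single w' c')
    show ?case using assms(3)
    proof (induction k rule: poly_mapping_single_induct)
      case (single w'' c'')
      then show ?case using \<open>w \<in> carrier G\<close> \<open>w' \<in> carrier G\<close> by (simp add: m_assoc mult.assoc)
    qed (simp_all add: monoid_algebra_mult_add_left monoid_algebra_mult_add_right)
  qed (simp_all add: monoid_algebra_mult_add_left monoid_algebra_mult_add_right)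
qed (simp_all add: monoid_algebra_mult_add_left monoid_algebra_mult_add_right)

lemma monoid_algebra_scale_left:
  "scale c f \<otimes>\<^bsub>monoid_algebra G\<^esub> g = scale c (f \<otimes>\<^bsub>monoid_algebra G\<^esub> g)"
  by (subst (1 2) monoid_algebra_mult_superset[of "keys f" "keys g"])
    (auto simp: keys_scale scale_sum algebra_simps)

lemma monoid_algebra_scale_right:
  "g \<otimes>\<^bsub>monoid_algebra G\<^esub> scale c f = scale c (g \<otimes>\<^bsub>monoid_algebra G\<^esub> f)"
  by (subst (1 2) monoid_algebra_mult_superset[of "keys g" "keys f"])
    (auto simp: keys_scale scale_sum algebra_simps)

lemma kalgebra_monoid_algebra: "kalgebra (monoid_algebra G :: ('k::field, 'a \<Rightarrow>\<^sub>0 'k) module)"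
proof -
  let ?A = "monoid_algebra G :: ('k, 'a \<Rightarrow>\<^sub>0 'k) module"
  have r: "ring ?A"
  proof (rule ringI)
    show "abelian_group ?A"
    proof (rule abelian_groupI)
      fix f :: "'a \<Rightarrow>\<^sub>0 'k" assume "f \<in> carrier ?A"
      then show "\<exists>y\<in>carrier ?A. y \<oplus>\<^bsub>?A\<^esub> f = \<zero>\<^bsub>?A\<^esub>" by (intro bexI[of _ "- f"]) simp_all
    qed (simp_all add: keys_add_subset add.assoc add.commute)
    show "Group.monoid ?A"
    proof (rule monoidI)
      fix f :: "'a \<Rightarrow>\<^sub>0 'k" assume "f \<in> carrier ?A"
      then have f: "keys f \<subseteq> carrier G" by simp
      show "\<one>\<^bsub>?A\<^esub> \<otimes>\<^bsub>?A\<^esub> f = f" using f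
        by (induction f rule: poly_mapping_single_induct)
          (simp_all add: monoid_algebra_mult_add_right)
      show "f \<otimes>\<^bsub>?A\<^esub> \<one>\<^bsub>?A\<^esub> = f" using f
        by (induction f rule: poly_mapping_single_induct)
          (simp_all add: monoid_algebra_mult_add_left)
    qed (simp_all add: monoid_algebra_assoc monoid_algebra_mult_closed)
  qed (simp_all add: monoid_algebra_mult_add_left monoid_algebra_mult_add_right)
  have "scale (c + d) f = scale c f + scale d f" for c d :: 'k and f :: "'a \<Rightarrow>\<^sub>0 'k"
    by (rule poly_mapping_eqI) (simp add: lookup_add algebra_simps)
  moreover have "scale c (scale d f) = scale (c * d) f" for c d :: 'k and f :: "'a \<Rightarrow>\<^sub>0 'k"
    by (rule poly_mapping_eqI) (simp add: algebra_simps)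
  moreover have "scale 1 f = f" for f :: "'a \<Rightarrow>\<^sub>0 'k"
    by (rule poly_mapping_eqI) simp
  ultimately show ?thesis
    unfolding kalgebra_def kalgebra_axioms_def using r
    by (simp add: keys_scale_subset scale_add monoid_algebra_scale_left monoid_algebra_scale_right)
qed

end

lemma finsum_monoid_algebra:
  assumes "Group.monoid M" "finite S" "\<And>i. i \<in> S \<Longrightarrow> keys (f i) \<subseteq> carrier M"
  shows "(\<Oplus>\<^bsub>monoid_algebra M\<^esub>i\<in>S. f i) = (\<Sum>i\<in>S. f i)"
proof -
  interpret kalgebra "monoid_algebra M" using monoid.kalgebra_monoid_algebra[OF assms(1)] .
  show ?thesis using assms(2,3)
  proof (induction S)
    case (insert x F)
    then show ?case by (subst finsum_insert) auto
  qed simp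
qed

lemma uminus_monoid_algebra:
  assumes "Group.monoid M" "keys f \<subseteq> carrier M"
  shows "\<ominus>\<^bsub>monoid_algebra M\<^esub> f = - f"
proof -
  interpret kalgebra "monoid_algebra M" using monoid.kalgebra_monoid_algebra[OF assms(1)] .
  show ?thesis using assms(2) by (intro minus_equality) simp_all
qed

text \<open>Universal property of the monoid algebra: both sides are bilinear, so it suffices to compare on monoid elements.\<close>

lemma (in kalgebra) lin_ext_monoid_algebra_hom:
  assumes M: "Group.monoid M" and \<psi>: "\<psi> \<in> carrier M \<rightarrow> carrier A" "\<psi> \<one>\<^bsub>M\<^esub> = \<one>"
    and mult: "\<And>a b. a \<in> carrier M \<Longrightarrow> b \<in> carrier M \<Longrightarrow> \<psi> (a \<otimes>\<^bsub>M\<^esub> b) = \<psi> a \<otimes> \<psi> b"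
  shows "algebra_hom (monoid_algebra M) A (lin_ext A \<psi>)"
proof -
  interpret M: Group.monoid M by fact
  interpret MA: kalgebra "monoid_algebra M" by (rule M.kalgebra_monoid_algebra)
  have cl: "lin_ext A \<psi> f \<in> carrier A" if "keys f \<subseteq> carrier M" for f
    using that \<psi> by (intro lin_ext_closed) auto
  have ad: "lin_ext A \<psi> (f + g) = lin_ext A \<psi> f \<oplus> lin_ext A \<psi> g"
    if "keys f \<subseteq> carrier M" "keys g \<subseteq> carrier M" for f g
    using that \<psi> by (intro lin_ext_add) auto
  have si: "lin_ext A \<psi> (single w c) = c \<odot> \<psi> w" if "w \<in> carrier M" for w c
    using that \<psi> by (intro lin_ext_single) auto
  have "lin_ext A \<psi> (f \<otimes>\<^bsub>monoid_algebra M\<^esub> g) = lin_ext A \<psi> f \<otimes> lin_ext A \<psi> g"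
    if f: "keys f \<subseteq> carrier M" and g: "keys g \<subseteq> carrier M" for f g
  proof -
    let ?m = "\<lambda>a b. single (a \<otimes>\<^bsub>M\<^esub> b) (lookup f a * lookup g b)"
    have \<psi>': "\<psi> a \<in> carrier A" if "a \<in> carrier M" for a using \<psi>(1) that by blast
    have m: "keys (?m a b) \<subseteq> carrier M" if "a \<in> keys f" "b \<in> keys g" for a b
      using that f g by auto
    have "lin_ext A \<psi> (f \<otimes>\<^bsub>monoid_algebra M\<^esub> g) = lin_ext A \<psi> (\<Sum>a\<in>keys f. \<Sum>b\<in>keys g. ?m a b)"
      by (simp add: monoid_algebra_def)
    also have "\<dots> = (\<Oplus>a\<in>keys f. lin_ext A \<psi> (\<Sum>b\<in>keys g. ?m a b))"
      by (rule lin_ext_sum[OF finite_keys keys_sum_subset[OF m] \<psi>(1)])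
    also have "\<dots> = (\<Oplus>a\<in>keys f. \<Oplus>b\<in>keys g. lin_ext A \<psi> (?m a b))"
      using cl[OF m] by (intro finsum_cong' refl lin_ext_sum[OF finite_keys m \<psi>(1)]) (auto intro!: finsum_closed)
    also have "\<dots> = (\<Oplus>a\<in>keys f. \<Oplus>b\<in>keys g. (lookup f a \<odot> \<psi> a) \<otimes> (lookup g b \<odot> \<psi> b))"
    proof (intro finsum_cong' refl Pi_I finsum_closed)
      fix a b assume "a \<in> keys f" "b \<in> keys g"
      then have ab: "a \<in> carrier M" "b \<in> carrier M" using f g by blast+
      show "lin_ext A \<psi> (?m a b) = (lookup f a \<odot> \<psi> a) \<otimes> (lookup g b \<odot> \<psi> b)"
        using ab \<psi>' by (simp add: si mult smult_mult_left smult_mult_right smult_smult mult.commute)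
      show "(lookup f a \<odot> \<psi> a) \<otimes> (lookup g b \<odot> \<psi> b) \<in> carrier A"
        "(lookup f a \<odot> \<psi> a) \<otimes> (lookup g b \<odot> \<psi> b) \<in> carrier A" using ab \<psi>' by simp_all
    qed
    also have "\<dots> = lin_ext A \<psi> f \<otimes> lin_ext A \<psi> g"
      unfolding lin_ext_def using f g \<psi>' by (intro finsum_product[symmetric]) auto
    finally show ?thesis .
  qed
  then have "lin_ext A \<psi> \<in> ring_hom (monoid_algebra M) A"
    using cl ad si[of "\<one>\<^bsub>M\<^esub>" 1] \<psi> by (intro ring_hom_memI) auto
  moreover have "lin_ext A \<psi> (scale c f) = c \<odot> lin_ext A \<psi> f"
    if "keys f \<subseteq> carrier M" for c f
    using that \<psi> by (intro lin_ext_scale) auto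
  ultimately show ?thesis
    by (intro algebra_hom.intro algebra_hom_axioms.intro MA.kalgebra_axioms kalgebra_axioms) auto
qed

section \<open>Free algebras\<close>

lemma word_monoid_simps [simp]:
  "carrier (word_monoid V) = lists V" "w \<otimes>\<^bsub>word_monoid V\<^esub> w' = w @ w'" "\<one>\<^bsub>word_monoid V\<^esub> = []"
  by (simp_all add: word_monoid_def)

lemma monoid_word_monoid: "Group.monoid (word_monoid V)"
  by (rule monoidI) auto

lemma kalgebra_free_algebra: "kalgebra (free_algebra V)"
  unfolding free_algebra_def by (rule monoid.kalgebra_monoid_algebra[OF monoid_word_monoid])

lemma free_algebra_simps [simp]:
  "carrier (free_algebra V) = {f. keys f \<subseteq> lists V}"
  "\<one>\<^bsub>free_algebra V\<^esub> = single [] 1"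
  "\<zero>\<^bsub>free_algebra V\<^esub> = 0" "f \<oplus>\<^bsub>free_algebra V\<^esub> g = f + g"
  "c \<odot>\<^bsub>free_algebra V\<^esub> f = scale c f"
  "single w c \<otimes>\<^bsub>free_algebra V\<^esub> single w' d = single (w @ w') (c * d)"
  by (simp_all add: free_algebra_def)

lemma (in kalgebra) eval_poly_hom:
  assumes "\<phi> \<in> V \<rightarrow> carrier A"
  shows "algebra_hom (free_algebra V) A (eval_poly A \<phi>)"
  unfolding eval_poly_lin_ext free_algebra_def
  using word_prod_closed[OF assms] word_prod_append[OF assms]
  by (intro lin_ext_monoid_algebra_hom monoid_word_monoid) auto

lemma (in kalgebra) eval_poly_closed:
  assumes "\<phi> \<in> V \<rightarrow> carrier A" "keys f \<subseteq> lists V"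
  shows "eval_poly A \<phi> f \<in> carrier A"
  unfolding eval_poly_lin_ext
proof (rule lin_ext_closed, rule Pi_I)
  fix w assume "w \<in> keys f"
  with assms(2) show "word_prod A \<phi> w \<in> carrier A" by (intro word_prod_closed[OF assms(1)]) auto
qed

lemma (in kalgebra) eval_poly_single:
  assumes "\<phi> \<in> V \<rightarrow> carrier A" "w \<in> lists V"
  shows "eval_poly A \<phi> (single w c) = c \<odot> word_prod A \<phi> w"
  unfolding eval_poly_lin_ext using word_prod_closed[OF assms] by (rule lin_ext_single)

lemma word_prod_free_algebra:
  "word_prod (free_algebra V) (\<lambda>t. single [t] 1) w = single w 1"
  by (induction w) simp_all

lemma eval_poly_free_algebra:
  assumes "keys f \<subseteq> lists V"
  shows "eval_poly (free_algebra V) (\<lambda>t. single [t] 1) f = f"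
proof -
  interpret kalgebra "free_algebra V" by (rule kalgebra_free_algebra)
  have gens: "(\<lambda>t. single [t] 1) \<in> V \<rightarrow> carrier (free_algebra V)" by auto
  interpret algebra_hom "free_algebra V" "free_algebra V" "eval_poly (free_algebra V) (\<lambda>t. single [t] 1)"
    by (rule eval_poly_hom[OF gens])
  show ?thesis using assms
  proof (induction f rule: poly_mapping_single_induct)
    case zero
    then show ?case using hom_zero by simp
  next
    case (single w c)
    then show ?case
      using eval_poly_single[of "\<lambda>t. single [t] 1" V w c] by (simp add: word_prod_free_algebra[simplified])
  next
    case (add f g)
    then show ?case using hom_add[of f g] by simp
  qed
qed

section \<open>Quotient algebras\<close>

locale algebra_ideal = kalgebra A + I: ideal I A for A :: "('k::field, 'a) module" (structure) and I
begin

lemma quota_simps: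
  "carrier (A Quota I) = carrier (A Quot I)" "\<one>\<^bsub>A Quota I\<^esub> = \<one>\<^bsub>A Quot I\<^esub>"
  "\<zero>\<^bsub>A Quota I\<^esub> = \<zero>\<^bsub>A Quot I\<^esub>" "x' \<oplus>\<^bsub>A Quota I\<^esub> y' = x' \<oplus>\<^bsub>A Quot I\<^esub> y'"
  "x' \<otimes>\<^bsub>A Quota I\<^esub> y' = x' \<otimes>\<^bsub>A Quot I\<^esub> y'"
  by (simp_all add: quotient_algebra_def)

lemma quota_carrier: "carrier (A Quota I) = (\<lambda>x. I +> x) ` carrier A"
  by (auto simp: quota_simps FactRing_def A_RCOSETS_def')

lemma coset_closed [simp]: "x \<in> carrier A \<Longrightarrow> I +> x \<in> carrier (A Quota I)"
  by (simp add: quota_carrier)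

lemma quota_carrierE:
  assumes "x' \<in> carrier (A Quota I)"
  obtains x where "x \<in> carrier A" "x' = I +> x"
  using assms by (auto simp: quota_carrier)

lemma quota_ops [simp]:
  "\<one>\<^bsub>A Quota I\<^esub> = I +> \<one>" "\<zero>\<^bsub>A Quota I\<^esub> = I"
  "x \<in> carrier A \<Longrightarrow> y \<in> carrier A \<Longrightarrow> (I +> x) \<oplus>\<^bsub>A Quota I\<^esub> (I +> y) = I +> (x \<oplus> y)"
  "x \<in> carrier A \<Longrightarrow> y \<in> carrier A \<Longrightarrow> (I +> x) \<otimes>\<^bsub>A Quota I\<^esub> (I +> y) = I +> (x \<otimes> y)"
  by (simp_all add: quota_simps FactRing_def I.a_rcos_sum I.rcoset_mult_add)

lemma coset_zero_iff: "x \<in> carrier A \<Longrightarrow> I +> x = I \<longleftrightarrow> x \<in> I"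
  using I.a_rcos_const[of x] I.a_rcos_self[of x] by auto

lemma coset_smult [simp]:
  assumes "x \<in> carrier A"
  shows "c \<odot>\<^bsub>A Quota I\<^esub> (I +> x) = I +> (c \<odot> x)"
proof -
  have "I +> (c \<odot> y) = I +> (c \<odot> x)" if "y \<in> I +> x" for y
  proof -
    from that obtain i where i: "i \<in> I" "y = i \<oplus> x" by (auto simp: a_r_coset_def')
    then have "c \<odot> y = c \<odot> i \<oplus> c \<odot> x" using assms I.a_subset by (auto simp: smult_add_right)
    moreover have "c \<odot> i \<in> I"
      using subspace_of_smult[OF ideal_subspace_of[OF I.ideal_axioms] i(1)] .
    ultimately have "c \<odot> y \<in> I +> (c \<odot> x)" by (auto simp: a_r_coset_def')
    then show ?thesis using I.a_repr_independence'[of _ "c \<odot> x"] assms by simp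
  qed
  then have "(\<Union>y\<in>I +> x. I +> (c \<odot> y)) = (\<Union>y\<in>I +> x. I +> (c \<odot> x))" by simp
  moreover have "I +> x \<noteq> {}" using I.a_rcos_self[OF assms] by auto
  ultimately show ?thesis by (simp add: quotient_algebra_def)
qed

lemma kalgebra_quota: "kalgebra (A Quota I)"
proof -
  interpret Q: ring "A Quot I" by (rule I.quotient_is_ring)
  have inverse: "\<exists>y\<in>carrier (A Quot I). y \<oplus>\<^bsub>A Quot I\<^esub> x = \<zero>\<^bsub>A Quot I\<^esub>" if "x \<in> carrier (A Quot I)" for x
    by (intro bexI[of _ "\<ominus>\<^bsub>A Quot I\<^esub> x"] Q.l_neg Q.a_inv_closed that)
  have r: "ring (A Quota I)"
    by (intro ringI abelian_groupI monoidI; unfold quota_simps)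
      (fact Q.a_closed Q.zero_closed Q.a_assoc Q.a_comm Q.l_zero Q.m_closed Q.one_closed Q.m_assoc
        Q.l_one Q.r_one Q.l_distr Q.r_distr inverse)+
  show ?thesis
  proof (intro kalgebra.intro kalgebra_axioms.intro r)
    fix c d x' y' assume "x' \<in> carrier (A Quota I)" "y' \<in> carrier (A Quota I)"
    then obtain x y where xy: "x \<in> carrier A" "x' = I +> x" "y \<in> carrier A" "y' = I +> y"
      by (elim quota_carrierE)
    show "c \<odot>\<^bsub>A Quota I\<^esub> x' \<in> carrier (A Quota I)" "1 \<odot>\<^bsub>A Quota I\<^esub> x' = x'"
      "c \<odot>\<^bsub>A Quota I\<^esub> (d \<odot>\<^bsub>A Quota I\<^esub> x') = (c * d) \<odot>\<^bsub>A Quota I\<^esub> x'"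
      "(c + d) \<odot>\<^bsub>A Quota I\<^esub> x' = c \<odot>\<^bsub>A Quota I\<^esub> x' \<oplus>\<^bsub>A Quota I\<^esub> d \<odot>\<^bsub>A Quota I\<^esub> x'"
      using xy by (simp_all add: smult_smult smult_add_left)
    show "c \<odot>\<^bsub>A Quota I\<^esub> (x' \<oplus>\<^bsub>A Quota I\<^esub> y') = c \<odot>\<^bsub>A Quota I\<^esub> x' \<oplus>\<^bsub>A Quota I\<^esub> c \<odot>\<^bsub>A Quota I\<^esub> y'"
      "(c \<odot>\<^bsub>A Quota I\<^esub> x') \<otimes>\<^bsub>A Quota I\<^esub> y' = c \<odot>\<^bsub>A Quota I\<^esub> (x' \<otimes>\<^bsub>A Quota I\<^esub> y')"
      "x' \<otimes>\<^bsub>A Quota I\<^esub> (c \<odot>\<^bsub>A Quota I\<^esub> y') = c \<odot>\<^bsub>A Quota I\<^esub> (x' \<otimes>\<^bsub>A Quota I\<^esub> y')"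
      using xy by (simp_all add: smult_add_right smult_mult_left smult_mult_right)
  qed
qed

lemma coset_hom: "algebra_hom A (A Quota I) (\<lambda>x. I +> x)"
proof (rule algebra_hom.intro[OF kalgebra_axioms kalgebra_quota], rule algebra_hom_axioms.intro)
  show "(\<lambda>x. I +> x) \<in> ring_hom A (A Quota I)"
    by (rule ring_hom_memI) (simp_all only: coset_closed quota_ops)
qed (simp only: coset_smult)

end

lemma (in kalgebra) algebra_ideal_genideal: "S \<subseteq> carrier A \<Longrightarrow> algebra_ideal A (Idl S)"
  by (rule algebra_ideal.intro[OF kalgebra_axioms genideal_ideal])

lemma (in algebra_hom) genideal_kernel:
  assumes "S \<subseteq> carrier A" "\<And>x. x \<in> S \<Longrightarrow> h x = \<zero>\<^bsub>C\<^esub>" "x \<in> Idl\<^bsub>A\<^esub> S"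
  shows "h x = \<zero>\<^bsub>C\<^esub>"
proof -
  have "S \<subseteq> a_kernel A C h" using assms(1,2) unfolding a_kernel_def' by blast
  then have "Idl\<^bsub>A\<^esub> S \<subseteq> a_kernel A C h" by (rule A.genideal_minimal[OF kernel_is_ideal])
  then show ?thesis using assms(3) unfolding a_kernel_def' by blast
qed

section \<open>Generated subalgebras and the first isomorphism theorem\<close>

text \<open>
  The isomorphism sends a value of \<open>h\<close> to its fibre, which is a coset of the kernel. This direction
  makes injectivity immediate: a nonempty fibre determines the value.
\<close>

lemma (in algebra_hom) image_iso_quotient:
  "C\<lparr>carrier := h ` carrier A\<rparr> \<cong>\<^sub>a A Quota (a_kernel A C h)"
proof -
  define J where "J = a_kernel A C h"
  interpret J: algebra_ideal A J
    unfolding J_def by (rule algebra_ideal.intro[OF A.kalgebra_axioms kernel_is_ideal])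
  define g where "g y = {x \<in> carrier A. h x = y}" for y
  have g_h: "g (h x) = J +>\<^bsub>A\<^esub> x" if x: "x \<in> carrier A" for x
  proof (rule Set.set_eqI)
    fix z show "z \<in> g (h x) \<longleftrightarrow> z \<in> J +>\<^bsub>A\<^esub> x"
    proof (cases "z \<in> carrier A")
      case True
      have "z \<in> J +>\<^bsub>A\<^esub> x \<longleftrightarrow> z \<ominus>\<^bsub>A\<^esub> x \<in> J"
        using J.I.a_rcos_module_minus[OF A.ring_axioms x True] .
      also have "\<dots> \<longleftrightarrow> h (z \<ominus>\<^bsub>A\<^esub> x) = \<zero>\<^bsub>C\<^esub>"
        using A.minus_closed[OF True x] by (simp only: J_def a_kernel_def' mem_Collect_eq simp_thms)
      also have "h (z \<ominus>\<^bsub>A\<^esub> x) = h z \<ominus>\<^bsub>C\<^esub> h x"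
        using x True by (simp only: a_minus_def hom_add A.a_inv_closed hom_a_inv)
      also have "h z \<ominus>\<^bsub>C\<^esub> h x = \<zero>\<^bsub>C\<^esub> \<longleftrightarrow> h z = h x"
        using x True by (intro C.r_right_minus_eq hom_closed)
      also have "\<dots> \<longleftrightarrow> z \<in> g (h x)"
        using True by (simp only: g_def mem_Collect_eq simp_thms)
      finally show ?thesis by (rule sym)
    next
      case False
      moreover have "J +>\<^bsub>A\<^esub> x \<subseteq> carrier A"
        by (rule A.a_r_coset_subset_G[OF J.I.a_subset x])
      ultimately show ?thesis by (auto simp only: g_def)
    qed
  qed
  have "g \<in> ring_hom (C\<lparr>carrier := h ` carrier A\<rparr>) (A Quota J)"
  proof (rule ring_hom_memI)
    fix y z assume "y \<in> carrier (C\<lparr>carrier := h ` carrier A\<rparr>)" "z \<in> carrier (C\<lparr>carrier := h ` carrier A\<rparr>)"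
    then obtain x x' where *: "y = h x" "x \<in> carrier A" "z = h x'" "x' \<in> carrier A" by auto
    show "g (y \<otimes>\<^bsub>C\<lparr>carrier := h ` carrier A\<rparr>\<^esub> z) = g y \<otimes>\<^bsub>A Quota J\<^esub> g z"
      using * g_h[of "x \<otimes>\<^bsub>A\<^esub> x'"] by (simp add: g_h)
    show "g (y \<oplus>\<^bsub>C\<lparr>carrier := h ` carrier A\<rparr>\<^esub> z) = g y \<oplus>\<^bsub>A Quota J\<^esub> g z"
      using * g_h[of "x \<oplus>\<^bsub>A\<^esub> x'"] by (simp add: g_h)
    show "g y \<in> carrier (A Quota J)"
      using * by (simp add: g_h)
  next
    show "g \<one>\<^bsub>C\<lparr>carrier := h ` carrier A\<rparr>\<^esub> = \<one>\<^bsub>A Quota J\<^esub>"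
      using g_h[of "\<one>\<^bsub>A\<^esub>"] by simp
  qed
  moreover have "inj_on g (h ` carrier A)"
    by (rule inj_onI) (auto simp: g_def set_eq_iff)
  moreover have "g ` (h ` carrier A) = carrier (A Quota J)"
    using g_h by (simp add: J.quota_carrier image_image)
  moreover have "g (c \<odot>\<^bsub>C\<^esub> h x) = c \<odot>\<^bsub>A Quota J\<^esub> g (h x)" if "x \<in> carrier A" for c x
    using that g_h[of "c \<odot>\<^bsub>A\<^esub> x"] by (simp add: g_h hom_smult)
  ultimately show ?thesis
    unfolding algebra_isomorphic_def ring_iso_def J_def
    by (intro bexI[of _ g]) (simp_all add: bij_betw_def)
qed

text \<open>
  The values of polynomials form a subalgebra, and every subalgebra containing the \<open>\<phi> t\<close> contains the
  word products and their linear combinations.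
\<close>

lemma (in kalgebra) generated_subalgebra_eq_image:
  assumes \<phi>: "\<phi> \<in> V \<rightarrow> carrier A"
  shows "generated_subalgebra A (\<phi> ` V) = A\<lparr>carrier := eval_poly A \<phi> ` carrier (free_algebra V)\<rparr>"
proof -
  interpret hom: algebra_hom "free_algebra V" A "eval_poly A \<phi>" by (rule eval_poly_hom[OF \<phi>])
  let ?E = "eval_poly A \<phi> ` carrier (free_algebra V)"
  have sr: "subring ?E A"
    by (rule hom.img_is_subring[OF hom.A.carrier_is_subring])
  have ss: "subspace_of ?E A"
  proof (rule subspace_ofI)
    fix c x assume "x \<in> ?E"
    then obtain f where f: "f \<in> carrier (free_algebra V)" "x = eval_poly A \<phi> f" by blast
    then have "c \<odot> x = eval_poly A \<phi> (c \<odot>\<^bsub>free_algebra V\<^esub> f)" using hom.hom_smult[OF f(1), of c] by simp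
    then show "c \<odot> x \<in> ?E" using f(1) hom.A.smult_in by blast
  qed (use subringE[OF sr] in auto)
  have gens: "\<phi> ` V \<subseteq> ?E"
  proof
    fix y assume "y \<in> \<phi> ` V"
    then obtain t where t: "t \<in> V" "y = \<phi> t" by blast
    then have "\<phi> t \<in> carrier A" using \<phi> by auto
    then have "y = eval_poly A \<phi> (single [t] 1)"
      using t \<phi> by (subst eval_poly_single[of _ V]) auto
    moreover have "single [t] 1 \<in> carrier (free_algebra V)" using t by simp
    ultimately show "y \<in> ?E" by blast
  qed
  have "?E \<subseteq> H" if H: "subring H A" "subspace_of H A" "\<phi> ` V \<subseteq> H" for H
  proof
    fix y assume "y \<in> ?E"
    then obtain f where f: "keys f \<subseteq> lists V" "y = eval_poly A \<phi> f" by auto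
    have w: "word_prod A \<phi> w \<in> H" if "w \<in> lists V" for w
      using that H(3) subringE(3)[OF H(1)] subringE(6)[OF H(1)] by (induction w) auto
    have "lookup f w \<odot> word_prod A \<phi> w \<in> H" if "w \<in> keys f" for w
      using that f(1) w subspace_of_smult[OF H(2)] by blast
    then show "y \<in> H"
      unfolding f(2) eval_poly_def by (intro subspace_of_finsum[OF H(2)]) auto
  qed
  then have "\<Inter> {H. subring H A \<and> subspace_of H A \<and> \<phi> ` V \<subseteq> H} = ?E"
    using sr ss gens by blast
  then show ?thesis by (simp add: generated_subalgebra_def)
qed

lemma (in kalgebra) generated_subalgebra_iso:
  assumes \<phi>: "\<phi> \<in> V \<rightarrow> carrier A"
  shows "generated_subalgebra A (\<phi> ` V)
    \<cong>\<^sub>a free_algebra V Quota {f \<in> carrier (free_algebra V). eval_poly A \<phi> f = \<zero>}"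
proof -
  interpret hom: algebra_hom "free_algebra V" A "eval_poly A \<phi>" by (rule eval_poly_hom[OF \<phi>])
  show ?thesis
    using hom.image_iso_quotient unfolding generated_subalgebra_eq_image[OF \<phi>] a_kernel_def' .
qed

section \<open>Tensor products\<close>

lemma (in algebra_ideal) coset_eqI:
  assumes "x \<in> carrier A" "y \<in> carrier A" "x \<ominus> y \<in> I"
  shows "I +> x = I +> y"
proof -
  have "x \<in> I +> y" using I.a_rcos_module_minus[OF ring_axioms] assms by simp
  then show ?thesis using I.a_repr_independence' assms(2) by simp
qed

lemma minus_monoid_algebra:
  assumes "Group.monoid M" "keys g \<subseteq> carrier M"
  shows "f \<ominus>\<^bsub>monoid_algebra M\<^esub> g = f - g"
  using uminus_monoid_algebra[OF assms] by (simp add: a_minus_def)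

definition bilinear_map ::
    "('k::field, 'a) module \<Rightarrow> ('k, 'b) module \<Rightarrow> ('k, 'c) module \<Rightarrow> ('a \<Rightarrow> 'b \<Rightarrow> 'c) \<Rightarrow> bool" where
  "bilinear_map A B C \<beta> \<longleftrightarrow>
    (\<forall>a\<in>carrier A. \<forall>b\<in>carrier B. \<beta> a b \<in> carrier C) \<and>
    (\<forall>a\<in>carrier A. \<forall>a'\<in>carrier A. \<forall>b\<in>carrier B. \<beta> (a \<oplus>\<^bsub>A\<^esub> a') b = \<beta> a b \<oplus>\<^bsub>C\<^esub> \<beta> a' b) \<and>
    (\<forall>a\<in>carrier A. \<forall>b\<in>carrier B. \<forall>b'\<in>carrier B. \<beta> a (b \<oplus>\<^bsub>B\<^esub> b') = \<beta> a b \<oplus>\<^bsub>C\<^esub> \<beta> a b') \<and>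
    (\<forall>c. \<forall>a\<in>carrier A. \<forall>b\<in>carrier B. \<beta> (c \<odot>\<^bsub>A\<^esub> a) b = c \<odot>\<^bsub>C\<^esub> \<beta> a b) \<and>
    (\<forall>c. \<forall>a\<in>carrier A. \<forall>b\<in>carrier B. \<beta> a (c \<odot>\<^bsub>B\<^esub> b) = c \<odot>\<^bsub>C\<^esub> \<beta> a b)"

locale tensor_factors = A: kalgebra A + B: kalgebra B
  for A :: "('k::field, 'a) module" and B :: "('k, 'b) module"
begin

lemma monoid_prod: "Group.monoid (A \<times>\<times> B)"
  by (rule DirProd_monoid[OF A.monoid_axioms B.monoid_axioms])

lemma prod_simps [simp]:
  "carrier (A \<times>\<times> B) = carrier A \<times> carrier B" "\<one>\<^bsub>A \<times>\<times> B\<^esub> = (\<one>\<^bsub>A\<^esub>, \<one>\<^bsub>B\<^esub>)"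
  "(a, b) \<otimes>\<^bsub>A \<times>\<times> B\<^esub> (a', b') = (a \<otimes>\<^bsub>A\<^esub> a', b \<otimes>\<^bsub>B\<^esub> b')"
  by (simp_all add: DirProd_def)

abbreviation "relators \<equiv>
    {single (a \<oplus>\<^bsub>A\<^esub> a', b) 1 - single (a, b) 1
        - single (a', b) (1::'k)
        | a a' b. a \<in> carrier A \<and> a' \<in> carrier A \<and> b \<in> carrier B}
   \<union> {single (a, b \<oplus>\<^bsub>B\<^esub> b') 1 - single (a, b) 1
        - single (a, b') 1
        | a b b'. a \<in> carrier A \<and> b \<in> carrier B \<and> b' \<in> carrier B}
   \<union> {single (c \<odot>\<^bsub>A\<^esub> a, b) 1 - single (a, b) c
        | c a b. a \<in> carrier A \<and> b \<in> carrier B}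
   \<union> {single (a, c \<odot>\<^bsub>B\<^esub> b) 1 - single (a, b) c
        | c a b. a \<in> carrier A \<and> b \<in> carrier B}"

lemma keys_diff_subset:
  "keys f \<subseteq> V \<Longrightarrow> keys g \<subseteq> V \<Longrightarrow> keys (f - g :: _ \<Rightarrow>\<^sub>0 'k) \<subseteq> V"
  using keys_add_subset[of f V "- g"] by simp

lemma relators_subset: "relators \<subseteq> carrier (monoid_algebra (A \<times>\<times> B))"
  by (intro Un_least; clarify) (simp_all add: keys_diff_subset)

sublocale MA: kalgebra "monoid_algebra (A \<times>\<times> B)"
  by (rule monoid.kalgebra_monoid_algebra[OF monoid_prod])

sublocale tensor: algebra_ideal "monoid_algebra (A \<times>\<times> B)" "tensor_ideal A B"
  unfolding tensor_ideal_def by (rule MA.algebra_ideal_genideal[OF relators_subset])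

lemma kalgebra_tensor: "kalgebra (tensor_algebra A B)"
  unfolding tensor_algebra_def by (rule tensor.kalgebra_quota)

sublocale T: kalgebra "tensor_algebra A B"
  by (rule kalgebra_tensor)

lemma relator_in_tensor_ideal: "x \<in> relators \<Longrightarrow> x \<in> tensor_ideal A B"
  unfolding tensor_ideal_def using MA.genideal_self[OF relators_subset] by blast

lemma pure_tensor_closed [simp]:
  "a \<in> carrier A \<Longrightarrow> b \<in> carrier B \<Longrightarrow> pure_tensor A B a b \<in> carrier (tensor_algebra A B)"
  unfolding pure_tensor_def tensor_algebra_def by (rule tensor.coset_closed) simp

lemma pure_tensor_mult:
  "a \<in> carrier A \<Longrightarrow> b \<in> carrier B \<Longrightarrow> a' \<in> carrier A \<Longrightarrow> b' \<in> carrier B \<Longrightarrow>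
    pure_tensor A B a b \<otimes>\<^bsub>tensor_algebra A B\<^esub> pure_tensor A B a' b'
      = pure_tensor A B (a \<otimes>\<^bsub>A\<^esub> a') (b \<otimes>\<^bsub>B\<^esub> b')"
  unfolding pure_tensor_def tensor_algebra_def by (subst tensor.quota_ops) simp_all

lemma pure_tensor_one: "pure_tensor A B \<one>\<^bsub>A\<^esub> \<one>\<^bsub>B\<^esub> = \<one>\<^bsub>tensor_algebra A B\<^esub>"
  unfolding pure_tensor_def tensor_algebra_def by (subst tensor.quota_ops) simp

lemma coset_single_eqI:
  assumes "keys f \<subseteq> carrier A \<times> carrier B" "keys g \<subseteq> carrier A \<times> carrier B"
    "f - g \<in> relators"
  shows "tensor_ideal A B +>\<^bsub>monoid_algebra (A \<times>\<times> B)\<^esub> f = tensor_ideal A B +>\<^bsub>monoid_algebra (A \<times>\<times> B)\<^esub> g"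
  using assms relator_in_tensor_ideal[OF assms(3)]
  by (intro tensor.coset_eqI) (simp_all add: minus_monoid_algebra[OF monoid_prod])

lemma pure_tensor_add_left:
  assumes "a \<in> carrier A" "a' \<in> carrier A" "b \<in> carrier B"
  shows "pure_tensor A B (a \<oplus>\<^bsub>A\<^esub> a') b = pure_tensor A B a b \<oplus>\<^bsub>tensor_algebra A B\<^esub> pure_tensor A B a' b"
proof -
  have "tensor_ideal A B +>\<^bsub>monoid_algebra (A \<times>\<times> B)\<^esub> single (a \<oplus>\<^bsub>A\<^esub> a', b) 1
      = tensor_ideal A B +>\<^bsub>monoid_algebra (A \<times>\<times> B)\<^esub> (single (a, b) 1 + single (a', b) 1)"
    using assms by (intro coset_single_eqI keys_add_subset UnI1) (auto simp: diff_diff_eq[symmetric])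
  then show ?thesis
    unfolding pure_tensor_def tensor_algebra_def using assms by (subst tensor.quota_ops) simp_all
qed

lemma pure_tensor_add_right:
  assumes "a \<in> carrier A" "b \<in> carrier B" "b' \<in> carrier B"
  shows "pure_tensor A B a (b \<oplus>\<^bsub>B\<^esub> b') = pure_tensor A B a b \<oplus>\<^bsub>tensor_algebra A B\<^esub> pure_tensor A B a b'"
proof -
  have "tensor_ideal A B +>\<^bsub>monoid_algebra (A \<times>\<times> B)\<^esub> single (a, b \<oplus>\<^bsub>B\<^esub> b') 1
      = tensor_ideal A B +>\<^bsub>monoid_algebra (A \<times>\<times> B)\<^esub> (single (a, b) 1 + single (a, b') 1)"
    using assms by (intro coset_single_eqI keys_add_subset UnI1[OF UnI1[OF UnI2]]) (auto simp: diff_diff_eq[symmetric])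
  then show ?thesis
    unfolding pure_tensor_def tensor_algebra_def using assms by (subst tensor.quota_ops) simp_all
qed

lemma pure_tensor_smult_left:
  assumes "a \<in> carrier A" "b \<in> carrier B"
  shows "pure_tensor A B (c \<odot>\<^bsub>A\<^esub> a) b = c \<odot>\<^bsub>tensor_algebra A B\<^esub> pure_tensor A B a b"
proof -
  have "tensor_ideal A B +>\<^bsub>monoid_algebra (A \<times>\<times> B)\<^esub> single (c \<odot>\<^bsub>A\<^esub> a, b) 1
      = tensor_ideal A B +>\<^bsub>monoid_algebra (A \<times>\<times> B)\<^esub> single (a, b) c"
    using assms by (intro coset_single_eqI UnI1[OF UnI2]) auto
  then show ?thesis
    unfolding pure_tensor_def tensor_algebra_def using assms by (subst tensor.coset_smult) simp_all
qed

lemma pure_tensor_smult_right: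
  assumes "a \<in> carrier A" "b \<in> carrier B"
  shows "pure_tensor A B a (c \<odot>\<^bsub>B\<^esub> b) = c \<odot>\<^bsub>tensor_algebra A B\<^esub> pure_tensor A B a b"
proof -
  have "tensor_ideal A B +>\<^bsub>monoid_algebra (A \<times>\<times> B)\<^esub> single (a, c \<odot>\<^bsub>B\<^esub> b) 1
      = tensor_ideal A B +>\<^bsub>monoid_algebra (A \<times>\<times> B)\<^esub> single (a, b) c"
    using assms by (intro coset_single_eqI UnI2) auto
  then show ?thesis
    unfolding pure_tensor_def tensor_algebra_def using assms by (subst tensor.coset_smult) simp_all
qed

end

text \<open>
  The tensor product is a quotient by a two-sided ideal, while a bilinear map need not respect
  multiplication. The elements annihilated by \<^emph>\<open>all\<close> bilinear maps into \<open>C\<close> nevertheless form an ideal: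
  precomposing a bilinear map with multiplication by a pair \<open>(a, b)\<close> gives another bilinear map.
  The relators lie in this ideal.
\<close>

lemma (in tensor_factors) lin_ext_tensor_ideal:
  assumes C: "kalgebra C" and \<beta>: "bilinear_map A B C \<beta>" and x: "x \<in> tensor_ideal A B"
  shows "lin_ext C (\<lambda>(a, b). \<beta> a b) x = \<zero>\<^bsub>C\<^esub>"
proof -
  interpret C: kalgebra C by fact
  let ?M = "monoid_algebra (A \<times>\<times> B) :: ('k, _) module"
  let ?L = "\<lambda>\<beta>. lin_ext C (\<lambda>(a, b). \<beta> a b)"
  define J where "J = {f \<in> carrier ?M. \<forall>\<beta>. bilinear_map A B C \<beta> \<longrightarrow> ?L \<beta> f = \<zero>\<^bsub>C\<^esub>}"
  have cl: "\<beta> a b \<in> carrier C" if "bilinear_map A B C \<beta>" "a \<in> carrier A" "b \<in> carrier B" for \<beta> a b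
    using that by (simp add: bilinear_map_def)
  have L_closed: "?L \<beta> f \<in> carrier C" if "bilinear_map A B C \<beta>" "f \<in> carrier ?M" for \<beta> f
    using that cl by (intro C.lin_ext_closed) auto
  have L_add: "?L \<beta> (f + g) = ?L \<beta> f \<oplus>\<^bsub>C\<^esub> ?L \<beta> g"
    if "bilinear_map A B C \<beta>" "f \<in> carrier ?M" "g \<in> carrier ?M" for \<beta> f g
    using that cl by (intro C.lin_ext_add) auto
  have L_diff: "?L \<beta> (f - g) = ?L \<beta> f \<ominus>\<^bsub>C\<^esub> ?L \<beta> g"
    if "bilinear_map A B C \<beta>" "f \<in> carrier ?M" "g \<in> carrier ?M" for \<beta> f g
    using that cl by (intro C.lin_ext_diff) auto
  have L_single: "?L \<beta> (single (a, b) c) = c \<odot>\<^bsub>C\<^esub> \<beta> a b"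
    if "bilinear_map A B C \<beta>" "a \<in> carrier A" "b \<in> carrier B" for \<beta> a b c
    using that cl by (subst C.lin_ext_single) auto
  have J_add: "f + g \<in> J" if "f \<in> J" "g \<in> J" for f g
    using that keys_add_subset[of f _ g] L_add by (auto simp: J_def)
  have left: "single (a, b) c \<otimes>\<^bsub>?M\<^esub> f \<in> J"
    and right: "f \<otimes>\<^bsub>?M\<^esub> single (a, b) c \<in> J"
    if ab: "a \<in> carrier A" "b \<in> carrier B" and f: "f \<in> J" for a b c f
  proof -
    let ?s = "single (a, b) c"
    have s: "?s \<in> carrier ?M" using ab by simp
    have fM: "keys f \<subseteq> carrier A \<times> carrier B" using f by (simp add: J_def)
    have scaled: "?L (\<lambda>x y. c \<odot>\<^bsub>C\<^esub> \<beta> (a \<otimes>\<^bsub>A\<^esub> x) (b \<otimes>\<^bsub>B\<^esub> y)) f = \<zero>\<^bsub>C\<^esub>"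
      "?L (\<lambda>x y. c \<odot>\<^bsub>C\<^esub> \<beta> (x \<otimes>\<^bsub>A\<^esub> a) (y \<otimes>\<^bsub>B\<^esub> b)) f = \<zero>\<^bsub>C\<^esub>" if "bilinear_map A B C \<beta>" for \<beta>
    proof -
      have "bilinear_map A B C (\<lambda>x y. c \<odot>\<^bsub>C\<^esub> \<beta> (a \<otimes>\<^bsub>A\<^esub> x) (b \<otimes>\<^bsub>B\<^esub> y))"
        "bilinear_map A B C (\<lambda>x y. c \<odot>\<^bsub>C\<^esub> \<beta> (x \<otimes>\<^bsub>A\<^esub> a) (y \<otimes>\<^bsub>B\<^esub> b))"
        using that ab unfolding bilinear_map_def
        by (simp_all add: A.r_distr B.r_distr A.l_distr B.l_distr A.smult_mult_right B.smult_mult_right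
            A.smult_mult_left B.smult_mult_left C.smult_add_right C.smult_smult mult.commute)
      then show "?L (\<lambda>x y. c \<odot>\<^bsub>C\<^esub> \<beta> (a \<otimes>\<^bsub>A\<^esub> x) (b \<otimes>\<^bsub>B\<^esub> y)) f = \<zero>\<^bsub>C\<^esub>"
        "?L (\<lambda>x y. c \<odot>\<^bsub>C\<^esub> \<beta> (x \<otimes>\<^bsub>A\<^esub> a) (y \<otimes>\<^bsub>B\<^esub> b)) f = \<zero>\<^bsub>C\<^esub>"
        using f unfolding J_def by blast+
    qed
    have "?L \<beta> (?s \<otimes>\<^bsub>?M\<^esub> f) = ?L (\<lambda>x y. c \<odot>\<^bsub>C\<^esub> \<beta> (a \<otimes>\<^bsub>A\<^esub> x) (b \<otimes>\<^bsub>B\<^esub> y)) f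
      \<and> ?L \<beta> (f \<otimes>\<^bsub>?M\<^esub> ?s) = ?L (\<lambda>x y. c \<odot>\<^bsub>C\<^esub> \<beta> (x \<otimes>\<^bsub>A\<^esub> a) (y \<otimes>\<^bsub>B\<^esub> b)) f"
      if \<beta>: "bilinear_map A B C \<beta>" for \<beta>
      using fM
    proof (induction f rule: poly_mapping_single_induct)
      case (single w d)
      then show ?case
        using ab cl[OF \<beta>] by (auto simp: L_single[OF \<beta>] C.lin_ext_single C.smult_smult mult.commute)
    next
      case (add f g)
      have "?s \<otimes>\<^bsub>?M\<^esub> f \<in> carrier ?M" "?s \<otimes>\<^bsub>?M\<^esub> g \<in> carrier ?M"
          "f \<otimes>\<^bsub>?M\<^esub> ?s \<in> carrier ?M" "g \<otimes>\<^bsub>?M\<^esub> ?s \<in> carrier ?M"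
        by (intro MA.m_closed s; use add in simp)+
      moreover have "?L (\<lambda>x y. c \<odot>\<^bsub>C\<^esub> \<beta> (a \<otimes>\<^bsub>A\<^esub> x) (b \<otimes>\<^bsub>B\<^esub> y)) (f + g)
          = ?L (\<lambda>x y. c \<odot>\<^bsub>C\<^esub> \<beta> (a \<otimes>\<^bsub>A\<^esub> x) (b \<otimes>\<^bsub>B\<^esub> y)) f \<oplus>\<^bsub>C\<^esub> ?L (\<lambda>x y. c \<odot>\<^bsub>C\<^esub> \<beta> (a \<otimes>\<^bsub>A\<^esub> x) (b \<otimes>\<^bsub>B\<^esub> y)) g"
        "?L (\<lambda>x y. c \<odot>\<^bsub>C\<^esub> \<beta> (x \<otimes>\<^bsub>A\<^esub> a) (y \<otimes>\<^bsub>B\<^esub> b)) (f + g)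
          = ?L (\<lambda>x y. c \<odot>\<^bsub>C\<^esub> \<beta> (x \<otimes>\<^bsub>A\<^esub> a) (y \<otimes>\<^bsub>B\<^esub> b)) f \<oplus>\<^bsub>C\<^esub> ?L (\<lambda>x y. c \<odot>\<^bsub>C\<^esub> \<beta> (x \<otimes>\<^bsub>A\<^esub> a) (y \<otimes>\<^bsub>B\<^esub> b)) g"
        using add(1,2) ab cl[OF \<beta>] by (intro C.lin_ext_add; force)+
      ultimately show ?case
        using add by (simp add: monoid_algebra_mult_add_left monoid_algebra_mult_add_right L_add[OF \<beta>])
    qed simp
    then have "\<forall>\<beta>. bilinear_map A B C \<beta> \<longrightarrow> ?L \<beta> (?s \<otimes>\<^bsub>?M\<^esub> f) = \<zero>\<^bsub>C\<^esub> \<and> ?L \<beta> (f \<otimes>\<^bsub>?M\<^esub> ?s) = \<zero>\<^bsub>C\<^esub>"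
      using scaled by simp
    moreover have "?s \<otimes>\<^bsub>?M\<^esub> f \<in> carrier ?M" "f \<otimes>\<^bsub>?M\<^esub> ?s \<in> carrier ?M"
      by (intro MA.m_closed s; use fM in simp)+
    ultimately show "?s \<otimes>\<^bsub>?M\<^esub> f \<in> J" "f \<otimes>\<^bsub>?M\<^esub> ?s \<in> J"
      unfolding J_def by blast+
  qed
  have zeroJ: "0 \<in> J" by (simp add: J_def)
  have "ideal J ?M"
  proof (rule idealI)
    show "ring ?M" by (rule MA.ring_axioms)
    have smJ: "scale c f \<in> J" if "f \<in> J" for c f
    proof -
      have "?L \<beta> (scale c f) = c \<odot>\<^bsub>C\<^esub> ?L \<beta> f" if "bilinear_map A B C \<beta>" for \<beta>
        using \<open>f \<in> J\<close> cl[OF that] by (intro C.lin_ext_scale) (auto simp: J_def)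
      then show ?thesis using that keys_scale_subset[of f _ c] by (simp add: J_def)
    qed
    have "subspace_of J ?M"
      using J_add smJ zeroJ by (intro MA.subspace_ofI) (auto simp: J_def)
    then show "subgroup J (add_monoid ?M)"
      by (simp add: subspace_of_def submodule_def)
  next
    fix f x assume f: "f \<in> J" and x: "x \<in> carrier ?M"
    then have "keys x \<subseteq> carrier A \<times> carrier B" by simp
    then have "x \<otimes>\<^bsub>?M\<^esub> f \<in> J \<and> f \<otimes>\<^bsub>?M\<^esub> x \<in> J"
    proof (induction x rule: poly_mapping_single_induct)
      case (single w c)
      then show ?case using left right f by auto
    qed (simp_all add: zeroJ J_add monoid_algebra_mult_add_left monoid_algebra_mult_add_right)
    then show "x \<otimes>\<^bsub>?M\<^esub> f \<in> J" "f \<otimes>\<^bsub>?M\<^esub> x \<in> J" by auto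
  qed
  moreover have "relators \<subseteq> J"
  proof
    fix r assume r: "r \<in> relators"
    have "?L \<beta> r = \<zero>\<^bsub>C\<^esub>" if \<beta>: "bilinear_map A B C \<beta>" for \<beta>
    proof -
      note [simp] = L_single[OF \<beta>] cl[OF \<beta>] L_diff[OF \<beta>] keys_diff_subset
      note \<beta>' = \<beta>[unfolded bilinear_map_def]
      have 3: "(x \<oplus>\<^bsub>C\<^esub> y) \<ominus>\<^bsub>C\<^esub> x \<ominus>\<^bsub>C\<^esub> y = \<zero>\<^bsub>C\<^esub>" if "x \<in> carrier C" "y \<in> carrier C" for x y
      proof -
        have "(x \<oplus>\<^bsub>C\<^esub> y) \<ominus>\<^bsub>C\<^esub> x \<ominus>\<^bsub>C\<^esub> y = (x \<oplus>\<^bsub>C\<^esub> \<ominus>\<^bsub>C\<^esub> x) \<oplus>\<^bsub>C\<^esub> (y \<oplus>\<^bsub>C\<^esub> \<ominus>\<^bsub>C\<^esub> y)"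
          using that by (simp add: C.minus_eq C.a_ac)
        then show ?thesis using that by (simp add: C.r_neg)
      qed
      show ?thesis using r \<beta>'
        by (elim UnE; clarify) (simp_all add: 3)
    qed
    with r relators_subset show "r \<in> J" by (auto simp only: J_def)
  qed
  ultimately have "tensor_ideal A B \<subseteq> J"
    unfolding tensor_ideal_def by (rule MA.genideal_minimal)
  with x \<beta> show ?thesis by (auto simp: J_def)
qed

text \<open>The form in which bilinear maps are used: they carry linear relations between pure tensors over.\<close>

lemma (in tensor_factors) bilinear_map_sum_zero:
  assumes C: "kalgebra C" and \<beta>: "bilinear_map A B C \<beta>" and S: "finite S"
    and ab: "a \<in> S \<rightarrow> carrier A" "b \<in> S \<rightarrow> carrier B"
    and zero: "(\<Oplus>\<^bsub>tensor_algebra A B\<^esub>j\<in>S. pure_tensor A B (a j) (b j)) = \<zero>\<^bsub>tensor_algebra A B\<^esub>"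
  shows "(\<Oplus>\<^bsub>C\<^esub>j\<in>S. \<beta> (a j) (b j)) = \<zero>\<^bsub>C\<^esub>"
proof -
  interpret C: kalgebra C by fact
  let ?M = "monoid_algebra (A \<times>\<times> B) :: ('k, _) module"
  interpret coset: algebra_hom ?M "?M Quota tensor_ideal A B" "\<lambda>x. tensor_ideal A B +>\<^bsub>?M\<^esub> x"
    by (rule tensor.coset_hom)
  have ab': "a j \<in> carrier A" "b j \<in> carrier B" if "j \<in> S" for j using ab that by auto
  let ?x = "\<Sum>j\<in>S. single (a j, b j) (1::'k)"
  have M: "?x \<in> carrier ?M" using ab' by (auto intro!: keys_sum_subset)
  have "tensor_ideal A B +>\<^bsub>?M\<^esub> ?x = (\<Oplus>\<^bsub>tensor_algebra A B\<^esub>j\<in>S. pure_tensor A B (a j) (b j))"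
    unfolding pure_tensor_def tensor_algebra_def using ab'
    by (subst coset.hom_finsum_closed[symmetric]) (auto simp: S finsum_monoid_algebra[OF monoid_prod])
  also have "\<dots> = tensor_ideal A B"
    unfolding zero by (simp add: tensor_algebra_def)
  finally have "?x \<in> tensor_ideal A B" using tensor.coset_zero_iff[OF M] by simp
  then have x0: "lin_ext C (\<lambda>(a, b). \<beta> a b) ?x = \<zero>\<^bsub>C\<^esub>" by (rule lin_ext_tensor_ideal[OF C \<beta>])
  have cl: "\<beta> x y \<in> carrier C" if "x \<in> carrier A" "y \<in> carrier B" for x y
    using \<beta> that by (simp add: bilinear_map_def)
  have "lin_ext C (\<lambda>(a, b). \<beta> a b) ?x
      = (\<Oplus>\<^bsub>C\<^esub>j\<in>S. lin_ext C (\<lambda>(a, b). \<beta> a b) (single (a j, b j) 1))"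
    using ab' cl by (intro C.lin_ext_sum[where V = "carrier A \<times> carrier B"] S) auto
  also have "\<dots> = (\<Oplus>\<^bsub>C\<^esub>j\<in>S. \<beta> (a j) (b j))"
    using ab' cl by (intro C.finsum_cong') auto
  finally show ?thesis using x0 by simp
qed

section \<open>Coordinates with respect to a basis\<close>

locale based_algebra = kalgebra B for B :: "('k::field, 'b) module" (structure) +
  fixes S :: "'i set" and b :: "'i \<Rightarrow> 'b"
  assumes finite_S [simp]: "finite S"
    and b_closed: "b \<in> S \<rightarrow> carrier B"
    and span: "x \<in> carrier B \<Longrightarrow> \<exists>c. x = (\<Oplus>i\<in>S. c i \<odot> b i)"
    and indep: "(\<Oplus>i\<in>S. c i \<odot> b i) = \<zero> \<Longrightarrow> i \<in> S \<Longrightarrow> c i = 0"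
begin

lemma b_in [simp]: "i \<in> S \<Longrightarrow> b i \<in> carrier B"
  using b_closed by auto

definition coord :: "'b \<Rightarrow> 'i \<Rightarrow> 'k" where
  "coord x = (SOME c. x = (\<Oplus>i\<in>S. c i \<odot> b i))"

lemma coord_expansion: "x \<in> carrier B \<Longrightarrow> x = (\<Oplus>i\<in>S. coord x i \<odot> b i)"
  unfolding coord_def using someI_ex[OF span] .

lemma sum_add: "(\<Oplus>i\<in>S. (c i + d i) \<odot> b i) = (\<Oplus>i\<in>S. c i \<odot> b i) \<oplus> (\<Oplus>i\<in>S. d i \<odot> b i)"
proof -
  have "(\<Oplus>i\<in>S. (c i + d i) \<odot> b i) = (\<Oplus>i\<in>S. c i \<odot> b i \<oplus> d i \<odot> b i)"
    by (intro finsum_cong') (auto simp: smult_add_left)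
  also have "\<dots> = (\<Oplus>i\<in>S. c i \<odot> b i) \<oplus> (\<Oplus>i\<in>S. d i \<odot> b i)"
    by (rule finsum_addf) auto
  finally show ?thesis .
qed

lemma sum_smult: "(\<Oplus>i\<in>S. (d * c i) \<odot> b i) = d \<odot> (\<Oplus>i\<in>S. c i \<odot> b i)"
  by (subst smult_finsum) (auto simp: smult_smult intro!: finsum_cong')

lemma sum_closed [simp]: "(\<Oplus>i\<in>S. c i \<odot> b i) \<in> carrier B"
  by (rule finsum_closed) auto

lemma coord_unique:
  assumes "x = (\<Oplus>i\<in>S. c i \<odot> b i)" "i \<in> S"
  shows "coord x i = c i"
proof -
  have x: "x \<in> carrier B" using assms(1) by simp
  have "(\<Oplus>i\<in>S. (coord x i + (- 1) * c i) \<odot> b i) = x \<oplus> \<ominus> x"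
    unfolding sum_add sum_smult coord_expansion[OF x, symmetric] assms(1)[symmetric]
    using x by (simp add: uminus_smult)
  then have "coord x i + (- 1) * c i = 0"
    using x assms(2) indep[of "\<lambda>i. coord x i + (- 1) * c i"] by (simp add: r_neg)
  then show ?thesis by simp
qed

lemma coord_add:
  "x \<in> carrier B \<Longrightarrow> y \<in> carrier B \<Longrightarrow> i \<in> S \<Longrightarrow> coord (x \<oplus> y) i = coord x i + coord y i"
  by (rule coord_unique) (simp_all add: sum_add coord_expansion[symmetric])

lemma coord_smult: "x \<in> carrier B \<Longrightarrow> i \<in> S \<Longrightarrow> coord (d \<odot> x) i = d * coord x i"
  by (rule coord_unique) (simp_all add: sum_smult coord_expansion[symmetric])

lemma coord_basis:
  assumes "i \<in> S" "j \<in> S"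
  shows "coord (b j) i = (if i = j then 1 else 0)"
proof (rule coord_unique)
  have "(\<Oplus>i\<in>S. (if i = j then 1 else 0) \<odot> b i) = (\<Oplus>i\<in>S. if j = i then b j else \<zero>)"
    using assms by (intro finsum_cong') auto
  then show "b j = (\<Oplus>i\<in>S. (if i = j then 1 else 0) \<odot> b i)"
    using assms finsum_delta[of S "b j" j] by simp
qed (use assms in auto)

end

text \<open>
  The algebra \<open>T\<close> is \<open>B\<close> with coefficients extended to \<open>A\<close>: a free \<open>A\<close>-module on the basis \<open>b\<close> of \<open>B\<close>, where
  \<open>\<tau> x a\<close> is the tensor of \<open>x\<close> and \<open>a\<close>. Abstracting from the order of the factors lets one argument serve
  \<open>B \<otimes> K[X;Y]\<close> and \<open>G \<otimes> B\<close>.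
\<close>

locale coefficient_extension = T: kalgebra T + A: kalgebra A + B: based_algebra B S b
  for T :: "('k::field, 't) module" (structure) and A :: "('k, 'a) module" and B :: "('k, 'b) module"
    and S :: "'i set" and b +
  fixes \<tau> :: "'b \<Rightarrow> 'a \<Rightarrow> 't"
  assumes bilinear: "bilinear_map B A T \<tau>"
    and \<tau>_mult: "\<lbrakk>x \<in> carrier B; a \<in> carrier A; y \<in> carrier B; a' \<in> carrier A\<rbrakk>
      \<Longrightarrow> \<tau> x a \<otimes> \<tau> y a' = \<tau> (x \<otimes>\<^bsub>B\<^esub> y) (a \<otimes>\<^bsub>A\<^esub> a')"
    and \<tau>_one: "\<tau> \<one>\<^bsub>B\<^esub> \<one>\<^bsub>A\<^esub> = \<one>"
    and \<tau>_indep: "\<lbrakk>f \<in> S \<rightarrow> carrier A; (\<Oplus>i\<in>S. \<tau> (b i) (f i)) = \<zero>; j \<in> S\<rbrakk> \<Longrightarrow> f j = \<zero>\<^bsub>A\<^esub>"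

lemma (in based_algebra) coord_bilinear_map:
  assumes "kalgebra A" "i \<in> S"
  shows "bilinear_map B A A (\<lambda>x a. coord x i \<odot>\<^bsub>A\<^esub> a)" "bilinear_map A B A (\<lambda>a x. coord x i \<odot>\<^bsub>A\<^esub> a)"
proof -
  interpret A: kalgebra A by fact
  show "bilinear_map B A A (\<lambda>x a. coord x i \<odot>\<^bsub>A\<^esub> a)" "bilinear_map A B A (\<lambda>a x. coord x i \<odot>\<^bsub>A\<^esub> a)"
    using assms(2) unfolding bilinear_map_def
    by (simp_all add: coord_add coord_smult A.smult_add_left A.smult_add_right A.smult_smult mult.commute)
qed

lemma (in based_algebra) sum_coord_basis:
  assumes "kalgebra A" "i \<in> S" "a \<in> S \<rightarrow> carrier A"
  shows "(\<Oplus>\<^bsub>A\<^esub>j\<in>S. coord (b j) i \<odot>\<^bsub>A\<^esub> a j) = a i"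
proof -
  interpret A: kalgebra A by fact
  have "(\<Oplus>\<^bsub>A\<^esub>j\<in>S. coord (b j) i \<odot>\<^bsub>A\<^esub> a j) = (\<Oplus>\<^bsub>A\<^esub>j\<in>S. if i = j then a i else \<zero>\<^bsub>A\<^esub>)"
    using assms(2,3) by (intro A.finsum_cong') (auto simp: coord_basis Pi_iff)
  then show ?thesis using assms A.finsum_delta[of S "a i" i] by auto
qed

text \<open>Freeness is detected by the bilinear maps \<open>(x, a) \<mapsto> coord x i \<odot> a\<close>, which single out the \<open>i\<close>-th coefficient.\<close>

lemma (in based_algebra) coefficient_extension_tensor:
  assumes A: "kalgebra A"
  shows "coefficient_extension (tensor_algebra B A) A B S b (pure_tensor B A)"
    and "coefficient_extension (tensor_algebra A B) A B S b (\<lambda>x a. pure_tensor A B a x)"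
proof -
  interpret BA: tensor_factors B A by (rule tensor_factors.intro[OF kalgebra_axioms A])
  interpret AB: tensor_factors A B by (rule tensor_factors.intro[OF A kalgebra_axioms])
  show "coefficient_extension (tensor_algebra B A) A B S b (pure_tensor B A)"
  proof (intro coefficient_extension.intro coefficient_extension_axioms.intro
      BA.kalgebra_tensor A based_algebra_axioms)
    show "bilinear_map B A (tensor_algebra B A) (pure_tensor B A)"
      unfolding bilinear_map_def
      by (simp add: BA.pure_tensor_add_left BA.pure_tensor_add_right
          BA.pure_tensor_smult_left BA.pure_tensor_smult_right)
    fix a i assume a: "a \<in> S \<rightarrow> carrier A" and i: "i \<in> S"
      and "(\<Oplus>\<^bsub>tensor_algebra B A\<^esub>i\<in>S. pure_tensor B A (b i) (a i)) = \<zero>\<^bsub>tensor_algebra B A\<^esub>"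
    then have "(\<Oplus>\<^bsub>A\<^esub>j\<in>S. coord (b j) i \<odot>\<^bsub>A\<^esub> a j) = \<zero>\<^bsub>A\<^esub>"
      using BA.bilinear_map_sum_zero[OF A coord_bilinear_map(1)[OF A i] finite_S b_closed a] by blast
    then show "a i = \<zero>\<^bsub>A\<^esub>" using sum_coord_basis[OF A i a] by simp
  qed (simp_all add: BA.pure_tensor_mult BA.pure_tensor_one)
  show "coefficient_extension (tensor_algebra A B) A B S b (\<lambda>x a. pure_tensor A B a x)"
  proof (intro coefficient_extension.intro coefficient_extension_axioms.intro
      AB.kalgebra_tensor A based_algebra_axioms)
    show "bilinear_map B A (tensor_algebra A B) (\<lambda>x a. pure_tensor A B a x)"
      unfolding bilinear_map_def
      by (simp add: AB.pure_tensor_add_left AB.pure_tensor_add_right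
          AB.pure_tensor_smult_left AB.pure_tensor_smult_right)
    fix a i assume a: "a \<in> S \<rightarrow> carrier A" and i: "i \<in> S"
      and "(\<Oplus>\<^bsub>tensor_algebra A B\<^esub>i\<in>S. pure_tensor A B (a i) (b i)) = \<zero>\<^bsub>tensor_algebra A B\<^esub>"
    then have "(\<Oplus>\<^bsub>A\<^esub>j\<in>S. coord (b j) i \<odot>\<^bsub>A\<^esub> a j) = \<zero>\<^bsub>A\<^esub>"
      using AB.bilinear_map_sum_zero[OF A coord_bilinear_map(2)[OF A i] finite_S a b_closed] by blast
    then show "a i = \<zero>\<^bsub>A\<^esub>" using sum_coord_basis[OF A i a] by simp
  qed (simp_all add: AB.pure_tensor_mult AB.pure_tensor_one)
qed

lemma finsum_free_algebra:
  assumes "finite S" "\<And>i. i \<in> S \<Longrightarrow> keys (f i) \<subseteq> lists V"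
  shows "(\<Oplus>\<^bsub>free_algebra V\<^esub>i\<in>S. f i) = (\<Sum>i\<in>S. f i)"
  unfolding free_algebra_def using assms by (intro finsum_monoid_algebra monoid_word_monoid) simp_all

section \<open>Coordinates of a polynomial evaluated at generic elements\<close>

context based_algebra
begin

text \<open>
  The letter \<open>z t k\<close> stands for the \<open>k\<close>-th coordinate of the variable \<open>t\<close>. The recursion is the formula
  \<open>(\<Sum>\<^sub>k a\<^sub>k b\<^sub>k) (\<Sum>\<^sub>l a'\<^sub>l b\<^sub>l) = \<Sum>\<^sub>j (\<Sum>\<^sub>k\<^sub>,\<^sub>l c\<^sub>k\<^sub>l\<^sub>j a\<^sub>k a'\<^sub>l) b\<^sub>j\<close> with the structure constants \<open>c\<^sub>k\<^sub>l\<^sub>j\<close> of \<open>B\<close>.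
\<close>

primrec coord_word :: "'z set \<Rightarrow> ('v \<Rightarrow> 'i \<Rightarrow> 'z) \<Rightarrow> 'v list \<Rightarrow> 'i \<Rightarrow> ('z list \<Rightarrow>\<^sub>0 'k)" where
  "coord_word Z z [] j = single [] (coord \<one> j)"
| "coord_word Z z (t # w) j = (\<Sum>k\<in>S. \<Sum>l\<in>S. scale (coord (b k \<otimes> b l) j)
      (single [z t k] 1 \<otimes>\<^bsub>free_algebra Z\<^esub> coord_word Z z w l))"

definition coord_poly :: "'z set \<Rightarrow> ('v \<Rightarrow> 'i \<Rightarrow> 'z) \<Rightarrow> ('v list \<Rightarrow>\<^sub>0 'k) \<Rightarrow> 'i \<Rightarrow> ('z list \<Rightarrow>\<^sub>0 'k)" where
  "coord_poly Z z f j = (\<Sum>w\<in>keys f. scale (lookup f w) (coord_word Z z w j))"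

lemma coord_word_closed:
  assumes "\<And>t k. t \<in> V \<Longrightarrow> k \<in> S \<Longrightarrow> z t k \<in> Z"
  shows "w \<in> lists V \<Longrightarrow> keys (coord_word Z z w j) \<subseteq> lists Z"
proof (induction w arbitrary: j)
  case (Cons t w)
  interpret F: kalgebra "free_algebra Z :: ('k, _) module" by (rule kalgebra_free_algebra)
  have "single [z t k] 1 \<otimes>\<^bsub>free_algebra Z\<^esub> coord_word Z z w l \<in> carrier (free_algebra Z)"
    if "k \<in> S" for k l
    using Cons assms[of t k] that by (intro F.m_closed) auto
  then show ?case by (auto intro!: keys_sum_subset keys_scale_subset)
qed simp

lemma coord_poly_closed:
  assumes "\<And>t k. t \<in> V \<Longrightarrow> k \<in> S \<Longrightarrow> z t k \<in> Z" "keys f \<subseteq> lists V"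
  shows "keys (coord_poly Z z f j) \<subseteq> lists Z"
  unfolding coord_poly_def
proof (intro keys_sum_subset keys_scale_subset)
  fix w assume "w \<in> keys f"
  then have "w \<in> lists V" using assms(2) by blast
  then show "keys (coord_word Z z w j) \<subseteq> lists Z" using coord_word_closed[of V z Z w j] assms(1) by blast
qed

end

context coefficient_extension
begin

lemma \<tau>_closed [simp]: "x \<in> carrier B \<Longrightarrow> a \<in> carrier A \<Longrightarrow> \<tau> x a \<in> carrier T"
  and \<tau>_add_left: "x \<in> carrier B \<Longrightarrow> y \<in> carrier B \<Longrightarrow> a \<in> carrier A \<Longrightarrow> \<tau> (x \<oplus>\<^bsub>B\<^esub> y) a = \<tau> x a \<oplus> \<tau> y a"
  and \<tau>_add_right: "x \<in> carrier B \<Longrightarrow> a \<in> carrier A \<Longrightarrow> a' \<in> carrier A \<Longrightarrow> \<tau> x (a \<oplus>\<^bsub>A\<^esub> a') = \<tau> x a \<oplus> \<tau> x a'"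
  and \<tau>_smult_left: "x \<in> carrier B \<Longrightarrow> a \<in> carrier A \<Longrightarrow> \<tau> (c \<odot>\<^bsub>B\<^esub> x) a = c \<odot> \<tau> x a"
  and \<tau>_smult_right: "x \<in> carrier B \<Longrightarrow> a \<in> carrier A \<Longrightarrow> \<tau> x (c \<odot>\<^bsub>A\<^esub> a) = c \<odot> \<tau> x a"
  using bilinear by (simp_all add: bilinear_map_def)

lemma \<tau>_zero [simp]: "x \<in> carrier B \<Longrightarrow> \<tau> x \<zero>\<^bsub>A\<^esub> = \<zero>" "a \<in> carrier A \<Longrightarrow> \<tau> \<zero>\<^bsub>B\<^esub> a = \<zero>"
  using \<tau>_smult_right[of x "\<zero>\<^bsub>A\<^esub>" 0] \<tau>_smult_left[of "\<zero>\<^bsub>B\<^esub>" a 0] by simp_all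

lemma \<tau>_finsum_right:
  "finite N \<Longrightarrow> x \<in> carrier B \<Longrightarrow> f \<in> N \<rightarrow> carrier A \<Longrightarrow> \<tau> x (\<Oplus>\<^bsub>A\<^esub>i\<in>N. f i) = (\<Oplus>i\<in>N. \<tau> x (f i))"
  by (induction N rule: finite_induct) (auto simp: A.finsum_insert T.finsum_insert \<tau>_add_right Pi_iff)

lemma \<tau>_finsum_left:
  "finite N \<Longrightarrow> a \<in> carrier A \<Longrightarrow> f \<in> N \<rightarrow> carrier B \<Longrightarrow> \<tau> (\<Oplus>\<^bsub>B\<^esub>i\<in>N. f i) a = (\<Oplus>i\<in>N. \<tau> (f i) a)"
  by (induction N rule: finite_induct) (auto simp: B.finsum_insert T.finsum_insert \<tau>_add_left Pi_iff)

definition comb :: "('i \<Rightarrow> 'a) \<Rightarrow> 't" where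
  "comb x = (\<Oplus>j\<in>S. \<tau> (b j) (x j))"

lemma comb_closed [simp]: "x \<in> S \<rightarrow> carrier A \<Longrightarrow> comb x \<in> carrier T"
  unfolding comb_def by (rule T.finsum_closed) (auto simp: Pi_iff)

lemma comb_cong: "(\<And>j. j \<in> S \<Longrightarrow> x j = y j) \<Longrightarrow> y \<in> S \<rightarrow> carrier A \<Longrightarrow> comb x = comb y"
  unfolding comb_def by (rule T.finsum_cong') (auto simp: Pi_iff)

lemma comb_eq_zero_iff: "x \<in> S \<rightarrow> carrier A \<Longrightarrow> comb x = \<zero> \<longleftrightarrow> (\<forall>j\<in>S. x j = \<zero>\<^bsub>A\<^esub>)"
proof
  assume "x \<in> S \<rightarrow> carrier A" "\<forall>j\<in>S. x j = \<zero>\<^bsub>A\<^esub>"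
  then have "comb x = (\<Oplus>j\<in>S. \<zero>)" unfolding comb_def by (intro T.finsum_cong') auto
  then show "comb x = \<zero>" by simp
qed (use \<tau>_indep in \<open>auto simp: comb_def\<close>)

lemma comb_finsum:
  assumes "finite N" "\<And>i. i \<in> N \<Longrightarrow> x i \<in> S \<rightarrow> carrier A"
  shows "(\<Oplus>i\<in>N. comb (x i)) = comb (\<lambda>j. \<Oplus>\<^bsub>A\<^esub>i\<in>N. x i j)"
proof -
  have x: "x i j \<in> carrier A" if "i \<in> N" "j \<in> S" for i j using assms(2) that by auto
  have "(\<Oplus>i\<in>N. comb (x i)) = (\<Oplus>j\<in>S. \<Oplus>i\<in>N. \<tau> (b j) (x i j))"
    unfolding comb_def using x by (intro T.finsum_swap assms B.finite_S) auto
  also have "\<dots> = comb (\<lambda>j. \<Oplus>\<^bsub>A\<^esub>i\<in>N. x i j)"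
    unfolding comb_def using x assms(1)
    by (intro T.finsum_cong') (auto simp: \<tau>_finsum_right intro!: A.finsum_closed)
  finally show ?thesis .
qed

lemma comb_smult: "x \<in> S \<rightarrow> carrier A \<Longrightarrow> c \<odot> comb x = comb (\<lambda>j. c \<odot>\<^bsub>A\<^esub> x j)"
  unfolding comb_def by (subst T.smult_finsum) (auto simp: \<tau>_smult_right Pi_iff intro!: T.finsum_cong')

lemma comb_add:
  "x \<in> S \<rightarrow> carrier A \<Longrightarrow> y \<in> S \<rightarrow> carrier A \<Longrightarrow> comb x \<oplus> comb y = comb (\<lambda>j. x j \<oplus>\<^bsub>A\<^esub> y j)"
proof -
  assume "x \<in> S \<rightarrow> carrier A" "y \<in> S \<rightarrow> carrier A"
  then have xy [simp]: "x i \<in> carrier A" "y i \<in> carrier A" if "i \<in> S" for i using that by auto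
  have "comb (\<lambda>j. x j \<oplus>\<^bsub>A\<^esub> y j) = (\<Oplus>j\<in>S. \<tau> (b j) (x j) \<oplus> \<tau> (b j) (y j))"
    unfolding comb_def by (intro T.finsum_cong') (auto simp: \<tau>_add_right)
  also have "\<dots> = comb x \<oplus> comb y"
    unfolding comb_def by (rule T.finsum_addf) auto
  finally show ?thesis by (rule sym)
qed

lemma \<tau>_eq_comb:
  assumes "x \<in> carrier B" "a \<in> carrier A"
  shows "\<tau> x a = comb (\<lambda>j. B.coord x j \<odot>\<^bsub>A\<^esub> a)"
proof -
  have "\<tau> x a = \<tau> (\<Oplus>\<^bsub>B\<^esub>j\<in>S. B.coord x j \<odot>\<^bsub>B\<^esub> b j) a" using B.coord_expansion[OF assms(1)] by simp
  also have "\<dots> = comb (\<lambda>j. B.coord x j \<odot>\<^bsub>A\<^esub> a)"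
    unfolding comb_def using assms
    by (subst \<tau>_finsum_left) (auto simp: \<tau>_smult_left \<tau>_smult_right intro!: T.finsum_cong')
  finally show ?thesis .
qed

lemma comb_mult:
  assumes "x \<in> S \<rightarrow> carrier A" "y \<in> S \<rightarrow> carrier A"
  shows "comb x \<otimes> comb y
    = comb (\<lambda>j. \<Oplus>\<^bsub>A\<^esub>k\<in>S. \<Oplus>\<^bsub>A\<^esub>l\<in>S. B.coord (b k \<otimes>\<^bsub>B\<^esub> b l) j \<odot>\<^bsub>A\<^esub> (x k \<otimes>\<^bsub>A\<^esub> y l))"
proof -
  have xy [simp]: "x i \<in> carrier A" "y i \<in> carrier A" if "i \<in> S" for i using assms that by auto
  have "comb x \<otimes> comb y = (\<Oplus>k\<in>S. \<Oplus>l\<in>S. \<tau> (b k) (x k) \<otimes> \<tau> (b l) (y l))"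
    unfolding comb_def by (intro T.finsum_product) auto
  also have "\<dots> = (\<Oplus>k\<in>S. \<Oplus>l\<in>S. comb (\<lambda>j. B.coord (b k \<otimes>\<^bsub>B\<^esub> b l) j \<odot>\<^bsub>A\<^esub> (x k \<otimes>\<^bsub>A\<^esub> y l)))"
    by (intro T.finsum_cong')
      (auto simp: \<tau>_mult \<tau>_eq_comb[of "_ \<otimes>\<^bsub>B\<^esub> _"] intro!: T.finsum_closed comb_closed)
  also have "\<dots> = (\<Oplus>k\<in>S. comb (\<lambda>j. \<Oplus>\<^bsub>A\<^esub>l\<in>S. B.coord (b k \<otimes>\<^bsub>B\<^esub> b l) j \<odot>\<^bsub>A\<^esub> (x k \<otimes>\<^bsub>A\<^esub> y l)))"
    by (intro T.finsum_cong' comb_finsum) (auto intro!: comb_closed A.finsum_closed)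
  also have "\<dots> = comb (\<lambda>j. \<Oplus>\<^bsub>A\<^esub>k\<in>S. \<Oplus>\<^bsub>A\<^esub>l\<in>S. B.coord (b k \<otimes>\<^bsub>B\<^esub> b l) j \<odot>\<^bsub>A\<^esub> (x k \<otimes>\<^bsub>A\<^esub> y l))"
    by (intro comb_finsum) (auto intro!: A.finsum_closed)
  finally show ?thesis .
qed

lemma word_prod_comb:
  assumes z: "\<And>t k. t \<in> V \<Longrightarrow> k \<in> S \<Longrightarrow> z t k \<in> Z" and a: "a \<in> Z \<rightarrow> carrier A"
    and \<phi>: "\<And>t. t \<in> V \<Longrightarrow> \<phi> t = comb (\<lambda>k. a (z t k))"
  shows "w \<in> lists V \<Longrightarrow> word_prod T \<phi> w = comb (\<lambda>j. eval_poly A a (B.coord_word Z z w j))"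
proof (induction w)
  case Nil
  have "comb (\<lambda>j. eval_poly A a (B.coord_word Z z [] j)) = comb (\<lambda>j. B.coord \<one>\<^bsub>B\<^esub> j \<odot>\<^bsub>A\<^esub> \<one>\<^bsub>A\<^esub>)"
    using a by (intro comb_cong) (auto simp: A.eval_poly_single[OF a])
  also have "\<dots> = \<one>" using \<tau>_eq_comb[of "\<one>\<^bsub>B\<^esub>" "\<one>\<^bsub>A\<^esub>"] \<tau>_one by simp
  finally show ?case by simp
next
  case (Cons t w)
  interpret ev: algebra_hom "free_algebra Z" A "eval_poly A a" by (rule A.eval_poly_hom[OF a])
  let ?F = "free_algebra Z :: ('k, _) module"
  have t: "t \<in> V" and w: "w \<in> lists V" using Cons.prems by auto
  have az: "a (z t k) \<in> carrier A" if "k \<in> S" for k using a z[OF t that] by auto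
  have wF: "B.coord_word Z z w l \<in> carrier ?F" for l
    using B.coord_word_closed[of V z Z w l] z w by simp
  have sF: "single [z t k] 1 \<in> carrier ?F" if "k \<in> S" for k using z[OF t that] by simp
  have ew: "eval_poly A a (B.coord_word Z z w l) \<in> carrier A" for l
    using ev.hom_closed[OF wF] .
  have ez: "eval_poly A a (single [z t k] 1) = a (z t k)" if "k \<in> S" for k
    using az[OF that] z[OF t that] by (subst A.eval_poly_single[OF a]) auto
  have ev_Cons: "eval_poly A a (B.coord_word Z z (t # w) j)
    = (\<Oplus>\<^bsub>A\<^esub>k\<in>S. \<Oplus>\<^bsub>A\<^esub>l\<in>S. B.coord (b k \<otimes>\<^bsub>B\<^esub> b l) j \<odot>\<^bsub>A\<^esub> (a (z t k) \<otimes>\<^bsub>A\<^esub> eval_poly A a (B.coord_word Z z w l)))" for j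
  proof -
    let ?m = "\<lambda>k l. B.coord (b k \<otimes>\<^bsub>B\<^esub> b l) j \<odot>\<^bsub>?F\<^esub> (single [z t k] 1 \<otimes>\<^bsub>?F\<^esub> B.coord_word Z z w l)"
    have m: "?m k l \<in> carrier ?F" if "k \<in> S" for k l
      by (intro ev.A.smult_in ev.A.m_closed sF that wF)
    have "B.coord_word Z z (t # w) j = (\<Oplus>\<^bsub>?F\<^esub>k\<in>S. \<Oplus>\<^bsub>?F\<^esub>l\<in>S. ?m k l)"
    proof -
      have keys_m: "keys (?m k l) \<subseteq> lists Z" if "k \<in> S" for k l
        using m[OF that, of l] by simp
      have "(\<Oplus>\<^bsub>?F\<^esub>k\<in>S. \<Oplus>\<^bsub>?F\<^esub>l\<in>S. ?m k l) = (\<Oplus>\<^bsub>?F\<^esub>k\<in>S. \<Sum>l\<in>S. ?m k l)"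
        using keys_sum_subset[of S "?m _" "lists Z"] keys_m
        by (intro ev.A.finsum_cong' finsum_free_algebra) simp_all
      also have "\<dots> = (\<Sum>k\<in>S. \<Sum>l\<in>S. ?m k l)"
        using keys_m by (intro finsum_free_algebra keys_sum_subset) simp_all
      finally show ?thesis by simp
    qed
    also have "eval_poly A a \<dots> = (\<Oplus>\<^bsub>A\<^esub>k\<in>S. \<Oplus>\<^bsub>A\<^esub>l\<in>S. eval_poly A a (?m k l))"
      using m by (subst ev.hom_finsum_closed)
        (auto simp: ev.hom_finsum_closed Pi_iff simp del: free_algebra_simps(1) intro!: A.finsum_cong' A.finsum_closed ev.A.finsum_closed)
    also have "\<dots> = (\<Oplus>\<^bsub>A\<^esub>k\<in>S. \<Oplus>\<^bsub>A\<^esub>l\<in>S. B.coord (b k \<otimes>\<^bsub>B\<^esub> b l) j \<odot>\<^bsub>A\<^esub> (a (z t k) \<otimes>\<^bsub>A\<^esub> eval_poly A a (B.coord_word Z z w l)))"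
      using wF sF az ew by (intro A.finsum_cong') (auto simp: ev.hom_smult ez Pi_iff simp del: free_algebra_simps(1,5) intro!: A.finsum_closed)
    finally show ?thesis .
  qed
  have "word_prod T \<phi> (t # w) = comb (\<lambda>k. a (z t k)) \<otimes> comb (\<lambda>j. eval_poly A a (B.coord_word Z z w j))"
    using Cons t by (simp add: \<phi>)
  also have "\<dots> = comb (\<lambda>j. \<Oplus>\<^bsub>A\<^esub>k\<in>S. \<Oplus>\<^bsub>A\<^esub>l\<in>S. B.coord (b k \<otimes>\<^bsub>B\<^esub> b l) j \<odot>\<^bsub>A\<^esub>
      (a (z t k) \<otimes>\<^bsub>A\<^esub> eval_poly A a (B.coord_word Z z w l)))"
    using az ew by (intro comb_mult) auto
  also have "\<dots> = comb (\<lambda>j. eval_poly A a (B.coord_word Z z (t # w) j))"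
    by (simp only: ev_Cons)
  finally show ?case .
qed

text \<open>
  The polynomials \<open>coord_poly\<close> involve neither \<open>T\<close> nor \<open>A\<close>; this uniformity is what allows values in
  different coefficient extensions of \<open>B\<close> to be compared.
\<close>

theorem eval_poly_comb:
  assumes z: "\<And>t k. t \<in> V \<Longrightarrow> k \<in> S \<Longrightarrow> z t k \<in> Z" and a: "a \<in> Z \<rightarrow> carrier A"
    and \<phi>: "\<And>t. t \<in> V \<Longrightarrow> \<phi> t = comb (\<lambda>k. a (z t k))" and f: "keys f \<subseteq> lists V"
  shows "eval_poly T \<phi> f = comb (\<lambda>j. eval_poly A a (B.coord_poly Z z f j))"
proof -
  interpret ev: algebra_hom "free_algebra Z" A "eval_poly A a" by (rule A.eval_poly_hom[OF a])
  let ?F = "free_algebra Z :: ('k, _) module"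
  have wV: "w \<in> lists V" if "w \<in> keys f" for w using f that by blast
  have cw: "B.coord_word Z z w j \<in> carrier ?F" if "w \<in> keys f" for w j
    using B.coord_word_closed[of V z Z w j] z wV[OF that] by simp
  have ew: "eval_poly A a (B.coord_word Z z w j) \<in> carrier A" if "w \<in> keys f" for w j
    using ev.hom_closed[OF cw[OF that]] .
  have "eval_poly T \<phi> f = (\<Oplus>w\<in>keys f. comb (\<lambda>j. lookup f w \<odot>\<^bsub>A\<^esub> eval_poly A a (B.coord_word Z z w j)))"
    unfolding eval_poly_def[of T] using ew
    by (intro T.finsum_cong') (auto simp: word_prod_comb[OF z a \<phi> wV, simplified] comb_smult Pi_iff)
  also have "\<dots> = comb (\<lambda>j. \<Oplus>\<^bsub>A\<^esub>w\<in>keys f. lookup f w \<odot>\<^bsub>A\<^esub> eval_poly A a (B.coord_word Z z w j))"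
    using ew by (intro comb_finsum) auto
  also have "(\<lambda>j. \<Oplus>\<^bsub>A\<^esub>w\<in>keys f. lookup f w \<odot>\<^bsub>A\<^esub> eval_poly A a (B.coord_word Z z w j))
      = (\<lambda>j. eval_poly A a (B.coord_poly Z z f j))"
  proof
    fix j
    have "B.coord_poly Z z f j = (\<Oplus>\<^bsub>?F\<^esub>w\<in>keys f. lookup f w \<odot>\<^bsub>?F\<^esub> B.coord_word Z z w j)"
      using cw by (subst finsum_free_algebra) (simp_all add: B.coord_poly_def keys_scale_subset)
    also have "eval_poly A a \<dots> = (\<Oplus>\<^bsub>A\<^esub>w\<in>keys f. lookup f w \<odot>\<^bsub>A\<^esub> eval_poly A a (B.coord_word Z z w j))"
      using cw ew by (subst ev.hom_finsum_closed)
        (auto simp: ev.hom_smult Pi_iff simp del: free_algebra_simps(1,5) intro!: A.finsum_cong')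
    finally show "(\<Oplus>\<^bsub>A\<^esub>w\<in>keys f. lookup f w \<odot>\<^bsub>A\<^esub> eval_poly A a (B.coord_word Z z w j))
      = eval_poly A a (B.coord_poly Z z f j)" by simp
  qed
  finally show ?thesis .
qed

corollary eval_poly_zero_iff:
  assumes "\<And>t k. t \<in> V \<Longrightarrow> k \<in> S \<Longrightarrow> z t k \<in> Z" "a \<in> Z \<rightarrow> carrier A"
    and "\<And>t. t \<in> V \<Longrightarrow> \<phi> t = comb (\<lambda>k. a (z t k))" "keys f \<subseteq> lists V"
  shows "eval_poly T \<phi> f = \<zero> \<longleftrightarrow> (\<forall>j\<in>S. eval_poly A a (B.coord_poly Z z f j) = \<zero>\<^bsub>A\<^esub>)"
  using A.eval_poly_closed[OF assms(2) B.coord_poly_closed[of V z Z f]] assms(1,4)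
    eval_poly_comb[of V z Z a \<phi> f] assms
  by (simp add: comb_eq_zero_iff)

end

section \<open>Words in supercommuting elements\<close>

abbreviation word_degree :: "('v \<Rightarrow> nat) \<Rightarrow> 'v list \<Rightarrow> nat" where
  "word_degree d w \<equiv> sum_list (map d w)"

lemma (in kalgebra) word_prod_supercommute:
  assumes \<phi>: "\<phi> \<in> V \<rightarrow> carrier A"
    and comm: "\<And>s t. s \<in> V \<Longrightarrow> t \<in> V \<Longrightarrow> \<phi> s \<otimes> \<phi> t = (- 1) ^ (d s * d t) \<odot> (\<phi> t \<otimes> \<phi> s)"
  shows "w \<in> lists V \<Longrightarrow> w' \<in> lists V \<Longrightarrow> word_prod A \<phi> w \<otimes> word_prod A \<phi> w'
    = (- 1) ^ (word_degree d w * word_degree d w') \<odot> (word_prod A \<phi> w' \<otimes> word_prod A \<phi> w)"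
proof (induction w)
  case Nil
  then show ?case using word_prod_closed[OF \<phi>, of w'] by simp
next
  case (Cons s w)
  have s: "s \<in> V" "\<phi> s \<in> carrier A" and w: "w \<in> lists V" using Cons.prems \<phi> by auto
  have letter: "\<phi> s \<otimes> word_prod A \<phi> v = (- 1) ^ (d s * word_degree d v) \<odot> (word_prod A \<phi> v \<otimes> \<phi> s)"
    if "v \<in> lists V" for v
    using that
  proof (induction v rule: list.induct)
    case Nil
    then show ?case using s by simp
  next
    case (Cons t v)
    have t: "t \<in> V" "\<phi> t \<in> carrier A" and v: "word_prod A \<phi> v \<in> carrier A"
      using Cons.prems \<phi> word_prod_closed[OF \<phi>, of v] by auto
    have "\<phi> s \<otimes> word_prod A \<phi> (t # v) = (\<phi> s \<otimes> \<phi> t) \<otimes> word_prod A \<phi> v"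
      using s t v by (simp add: m_assoc)
    also have "\<dots> = (- 1) ^ (d s * d t) \<odot> (\<phi> t \<otimes> (\<phi> s \<otimes> word_prod A \<phi> v))"
      using s t v by (subst comm) (simp_all add: smult_mult_left m_assoc)
    also have "\<dots> = (- 1) ^ (d s * d t) \<odot> (\<phi> t \<otimes> ((- 1) ^ (d s * word_degree d v) \<odot> (word_prod A \<phi> v \<otimes> \<phi> s)))"
      using Cons.prems by (subst Cons.IH) simp_all
    also have "\<dots> = (- 1) ^ (d s * word_degree d (t # v)) \<odot> (word_prod A \<phi> (t # v) \<otimes> \<phi> s)"
      using s t v by (simp add: smult_mult_right smult_smult m_assoc distrib_left power_add)
    finally show ?case .
  qed
  have cl: "word_prod A \<phi> w \<in> carrier A" "word_prod A \<phi> w' \<in> carrier A"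
    using word_prod_closed[OF \<phi>] w Cons.prems(2) by blast+
  have "word_prod A \<phi> (s # w) \<otimes> word_prod A \<phi> w' = \<phi> s \<otimes> (word_prod A \<phi> w \<otimes> word_prod A \<phi> w')"
    using s cl by (simp add: m_assoc)
  also have "\<dots> = (- 1) ^ (word_degree d w * word_degree d w') \<odot> ((\<phi> s \<otimes> word_prod A \<phi> w') \<otimes> word_prod A \<phi> w)"
    using s cl Cons.IH[OF w Cons.prems(2)] by (simp add: smult_mult_right m_assoc)
  also have "\<dots> = (- 1) ^ (word_degree d (s # w) * word_degree d w') \<odot> (word_prod A \<phi> w' \<otimes> word_prod A \<phi> (s # w))"
  proof -
    have "(- 1 :: 'k) ^ (word_degree d w * word_degree d w') * (- 1) ^ (d s * word_degree d w')
        = (- 1) ^ (word_degree d (s # w) * word_degree d w')"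
      by (simp add: power_add[symmetric] distrib_right add.commute)
    moreover have "(\<phi> s \<otimes> word_prod A \<phi> w') \<otimes> word_prod A \<phi> w
        = (- 1) ^ (d s * word_degree d w') \<odot> (word_prod A \<phi> w' \<otimes> word_prod A \<phi> (s # w))"
      using s cl letter[OF Cons.prems(2)] by (simp add: smult_mult_left m_assoc)
    ultimately show ?thesis using s cl by (simp add: smult_smult)
  qed
  finally show ?case .
qed

text \<open>Extends a commutation rule from words to linear combinations of words of fixed kinds.\<close>

lemma (in kalgebra) eval_poly_twisted_commute:
  assumes \<phi>: "\<phi> \<in> V \<rightarrow> carrier A" and N: "N \<subseteq> lists V" "M \<subseteq> lists V"
    and comm: "\<And>w w'. w \<in> N \<Longrightarrow> w' \<in> M \<Longrightarrow> word_prod A \<phi> w \<otimes> word_prod A \<phi> w'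
      = \<epsilon> \<odot> (word_prod A \<phi> w' \<otimes> word_prod A \<phi> w)"
    and f: "keys f \<subseteq> N" and g: "keys g \<subseteq> M"
  shows "eval_poly A \<phi> f \<otimes> eval_poly A \<phi> g = \<epsilon> \<odot> (eval_poly A \<phi> g \<otimes> eval_poly A \<phi> f)"
proof -
  let ?F = "\<lambda>w. lookup f w \<odot> word_prod A \<phi> w" and ?H = "\<lambda>w. lookup g w \<odot> word_prod A \<phi> w"
  have wf: "word_prod A \<phi> w \<in> carrier A" if "w \<in> keys f" for w
    using f N(1) that by (intro word_prod_closed[OF \<phi>]) blast
  have wg: "word_prod A \<phi> w \<in> carrier A" if "w \<in> keys g" for w
    using g N(2) that by (intro word_prod_closed[OF \<phi>]) blast
  have swap: "?F w \<otimes> ?H w' = \<epsilon> \<odot> (?H w' \<otimes> ?F w)" if w: "w \<in> keys f" "w' \<in> keys g" for w w'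
  proof -
    have "?F w \<otimes> ?H w' = (lookup f w * lookup g w') \<odot> (word_prod A \<phi> w \<otimes> word_prod A \<phi> w')"
      using wf[OF w(1)] wg[OF w(2)] by (simp add: smult_mult_left smult_mult_right smult_smult mult.commute)
    also have "word_prod A \<phi> w \<otimes> word_prod A \<phi> w' = \<epsilon> \<odot> (word_prod A \<phi> w' \<otimes> word_prod A \<phi> w)"
      using f g w by (intro comm) blast+
    finally show ?thesis
      using wf[OF w(1)] wg[OF w(2)]
      by (simp add: smult_mult_left smult_mult_right smult_smult mult.commute mult.left_commute)
  qed
  have F: "?F \<in> keys f \<rightarrow> carrier A" and H: "?H \<in> keys g \<rightarrow> carrier A" using wf wg by auto
  have "eval_poly A \<phi> f \<otimes> eval_poly A \<phi> g = (\<Oplus>w\<in>keys f. \<Oplus>w'\<in>keys g. ?F w \<otimes> ?H w')"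
    unfolding eval_poly_def by (rule finsum_product[OF finite_keys finite_keys F H])
  also have "\<dots> = (\<Oplus>w\<in>keys f. \<epsilon> \<odot> (\<Oplus>w'\<in>keys g. ?H w' \<otimes> ?F w))"
    using wf wg swap by (intro finsum_cong' refl) (auto simp: smult_finsum intro!: finsum_cong' finsum_closed)
  also have "\<dots> = \<epsilon> \<odot> (\<Oplus>w\<in>keys f. \<Oplus>w'\<in>keys g. ?H w' \<otimes> ?F w)"
    using wf wg by (intro smult_finsum[symmetric]) (auto intro!: finsum_closed)
  also have "(\<Oplus>w\<in>keys f. \<Oplus>w'\<in>keys g. ?H w' \<otimes> ?F w) = (\<Oplus>w'\<in>keys g. \<Oplus>w\<in>keys f. ?H w' \<otimes> ?F w)"
    using wf wg by (intro finsum_swap) auto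
  also have "\<dots> = eval_poly A \<phi> g \<otimes> eval_poly A \<phi> f"
    unfolding eval_poly_def by (rule finsum_product[OF finite_keys finite_keys H F, symmetric])
  finally show ?thesis .
qed

section \<open>The Grassmann algebra\<close>

definition grassmann_gen :: "nat \<Rightarrow> (nat list \<Rightarrow>\<^sub>0 'k::field) set" where
  "grassmann_gen i = grassmann_ideal +>\<^bsub>free_algebra UNIV\<^esub> single [i] 1"

lemma grassmann_relators_subset:
  "{v \<otimes>\<^bsub>free_algebra UNIV\<^esub> v | v. \<forall>w\<in>keys v. length w = 1} \<subseteq> carrier (free_algebra UNIV)"
  by simp

lemma algebra_ideal_grassmann: "algebra_ideal (free_algebra UNIV) grassmann_ideal"
  unfolding grassmann_ideal_def
  by (rule kalgebra.algebra_ideal_genideal[OF kalgebra_free_algebra grassmann_relators_subset])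

lemma kalgebra_grassmann: "kalgebra grassmann"
  unfolding grassmann_def by (rule algebra_ideal.kalgebra_quota[OF algebra_ideal_grassmann])

lemma grassmann_gen_closed [simp]: "grassmann_gen i \<in> carrier grassmann"
  unfolding grassmann_def grassmann_gen_def by (rule algebra_ideal.coset_closed[OF algebra_ideal_grassmann]) simp

lemma grassmann_coset:
  "grassmann_ideal +>\<^bsub>free_algebra UNIV\<^esub> f = eval_poly grassmann grassmann_gen f"
proof -
  interpret c: algebra_hom "free_algebra UNIV" grassmann "\<lambda>x. grassmann_ideal +>\<^bsub>free_algebra UNIV\<^esub> x"
    unfolding grassmann_def by (rule algebra_ideal.coset_hom[OF algebra_ideal_grassmann])
  have "eval_poly (free_algebra UNIV) (\<lambda>t. single [t] 1) f = f"
    by (rule eval_poly_free_algebra) simp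
  then show ?thesis
    using c.hom_eval_poly[of "\<lambda>t. single [t] 1" UNIV f] by (simp add: grassmann_gen_def[abs_def])
qed

lemma grassmann_word_prod:
  "word_prod grassmann grassmann_gen w
    = grassmann_ideal +>\<^bsub>free_algebra UNIV\<^esub> single w (1::'k::field)"
proof -
  interpret kalgebra "grassmann :: ('k, _) module" by (rule kalgebra_grassmann)
  have "word_prod grassmann (grassmann_gen :: nat \<Rightarrow> (_ \<Rightarrow>\<^sub>0 'k) set) w \<in> carrier grassmann"
    by (rule word_prod_closed[of _ UNIV]) simp_all
  then show ?thesis
    unfolding grassmann_coset by (subst eval_poly_single[of _ UNIV]) simp_all
qed

lemma grassmann_square_zero:
  assumes "\<forall>w\<in>keys v. length w = 1"
  shows "eval_poly grassmann grassmann_gen v \<otimes>\<^bsub>grassmann\<^esub> eval_poly grassmann grassmann_gen v = \<zero>\<^bsub>grassmann\<^esub>"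
proof -
  interpret g: algebra_ideal "free_algebra UNIV" grassmann_ideal by (rule algebra_ideal_grassmann)
  interpret c: algebra_hom "free_algebra UNIV" grassmann "\<lambda>x. grassmann_ideal +>\<^bsub>free_algebra UNIV\<^esub> x"
    unfolding grassmann_def by (rule g.coset_hom)
  have "v \<otimes>\<^bsub>free_algebra UNIV\<^esub> v \<in> grassmann_ideal"
    unfolding grassmann_ideal_def using g.genideal_self[OF grassmann_relators_subset] assms by blast
  then have "grassmann_ideal +>\<^bsub>free_algebra UNIV\<^esub> (v \<otimes>\<^bsub>free_algebra UNIV\<^esub> v) = \<zero>\<^bsub>grassmann\<^esub>"
    unfolding grassmann_def g.quota_ops by (rule g.I.a_rcos_const)
  moreover have "v \<in> carrier (free_algebra UNIV)" by simp
  ultimately show ?thesis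
    unfolding grassmann_coset[symmetric] using c.hom_mult[of v v] by metis
qed

lemma (in kalgebra) add_zero_imp_neg:
  "x \<in> carrier A \<Longrightarrow> y \<in> carrier A \<Longrightarrow> x \<oplus> y = \<zero> \<Longrightarrow> x = (- 1) \<odot> y"
  using minus_equality[of x y] by (simp add: uminus_smult)

text \<open>Polarisation: expand the square of \<open>e\<^sub>i + e\<^sub>j\<close>.\<close>

lemma grassmann_gen_anticommute:
  "grassmann_gen i \<otimes>\<^bsub>grassmann\<^esub> grassmann_gen j
    = (- 1) \<odot>\<^bsub>grassmann\<^esub> (grassmann_gen j \<otimes>\<^bsub>grassmann\<^esub> (grassmann_gen i :: (nat list \<Rightarrow>\<^sub>0 'k::field) set))"
proof -
  interpret kalgebra "grassmann :: ('k, _) module" by (rule kalgebra_grassmann)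
  interpret ev: algebra_hom "free_algebra UNIV" "grassmann :: ('k, _) module" "eval_poly grassmann grassmann_gen"
    by (rule eval_poly_hom) simp
  let ?e = "grassmann_gen :: nat \<Rightarrow> (nat list \<Rightarrow>\<^sub>0 'k) set"
  have e: "eval_poly grassmann ?e (single [k] 1) = ?e k" for k
    by (subst eval_poly_single[of _ UNIV]) simp_all
  have sq: "?e k \<otimes>\<^bsub>grassmann\<^esub> ?e k = \<zero>\<^bsub>grassmann\<^esub>" for k
    using grassmann_square_zero[of "single [k] (1::'k)"] by (simp add: e)
  have "\<forall>w\<in>keys (single [i] (1::'k) + single [j] 1). length w = 1"
    using keys_add[of "single [i] (1::'k)" "single [j] 1"] by auto
  from grassmann_square_zero[OF this]
  have "(?e i \<oplus>\<^bsub>grassmann\<^esub> ?e j) \<otimes>\<^bsub>grassmann\<^esub> (?e i \<oplus>\<^bsub>grassmann\<^esub> ?e j) = \<zero>\<^bsub>grassmann\<^esub>"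
    using ev.hom_add[of "single [i] 1" "single [j] 1"] by (simp add: e)
  then have "?e i \<otimes>\<^bsub>grassmann\<^esub> ?e j \<oplus>\<^bsub>grassmann\<^esub> ?e j \<otimes>\<^bsub>grassmann\<^esub> ?e i = \<zero>\<^bsub>grassmann\<^esub>"
    by (simp add: l_distr r_distr sq a_comm)
  then show ?thesis by (intro add_zero_imp_neg) simp_all
qed

text \<open>Indexing the parts by a natural number, of which only the parity counts, makes degrees add under multiplication.\<close>

definition grassmann_part :: "nat \<Rightarrow> (nat list \<Rightarrow>\<^sub>0 'k::field) set set" where
  "grassmann_part d = (if even d then grassmann_even else grassmann_odd)"

lemma grassmann_part_eq:
  "grassmann_part d = eval_poly grassmann grassmann_gen
    ` {f. keys f \<subseteq> {w. even (length w) \<longleftrightarrow> even d}}"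
proof (cases "even d")
  case True
  then show ?thesis
    unfolding grassmann_part_def grassmann_even_def grassmann_coset by (simp add: image_def subset_iff) blast
next
  case False
  then show ?thesis
    unfolding grassmann_part_def grassmann_odd_def grassmann_coset by (simp add: image_def subset_iff) blast
qed

lemma grassmann_part_subspace: "subspace_of (grassmann_part d) (grassmann :: ('k::field, _) module)"
proof -
  interpret kalgebra "grassmann :: ('k, _) module" by (rule kalgebra_grassmann)
  interpret ev: algebra_hom "free_algebra UNIV" "grassmann :: ('k, _) module" "eval_poly grassmann grassmann_gen"
    by (rule eval_poly_hom) simp
  let ?ev = "eval_poly grassmann (grassmann_gen :: nat \<Rightarrow> (nat list \<Rightarrow>\<^sub>0 'k) set)"
  show ?thesis
  proof (rule subspace_ofI)
    show "grassmann_part d \<subseteq> carrier (grassmann :: ('k, _) module)"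
    proof -
      have "?ev f \<in> carrier grassmann" for f by (rule eval_poly_closed[of _ UNIV]) simp_all
      then show ?thesis by (auto simp: grassmann_part_eq)
    qed
    show "\<zero>\<^bsub>grassmann :: ('k, _) module\<^esub> \<in> grassmann_part d"
      unfolding grassmann_part_eq by (rule image_eqI[of _ _ 0]) (simp_all add: eval_poly_lin_ext)
  next
    fix x y :: "(nat list \<Rightarrow>\<^sub>0 'k) set" assume "x \<in> grassmann_part d" "y \<in> grassmann_part d"
    then obtain f g where fg: "x = ?ev f" "y = ?ev g" "keys f \<subseteq> {w. even (length w) \<longleftrightarrow> even d}"
      "keys g \<subseteq> {w. even (length w) \<longleftrightarrow> even d}"
      unfolding grassmann_part_eq by blast
    have "x \<oplus>\<^bsub>grassmann\<^esub> y = ?ev (f + g)" using ev.hom_add[of f g] fg by simp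
    then show "x \<oplus>\<^bsub>grassmann\<^esub> y \<in> grassmann_part d"
      unfolding grassmann_part_eq using keys_add_subset[OF fg(3,4)] by blast
  next
    fix c and x :: "(nat list \<Rightarrow>\<^sub>0 'k) set" assume "x \<in> grassmann_part d"
    then obtain f where f: "x = ?ev f" "keys f \<subseteq> {w. even (length w) \<longleftrightarrow> even d}"
      unfolding grassmann_part_eq by blast
    have "c \<odot>\<^bsub>grassmann\<^esub> x = ?ev (scale c f)" using ev.hom_smult[of f c] f by simp
    then show "c \<odot>\<^bsub>grassmann\<^esub> x \<in> grassmann_part d"
      unfolding grassmann_part_eq using keys_scale_subset[OF f(2), of c] by blast
  qed
qed

lemma grassmann_part_mult:
  assumes "x \<in> grassmann_part d" "y \<in> grassmann_part d'"
  shows "x \<otimes>\<^bsub>grassmann\<^esub> y \<in> (grassmann_part (d + d') :: (nat list \<Rightarrow>\<^sub>0 'k::field) set set)"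
proof -
  interpret kalgebra "grassmann :: ('k, _) module" by (rule kalgebra_grassmann)
  interpret ev: algebra_hom "free_algebra UNIV" "grassmann :: ('k, _) module" "eval_poly grassmann grassmann_gen"
    by (rule eval_poly_hom) simp
  let ?ev = "eval_poly grassmann (grassmann_gen :: nat \<Rightarrow> (nat list \<Rightarrow>\<^sub>0 'k) set)"
  obtain f g where fg: "x = ?ev f" "y = ?ev g" "keys f \<subseteq> {w. even (length w) \<longleftrightarrow> even d}"
      "keys g \<subseteq> {w. even (length w) \<longleftrightarrow> even d'}"
    using assms unfolding grassmann_part_eq by blast
  have "f \<otimes>\<^bsub>free_algebra UNIV\<^esub> g = (\<Sum>a\<in>keys f. \<Sum>b\<in>keys g.
      single (a @ b) (lookup f a * lookup g b))"
    unfolding free_algebra_def by (subst monoid_algebra_mult_superset[OF finite_keys finite_keys order.refl order.refl]) simp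
  also have "keys \<dots> \<subseteq> {w. even (length w) \<longleftrightarrow> even (d + d')}"
    using fg(3,4) by (intro keys_sum_subset) (auto split: if_splits)
  finally have "keys (f \<otimes>\<^bsub>free_algebra UNIV\<^esub> g) \<subseteq> {w. even (length w) \<longleftrightarrow> even (d + d')}" .
  moreover have "x \<otimes>\<^bsub>grassmann\<^esub> y = ?ev (f \<otimes>\<^bsub>free_algebra UNIV\<^esub> g)" using ev.hom_mult[of f g] fg by simp
  ultimately show ?thesis unfolding grassmann_part_eq by blast
qed

lemma grassmann_part_commute:
  assumes "x \<in> grassmann_part d" "y \<in> grassmann_part d'"
  shows "x \<otimes>\<^bsub>grassmann\<^esub> y = (- 1) ^ (d * d') \<odot>\<^bsub>grassmann\<^esub> (y \<otimes>\<^bsub>grassmann\<^esub> (x :: (nat list \<Rightarrow>\<^sub>0 'k::field) set))"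
proof -
  interpret kalgebra "grassmann :: ('k, _) module" by (rule kalgebra_grassmann)
  let ?e = "grassmann_gen :: nat \<Rightarrow> (nat list \<Rightarrow>\<^sub>0 'k) set"
  obtain f g where fg: "x = eval_poly grassmann ?e f" "y = eval_poly grassmann ?e g"
      "keys f \<subseteq> {w. even (length w) \<longleftrightarrow> even d}"
      "keys g \<subseteq> {w. even (length w) \<longleftrightarrow> even d'}"
    using assms unfolding grassmann_part_eq by blast
  have deg: "word_degree (\<lambda>_. Suc 0) w = length w" for w :: "nat list" by (induction w) auto
  have anticommute: "?e i \<otimes>\<^bsub>grassmann\<^esub> ?e j = (- 1) ^ (Suc 0 * Suc 0) \<odot>\<^bsub>grassmann\<^esub> (?e j \<otimes>\<^bsub>grassmann\<^esub> ?e i)" for i j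
    using grassmann_gen_anticommute[of i j] by simp
  have "word_prod grassmann ?e w \<otimes>\<^bsub>grassmann\<^esub> word_prod grassmann ?e w'
      = (- 1) ^ (d * d') \<odot>\<^bsub>grassmann\<^esub> (word_prod grassmann ?e w' \<otimes>\<^bsub>grassmann\<^esub> word_prod grassmann ?e w)"
    if "even (length w) \<longleftrightarrow> even d" "even (length w') \<longleftrightarrow> even d'" for w w'
  proof -
    have "(- 1 :: 'k) ^ (length w * length w') = (- 1) ^ (d * d')"
      using that by (simp add: minus_one_power_iff)
    then show ?thesis
      using word_prod_supercommute[of ?e UNIV "\<lambda>_. Suc 0" w w', OF _ anticommute] by (simp add: deg)
  qed
  then show ?thesis
    unfolding fg(1,2)
    by (intro eval_poly_twisted_commute[of ?e UNIV "{w. even (length w) \<longleftrightarrow> even d}" "{w. even (length w) \<longleftrightarrow> even d'}"] fg(3,4))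
      simp_all
qed

section \<open>Vanishing power sums\<close>

lemma poly_interpolation:
  fixes g :: "'k::field \<Rightarrow> 'k"
  assumes "finite N"
  shows "\<exists>p. \<forall>x\<in>N. poly p x = g x"
  using assms
proof (induction N)
  case (insert a N)
  then obtain p where p: "\<forall>x\<in>N. poly p x = g x" by blast
  define q where "q = (\<Prod>x\<in>N. [:- x, 1:])"
  have q: "poly q x = 0 \<longleftrightarrow> x \<in> N" for x
    using insert(1) by (auto simp: q_def poly_prod)
  define p' where "p' = p + smult ((g a - poly p a) / poly q a) q"
  have "poly p' x = g x" if "x \<in> insert a N" for x
    using that p q[of x] q[of a] insert(2) by (auto simp: p'_def)
  then show ?case by blast
qed simp

text \<open>
  The hypothesis extends from powers to polynomials by linearity, and every function agrees with a
  polynomial on the finite set of the \<open>\<nu> w\<close>.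
\<close>

lemma (in kalgebra) power_sums_vanish:
  assumes W: "finite W" and y: "y \<in> W \<rightarrow> carrier A"
    and power: "\<And>k::nat. (\<Oplus>w\<in>W. (c w * \<nu> w ^ k) \<odot> y w) = \<zero>"
  shows "(\<Oplus>w\<in>W. (c w * g (\<nu> w)) \<odot> y w) = \<zero>"
proof -
  have y' [simp]: "y w \<in> carrier A" if "w \<in> W" for w using y that by auto
  have "(\<Oplus>w\<in>W. (c w * (\<nu> w ^ k * poly p (\<nu> w))) \<odot> y w) = \<zero>" for p k
  proof (induction p arbitrary: k)
    case 0
    have "(\<Oplus>w\<in>W. (c w * (\<nu> w ^ k * poly 0 (\<nu> w))) \<odot> y w) = (\<Oplus>w\<in>W. \<zero>)"
      by (intro finsum_cong') auto
    then show ?case by simp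
  next
    case (pCons a p)
    have "(\<Oplus>w\<in>W. (c w * (\<nu> w ^ k * poly (pCons a p) (\<nu> w))) \<odot> y w)
      = (\<Oplus>w\<in>W. a \<odot> ((c w * \<nu> w ^ k) \<odot> y w) \<oplus> (c w * (\<nu> w ^ Suc k * poly p (\<nu> w))) \<odot> y w)"
      by (intro finsum_cong') (auto simp: smult_smult smult_add_left[symmetric] algebra_simps)
    also have "\<dots> = (\<Oplus>w\<in>W. a \<odot> ((c w * \<nu> w ^ k) \<odot> y w)) \<oplus> (\<Oplus>w\<in>W. (c w * (\<nu> w ^ Suc k * poly p (\<nu> w))) \<odot> y w)"
      by (intro finsum_addf) auto
    also have "(\<Oplus>w\<in>W. a \<odot> ((c w * \<nu> w ^ k) \<odot> y w)) = a \<odot> (\<Oplus>w\<in>W. (c w * \<nu> w ^ k) \<odot> y w)"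
      by (intro smult_finsum[symmetric] W) auto
    finally show ?case using pCons.IH[of "Suc k"] power[of k] by simp
  qed
  from this[of 0] have all: "(\<Oplus>w\<in>W. (c w * poly p (\<nu> w)) \<odot> y w) = \<zero>" for p by simp
  obtain p where p: "\<forall>x\<in>\<nu> ` W. poly p x = g x" using poly_interpolation[of "\<nu> ` W"] W by blast
  have "(\<Oplus>w\<in>W. (c w * g (\<nu> w)) \<odot> y w) = (\<Oplus>w\<in>W. (c w * poly p (\<nu> w)) \<odot> y w)"
    using p by (intro finsum_cong') auto
  then show ?thesis using all by simp
qed

text \<open>
  Taking for \<open>g\<close> in the preceding lemma the indicator functions of the values of \<open>\<nu>\<close> isolates the terms
  with \<open>\<nu> w = n\<close>; each of these partial sums may then be multiplied by its own factor \<open>E n\<close>.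
\<close>

lemma (in kalgebra) power_sums_coefficients:
  assumes W: "finite W" and y: "y \<in> W \<rightarrow> carrier A" and E: "\<And>n. E n \<in> carrier A"
    and power: "\<And>k::nat. (\<Oplus>w\<in>W. (c w * \<nu> w ^ k) \<odot> y w) = \<zero>"
  shows "(\<Oplus>w\<in>W. c w \<odot> (E (\<nu> w) \<otimes> y w)) = \<zero>"
proof -
  have y' [simp]: "y w \<in> carrier A" if "w \<in> W" for w using y that by auto
  note E [simp]
  have "(\<Oplus>w\<in>W. c w \<odot> (E (\<nu> w) \<otimes> y w))
      = (\<Oplus>w\<in>W. \<Oplus>n\<in>\<nu> ` W. if \<nu> w = n then c w \<odot> (E (\<nu> w) \<otimes> y w) else \<zero>)"
    using W by (intro finsum_cong') (auto simp: finsum_delta)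
  also have "\<dots> = (\<Oplus>n\<in>\<nu> ` W. \<Oplus>w\<in>W. if \<nu> w = n then c w \<odot> (E (\<nu> w) \<otimes> y w) else \<zero>)"
    using W by (intro finsum_swap) auto
  also have "\<dots> = (\<Oplus>n\<in>\<nu> ` W. \<zero>)"
  proof (intro finsum_cong' refl)
    fix n
    have "(\<Oplus>w\<in>W. if \<nu> w = n then c w \<odot> (E (\<nu> w) \<otimes> y w) else \<zero>)
        = (\<Oplus>w\<in>W. E n \<otimes> ((c w * (if \<nu> w = n then 1 else 0)) \<odot> y w))"
      by (intro finsum_cong') (auto simp: smult_mult_right)
    also have "\<dots> = E n \<otimes> (\<Oplus>w\<in>W. (c w * (if \<nu> w = n then 1 else 0)) \<odot> y w)"
      using W by (intro finsum_rdistr[symmetric]) auto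
    also have "(\<Oplus>w\<in>W. (c w * (if \<nu> w = n then 1 else 0)) \<odot> y w) = \<zero>"
      by (rule power_sums_vanish[OF W y power, of "\<lambda>x. if x = n then 1 else 0"])
    finally show "(\<Oplus>w\<in>W. if \<nu> w = n then c w \<odot> (E (\<nu> w) \<otimes> y w) else \<zero>) = \<zero>" by simp
  qed simp
  finally show ?thesis by simp
qed

section \<open>Even and odd letters of a word\<close>

primrec lefts :: "('x + 'y) list \<Rightarrow> 'x list" where
  "lefts [] = []"
| "lefts (z # w) = (case z of Inl x \<Rightarrow> x # lefts w | Inr _ \<Rightarrow> lefts w)"

primrec rights :: "('x + 'y) list \<Rightarrow> 'y list" where
  "rights [] = []"
| "rights (z # w) = (case z of Inl _ \<Rightarrow> rights w | Inr y \<Rightarrow> y # rights w)"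

lemma gen_degree_simps [simp]: "gen_degree (Inl x) = 0" "gen_degree (Inr y) = 1"
  by (simp_all add: gen_degree_def)

lemma word_degree_Inl [simp]: "word_degree (gen_degree \<circ> Inl) v = 0"
  by (induction v) simp_all

lemma in_Plus_simps [simp]:
  "Inl x \<in> Sum_Type.Plus U W \<longleftrightarrow> x \<in> U" "Inr y \<in> Sum_Type.Plus U W \<longleftrightarrow> y \<in> W"
  by auto

lemma lefts_rights_in:
  "w \<in> lists (Sum_Type.Plus U W) \<Longrightarrow> lefts w \<in> lists U \<and> rights w \<in> lists W"
  by (induction w) auto

lemma (in kalgebra) word_prod_commute_perm:
  assumes \<phi>: "\<phi> \<in> V \<rightarrow> carrier A"
    and comm: "\<And>s t. s \<in> V \<Longrightarrow> t \<in> V \<Longrightarrow> \<phi> s \<otimes> \<phi> t = \<phi> t \<otimes> \<phi> s"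
  shows "v \<in> lists V \<Longrightarrow> mset v = mset w \<Longrightarrow> word_prod A \<phi> v = word_prod A \<phi> w"
proof (induction v arbitrary: w)
  case (Cons t v)
  have t: "t \<in> V" "\<phi> t \<in> carrier A" and v: "v \<in> lists V" using Cons.prems \<phi> by auto
  have "t \<in> set w" using Cons.prems(2) by (metis list.set_intros(1) set_mset_mset)
  then obtain x y where w: "w = x @ t # y" by (meson split_list)
  have "set w = set (t # v)" using Cons.prems(2) by (metis set_mset_mset)
  then have xy: "x \<in> lists V" "y \<in> lists V" using Cons.prems(1) w by auto
  have cl: "word_prod A \<phi> x \<in> carrier A" "word_prod A \<phi> y \<in> carrier A"
    using word_prod_closed[OF \<phi>] xy by blast+
  have x_t: "word_prod A \<phi> x \<otimes> \<phi> t = \<phi> t \<otimes> word_prod A \<phi> x"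
    using word_prod_supercommute[OF \<phi>, of "\<lambda>_. 0" x "[t]"] comm t xy cl \<phi> by (simp add: Pi_iff)
  have "word_prod A \<phi> v = word_prod A \<phi> (x @ y)"
    using Cons.prems(2) w by (intro Cons.IH v) simp
  then have "word_prod A \<phi> (t # v) = \<phi> t \<otimes> (word_prod A \<phi> x \<otimes> word_prod A \<phi> y)"
    using word_prod_append[OF \<phi> xy] by simp
  also have "\<dots> = word_prod A \<phi> x \<otimes> (\<phi> t \<otimes> word_prod A \<phi> y)"
    using t cl x_t by (simp add: m_assoc[symmetric])
  also have "\<dots> = word_prod A \<phi> w"
    using word_prod_append[OF \<phi>, of x "t # y"] xy t w by simp
  finally show ?case .
qed simp

text \<open>Even letters commute with all letters, so they can be collected in front.\<close>

lemma (in kalgebra) word_prod_split: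
  assumes \<phi>: "\<phi> \<in> V \<rightarrow> carrier A"
    and comm: "\<And>s t. s \<in> V \<Longrightarrow> t \<in> V \<Longrightarrow>
      \<phi> s \<otimes> \<phi> t = (- 1) ^ (gen_degree s * gen_degree t) \<odot> (\<phi> t \<otimes> \<phi> s)"
  shows "w \<in> lists V \<Longrightarrow> word_prod A \<phi> w
    = word_prod A \<phi> (map Inl (lefts w)) \<otimes> word_prod A \<phi> (map Inr (rights w))"
proof (induction w)
  case (Cons z w)
  have z: "z \<in> V" "\<phi> z \<in> carrier A" and w: "w \<in> lists V" using Cons.prems \<phi> by auto
  have lr: "map Inl (lefts w) \<in> lists V" "map Inr (rights w) \<in> lists V"
    using w by (induction w) (auto split: sum.splits)
  then have cl: "word_prod A \<phi> (map Inl (lefts w)) \<in> carrier A" "word_prod A \<phi> (map Inr (rights w)) \<in> carrier A"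
    using word_prod_closed[OF \<phi>] by blast+
  show ?case
  proof (cases z)
    case (Inl x)
    then show ?thesis using Cons.IH[OF w] z cl by (simp add: m_assoc)
  next
    case (Inr y)
    have "\<phi> z \<otimes> word_prod A \<phi> (map Inl (lefts w)) = word_prod A \<phi> (map Inl (lefts w)) \<otimes> \<phi> z"
      using word_prod_supercommute[OF \<phi> comm, where w="[z]", OF _ _ _ lr(1)] z cl by simp
    then have "\<phi> z \<otimes> (word_prod A \<phi> (map Inl (lefts w)) \<otimes> word_prod A \<phi> (map Inr (rights w)))
      = word_prod A \<phi> (map Inl (lefts w)) \<otimes> (\<phi> z \<otimes> word_prod A \<phi> (map Inr (rights w)))"
      using z cl by (simp add: m_assoc[symmetric])
    then show ?thesis using Cons.IH[OF w] Inr by simp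
  qed
qed simp

section \<open>The free supercommutative algebra\<close>

abbreviation "supercomm_relators Z \<equiv> {single [a, b] 1
        - single [b, a] ((- 1) ^ (gen_degree a * gen_degree b))
        | a b. a \<in> Z \<and> b \<in> Z}"

lemma supercomm_relators_subset:
  "supercomm_relators Z \<subseteq> (carrier (free_algebra Z) :: ((_ + _) list \<Rightarrow>\<^sub>0 'k::field) set)"
proof
  fix r :: "(_ + _) list \<Rightarrow>\<^sub>0 'k" assume "r \<in> supercomm_relators Z"
  then obtain a b where r: "r = single [a, b] 1 + (- single [b, a] ((- 1) ^ (gen_degree a * gen_degree b)))"
    and ab: "a \<in> Z" "b \<in> Z" by auto
  have "keys r \<subseteq> lists Z"
    unfolding r using ab by (intro keys_add_subset) simp_all
  then show "r \<in> carrier (free_algebra Z)" by simp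
qed

lemma algebra_ideal_supercomm: "algebra_ideal (free_algebra (Sum_Type.Plus U W)) (supercomm_ideal U W)"
  unfolding supercomm_ideal_def
  by (rule kalgebra.algebra_ideal_genideal[OF kalgebra_free_algebra supercomm_relators_subset])

lemma kalgebra_free_supercomm: "kalgebra (free_supercomm U W)"
  unfolding free_supercomm_def by (rule algebra_ideal.kalgebra_quota[OF algebra_ideal_supercomm])

lemma supercomm_gen_closed: "z \<in> Sum_Type.Plus U W \<Longrightarrow> supercomm_gen U W z \<in> carrier (free_supercomm U W)"
  unfolding free_supercomm_def supercomm_gen_def
  by (rule algebra_ideal.coset_closed[OF algebra_ideal_supercomm]) simp

lemma free_supercomm_coset:
  assumes "keys f \<subseteq> lists (Sum_Type.Plus U W)"
  shows "supercomm_ideal U W +>\<^bsub>free_algebra (Sum_Type.Plus U W)\<^esub> f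
    = eval_poly (free_supercomm U W) (supercomm_gen U W) f"
proof -
  interpret c: algebra_hom "free_algebra (Sum_Type.Plus U W)" "free_supercomm U W"
    "\<lambda>x. supercomm_ideal U W +>\<^bsub>free_algebra (Sum_Type.Plus U W)\<^esub> x"
    unfolding free_supercomm_def by (rule algebra_ideal.coset_hom[OF algebra_ideal_supercomm])
  have "eval_poly (free_algebra (Sum_Type.Plus U W)) (\<lambda>t. single [t] 1) f = f"
    by (rule eval_poly_free_algebra[OF assms])
  then show ?thesis
    using c.hom_eval_poly[OF _ assms, of "\<lambda>t. single [t] 1"]
    by (simp add: supercomm_gen_def[abs_def])
qed

lemma eval_poly_supercomm_gen_zero_iff:
  assumes "keys f \<subseteq> lists (Sum_Type.Plus U W)"
  shows "eval_poly (free_supercomm U W) (supercomm_gen U W) f = \<zero>\<^bsub>free_supercomm U W\<^esub>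
    \<longleftrightarrow> f \<in> supercomm_ideal U W"
proof -
  interpret s: algebra_ideal "free_algebra (Sum_Type.Plus U W)" "supercomm_ideal U W"
    by (rule algebra_ideal_supercomm)
  show ?thesis
    unfolding free_supercomm_coset[OF assms, symmetric] unfolding free_supercomm_def s.quota_ops
    using assms by (intro s.coset_zero_iff) simp
qed

lemma (in kalgebra) eval_poly_relator:
  assumes \<phi>: "\<phi> \<in> V \<rightarrow> carrier A" and st: "s \<in> V" "t \<in> V"
  shows "eval_poly A \<phi> (single [s, t] 1 - single [t, s] c)
    = \<phi> s \<otimes> \<phi> t \<ominus> c \<odot> (\<phi> t \<otimes> \<phi> s)"
proof -
  have st': "\<phi> s \<in> carrier A" "\<phi> t \<in> carrier A" using assms by auto
  have "eval_poly A \<phi> (single [s, t] 1 - single [t, s] c)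
      = eval_poly A \<phi> (single [s, t] 1) \<ominus> eval_poly A \<phi> (single [t, s] c)"
    unfolding eval_poly_lin_ext using st' by (intro lin_ext_diff) (auto split: if_splits)
  also have "\<dots> = \<phi> s \<otimes> \<phi> t \<ominus> c \<odot> (\<phi> t \<otimes> \<phi> s)"
    using st st' by (simp add: eval_poly_single[OF \<phi>])
  finally show ?thesis .
qed

lemma supercomm_gen_commute:
  assumes "s \<in> Sum_Type.Plus U W" "t \<in> Sum_Type.Plus U W"
  shows "supercomm_gen U W s \<otimes>\<^bsub>free_supercomm U W\<^esub> supercomm_gen U W t
    = (- 1) ^ (gen_degree s * gen_degree t) \<odot>\<^bsub>free_supercomm U W\<^esub>
      (supercomm_gen U W t \<otimes>\<^bsub>free_supercomm U W\<^esub> (supercomm_gen U W s :: (_ \<Rightarrow>\<^sub>0 'k::field) set))"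
proof -
  let ?P = "free_supercomm U W :: ('k, _) module"
  let ?g = "supercomm_gen U W :: _ \<Rightarrow> (_ \<Rightarrow>\<^sub>0 'k) set"
  let ?r = "single [s, t] 1 - single [t, s] ((- 1) ^ (gen_degree s * gen_degree t)) :: _ \<Rightarrow>\<^sub>0 'k"
  interpret P: kalgebra ?P by (rule kalgebra_free_supercomm)
  interpret F: kalgebra "free_algebra (Sum_Type.Plus U W) :: ('k, _) module" by (rule kalgebra_free_algebra)
  have g: "?g \<in> Sum_Type.Plus U W \<rightarrow> carrier ?P" using supercomm_gen_closed by blast
  have mem: "?r \<in> supercomm_relators (Sum_Type.Plus U W)" using assms by blast
  then have "?r \<in> supercomm_ideal U W"
    unfolding supercomm_ideal_def using F.genideal_self[OF supercomm_relators_subset] by blast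
  moreover have "keys ?r \<subseteq> lists (Sum_Type.Plus U W)"
    using subsetD[OF supercomm_relators_subset mem] by simp
  ultimately have "eval_poly ?P ?g ?r = \<zero>\<^bsub>?P\<^esub>" by (simp only: eval_poly_supercomm_gen_zero_iff)
  then show ?thesis
    using Pi_mem[OF g assms(1)] Pi_mem[OF g assms(2)]
    unfolding P.eval_poly_relator[OF g assms] by (subst (asm) P.r_right_minus_eq) simp_all
qed

section \<open>Identities of the free supercommutative algebra\<close>

text \<open>Graded substitutions respect the relators because the Grassmann algebra is supercommutative.\<close>

lemma supercomm_ideal_vanishes:
  assumes a: "\<And>z. z \<in> Sum_Type.Plus U W \<Longrightarrow> a z \<in> grassmann_part (gen_degree z)"
    and f: "f \<in> supercomm_ideal U W"
  shows "eval_poly grassmann a f = (\<zero>\<^bsub>grassmann\<^esub> :: (_ \<Rightarrow>\<^sub>0 'k::field) set)"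
proof -
  let ?G = "grassmann :: ('k, _) module" and ?Z = "Sum_Type.Plus U W"
  interpret G: kalgebra ?G by (rule kalgebra_grassmann)
  have a': "a \<in> ?Z \<rightarrow> carrier ?G"
    using a G.subspace_of_subset[OF grassmann_part_subspace] by blast
  interpret ev: algebra_hom "free_algebra ?Z" ?G "eval_poly ?G a" by (rule G.eval_poly_hom[OF a'])
  show ?thesis
  proof (rule ev.genideal_kernel[OF supercomm_relators_subset])
    show "f \<in> Idl\<^bsub>free_algebra ?Z\<^esub> supercomm_relators ?Z" using f by (simp only: supercomm_ideal_def)
    fix x assume "x \<in> (supercomm_relators ?Z :: (_ \<Rightarrow>\<^sub>0 'k) set)"
    then obtain s t where x: "x = single [s, t] 1
        - single [t, s] ((- 1) ^ (gen_degree s * gen_degree t))" and st: "s \<in> ?Z" "t \<in> ?Z"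
      by blast
    have cl: "a s \<in> carrier ?G" "a t \<in> carrier ?G" using a' st by auto
    show "eval_poly ?G a x = \<zero>\<^bsub>?G\<^esub>"
      unfolding x G.eval_poly_relator[OF a' st] using grassmann_part_commute[OF a[OF st(1)] a[OF st(2)]] cl
      by (subst G.r_right_minus_eq) simp_all
  qed
qed

text \<open>
  Universal property of the Grassmann algebra: a linear combination \<open>u\<close> of anticommuting elements
  anticommutes with itself, so \<open>2 u\<^sup>2 = 0\<close>. It provides the homomorphism from \<open>G\<close> back to the free
  supercommutative algebra.
\<close>

lemma grassmann_ideal_vanishes:
  assumes P: "kalgebra P" and char: "(2::'k::field) \<noteq> 0"
    and \<psi>: "\<And>i. \<psi> i \<in> carrier P"
    and comm: "\<And>i j. \<psi> i \<otimes>\<^bsub>P\<^esub> \<psi> j = (- 1 :: 'k) \<odot>\<^bsub>P\<^esub> (\<psi> j \<otimes>\<^bsub>P\<^esub> \<psi> i)"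
    and f: "f \<in> grassmann_ideal"
  shows "eval_poly P \<psi> f = \<zero>\<^bsub>P\<^esub>"
proof -
  interpret P: kalgebra P by fact
  have \<psi>': "\<psi> \<in> UNIV \<rightarrow> carrier P" using \<psi> by simp
  interpret ev: algebra_hom "free_algebra UNIV" P "eval_poly P \<psi>" by (rule P.eval_poly_hom[OF \<psi>'])
  show ?thesis
  proof (rule ev.genideal_kernel[OF grassmann_relators_subset])
    show "f \<in> Idl\<^bsub>free_algebra UNIV\<^esub> {v \<otimes>\<^bsub>free_algebra UNIV\<^esub> v | v. \<forall>w\<in>keys v. length w = 1}"
      using f by (simp only: grassmann_ideal_def)
    fix x :: "nat list \<Rightarrow>\<^sub>0 'k"
    assume "x \<in> {v \<otimes>\<^bsub>free_algebra UNIV\<^esub> v | v. \<forall>w\<in>keys v. length w = 1}"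
    then obtain v where x: "x = v \<otimes>\<^bsub>free_algebra UNIV\<^esub> v" and v: "\<forall>w\<in>keys v. length w = 1"
      by blast
    let ?u = "eval_poly P \<psi> v"
    have u: "?u \<in> carrier P" by (rule P.eval_poly_closed[OF \<psi>']) simp
    define q where "q = ?u \<otimes>\<^bsub>P\<^esub> ?u"
    have q: "q \<in> carrier P" using u by (simp add: q_def)
    have "q = (- 1) \<odot>\<^bsub>P\<^esub> q"
      unfolding q_def
    proof (rule P.eval_poly_twisted_commute[OF \<psi>', of "{w. length w = 1}" "{w. length w = 1}"])
      fix w w' :: "nat list" assume "w \<in> {w. length w = 1}" "w' \<in> {w. length w = 1}"
      then obtain i j where ij: "w = [i]" "w' = [j]" by (auto simp: length_Suc_conv)
      have "word_prod P \<psi> [k] = \<psi> k" for k using \<psi> by simp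
      then show "word_prod P \<psi> w \<otimes>\<^bsub>P\<^esub> word_prod P \<psi> w' = (- 1) \<odot>\<^bsub>P\<^esub> (word_prod P \<psi> w' \<otimes>\<^bsub>P\<^esub> word_prod P \<psi> w)"
        using comm[of i j] unfolding ij by presburger
    next
      show "keys v \<subseteq> {w. length w = 1}" using v by blast
      then show "keys v \<subseteq> {w. length w = 1}" .
    qed simp_all
    then have neg: "q = \<ominus>\<^bsub>P\<^esub> q" by (rule trans[OF _ P.uminus_smult[OF q]])
    have "(1 + 1) \<odot>\<^bsub>P\<^esub> q = q \<oplus>\<^bsub>P\<^esub> q"
      using q by (subst P.smult_add_left) simp_all
    also have "\<dots> = q \<oplus>\<^bsub>P\<^esub> \<ominus>\<^bsub>P\<^esub> q" by (fact arg_cong[OF neg, of "\<lambda>x. q \<oplus>\<^bsub>P\<^esub> x"])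
    also have "\<dots> = \<zero>\<^bsub>P\<^esub>" using q by (rule P.r_neg)
    finally have "(1 + 1) \<odot>\<^bsub>P\<^esub> q = \<zero>\<^bsub>P\<^esub>" .
    moreover have "(1 + 1 :: 'k) \<noteq> 0" using char by simp
    ultimately have "q = \<zero>\<^bsub>P\<^esub>" by (rule P.smult_eq_zeroD[OF q])
    then show "eval_poly P \<psi> x = \<zero>\<^bsub>P\<^esub>"
      unfolding x q_def by (subst ev.hom_mult) simp_all
  qed
qed

lemma eval_poly_grassmann_gen_zero_iff:
  "eval_poly grassmann grassmann_gen f = \<zero>\<^bsub>grassmann\<^esub> \<longleftrightarrow> f \<in> grassmann_ideal"
proof -
  interpret g: algebra_ideal "free_algebra UNIV" grassmann_ideal by (rule algebra_ideal_grassmann)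
  show ?thesis
    unfolding grassmann_coset[symmetric] unfolding grassmann_def g.quota_ops
    by (rule g.coset_zero_iff) simp
qed

lemma (in kalgebra) eval_poly_sum_single:
  assumes \<phi>: "\<phi> \<in> V \<rightarrow> carrier A" and S: "finite S" and w: "\<And>i. i \<in> S \<Longrightarrow> w i \<in> lists V"
  shows "eval_poly A \<phi> (\<Sum>i\<in>S. single (w i) (c i)) = (\<Oplus>i\<in>S. c i \<odot> word_prod A \<phi> (w i))"
proof -
  have cl: "word_prod A \<phi> v \<in> carrier A" if "v \<in> lists V" for v by (rule word_prod_closed[OF \<phi> that])
  have "eval_poly A \<phi> (\<Sum>i\<in>S. single (w i) (c i))
      = (\<Oplus>i\<in>S. lin_ext A (word_prod A \<phi>) (single (w i) (c i)))"
    unfolding eval_poly_lin_ext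
  proof (rule lin_ext_sum[where V="lists V", OF S])
    show "keys (single (w i) (c i)) \<subseteq> lists V" if "i \<in> S" for i
      using w[OF that] by simp
    show "word_prod A \<phi> \<in> lists V \<rightarrow> carrier A" using cl by (rule Pi_I)
  qed
  also have "\<dots> = (\<Oplus>i\<in>S. c i \<odot> word_prod A \<phi> (w i))"
  proof (intro finsum_cong' refl Pi_I)
    fix i assume "i \<in> S"
    from cl[OF w[OF this]]
    show "lin_ext A (word_prod A \<phi>) (single (w i) (c i)) = c i \<odot> word_prod A \<phi> (w i)"
      and "c i \<odot> word_prod A \<phi> (w i) \<in> carrier A" by (rule lin_ext_single, rule smult_in)
  qed
  finally show ?thesis .
qed

lemma one_grassmann_part: "\<one>\<^bsub>grassmann\<^esub> \<in> (grassmann_part 0 :: (_ \<Rightarrow>\<^sub>0 'k::field) set set)"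
proof -
  have "\<one>\<^bsub>grassmann\<^esub> = grassmann_ideal +>\<^bsub>free_algebra UNIV\<^esub> single [] (1::'k)"
    using grassmann_word_prod[of "[]", where 'k='k] by simp
  moreover have "\<forall>w\<in>keys (single ([] :: nat list) (1::'k)). even (length w)" by simp
  ultimately show ?thesis unfolding grassmann_part_def grassmann_even_def by (simp only: even_zero if_True) blast
qed

lemma grassmann_gen_part: "grassmann_gen i \<in> (grassmann_part 1 :: (_ \<Rightarrow>\<^sub>0 'k::field) set set)"
proof -
  have "\<forall>w\<in>keys (single [i] (1::'k)). odd (length w)" by simp
  then show ?thesis unfolding grassmann_part_def grassmann_odd_def grassmann_gen_def by (simp only: odd_one if_False) blast
qed

text \<open>By unique factorization, the product of the codes of a list determines its multiset of entries.\<close>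

definition prime_code :: "'x::countable \<Rightarrow> nat" where
  "prime_code x = enumerate {p. prime p} (to_nat x)"

lemma prime_prime_code: "prime (prime_code x)"
  unfolding prime_code_def using enumerate_in_set[OF primes_infinite, of "to_nat x"] by simp

lemma inj_prime_code: "inj prime_code"
proof (rule injI)
  fix x y :: 'a assume eq: "prime_code x = prime_code y"
  have "strict_mono (enumerate {p::nat. prime p})"
    by (rule strict_mono_enumerate[OF primes_infinite])
  then have "to_nat x = to_nat y"
    using eq unfolding prime_code_def by (simp only: strict_mono_eq)
  then show "x = y" by simp
qed

lemma prod_prime_code_inj:
  fixes v w :: "'x::countable list"
  assumes "prod_list (map prime_code v) = prod_list (map prime_code w)"
  shows "mset v = mset w"
proof -
  have factors: "prime_factorization (prod_list (map prime_code v)) = image_mset prime_code (mset v)"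
    for v :: "'x list"
    unfolding prod_mset_prod_list[symmetric] mset_map
    by (rule prime_factorization_prod_mset_primes) (auto simp: prime_prime_code)
  have "image_mset prime_code (mset v) = image_mset prime_code (mset w)"
    unfolding factors[symmetric] assms ..
  then have "image_mset (inv_into UNIV prime_code :: nat \<Rightarrow> 'x) (image_mset prime_code (mset v))
      = image_mset (inv_into UNIV prime_code) (image_mset prime_code (mset w))"
    by (rule arg_cong)
  moreover have "image_mset (inv_into UNIV prime_code) (image_mset prime_code M) = M" for M :: "'x multiset"
  proof -
    have "inv_into UNIV prime_code (prime_code x) = x" for x :: 'x
      by (rule inv_into_f_f[OF inj_prime_code UNIV_I])
    then show ?thesis by (induction M) simp_all
  qed
  ultimately show ?thesis by (simp only:)
qed

text \<open>
  The graded identities of the Grassmann algebra follow from supercommutativity. Scalar values for the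
  even letters suffice to separate words with different even parts, and the odd parts are
  compared inside the free supercommutative algebra through \<open>grassmann_ideal_vanishes\<close>.
\<close>

theorem supercomm_ideal_iff_grassmann_identity:
  fixes f :: "('x::countable + 'y::countable) list \<Rightarrow>\<^sub>0 'k::field_char_0"
  assumes f: "keys f \<subseteq> lists (Sum_Type.Plus U W)"
  shows "f \<in> supercomm_ideal U W \<longleftrightarrow>
    (\<forall>a. (\<forall>z\<in>Sum_Type.Plus U W. a z \<in> grassmann_part (gen_degree z)) \<longrightarrow> eval_poly grassmann a f = \<zero>\<^bsub>grassmann\<^esub>)"
proof
  assume identity: "\<forall>a. (\<forall>z\<in>Sum_Type.Plus U W. a z \<in> grassmann_part (gen_degree z)) \<longrightarrow> eval_poly grassmann a f = \<zero>\<^bsub>grassmann\<^esub>"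
  let ?G = "grassmann :: ('k, _) module" and ?Z = "Sum_Type.Plus U W"
  let ?P = "free_supercomm U W :: ('k, _) module"
  let ?g = "supercomm_gen U W :: _ \<Rightarrow> (_ \<Rightarrow>\<^sub>0 'k) set"
  let ?e = "grassmann_gen :: nat \<Rightarrow> (_ \<Rightarrow>\<^sub>0 'k) set"
  interpret G: kalgebra ?G by (rule kalgebra_grassmann)
  interpret P: kalgebra ?P by (rule kalgebra_free_supercomm)
  have g: "?g \<in> ?Z \<rightarrow> carrier ?P" using supercomm_gen_closed by blast
  (* The even letters of w, as a multiset, are encoded by the integer N w, whose image in the field
     is \<nu> w; the odd letters become indices of generators of the Grassmann algebra. *)
  define N where "N w = prod_list (map prime_code (lefts w))" for w :: "('x + 'y) list"
  define \<nu> where "\<nu> w = (of_nat (N w) :: 'k)" for w :: "('x + 'y) list"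
  define odds where "odds w = map to_nat (rights w)" for w :: "('x + 'y) list"
  (* The map from generators of the Grassmann algebra back to odd letters; indices that encode no
     letter of W are sent to zero. *)
  define \<psi> where "\<psi> i = (if i \<in> to_nat ` W then ?g (Inr (from_nat i)) else \<zero>\<^bsub>?P\<^esub>)" for i
  have keysZ: "w \<in> lists ?Z" if "w \<in> keys f" for w using f that by blast
  have lr: "map Inl (lefts w) \<in> lists ?Z" "map Inr (rights w) \<in> lists ?Z" if "w \<in> keys f" for w
    using lefts_rights_in[OF keysZ[OF that]] by auto
  have \<psi>_to_nat: "\<psi> (to_nat y) = ?g (Inr y)" if "y \<in> W" for y
    using that by (simp add: \<psi>_def)
  have \<psi>_cases: "\<psi> i = \<zero>\<^bsub>?P\<^esub> \<or> (\<exists>y\<in>W. \<psi> i = ?g (Inr y))" for i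
    unfolding \<psi>_def by (cases "i \<in> to_nat ` W") auto
  have g_Inr: "?g (Inr y) \<in> carrier ?P" if "y \<in> W" for y
    using that by (intro Pi_mem[OF g]) simp
  have \<psi>_closed: "\<psi> i \<in> carrier ?P" for i
    using \<psi>_cases[of i] g_Inr P.zero_closed by metis
  have \<psi>_comm: "\<psi> i \<otimes>\<^bsub>?P\<^esub> \<psi> j = (- 1) \<odot>\<^bsub>?P\<^esub> (\<psi> j \<otimes>\<^bsub>?P\<^esub> \<psi> i)" for i j
  proof (cases "\<psi> i = \<zero>\<^bsub>?P\<^esub> \<or> \<psi> j = \<zero>\<^bsub>?P\<^esub>")
    case True
    then show ?thesis
      by (elim disjE) (simp_all only: P.l_null P.r_null P.smult_zero \<psi>_closed)
  next
    case False
    then obtain x y where xy: "x \<in> W" "\<psi> i = ?g (Inr x)" "y \<in> W" "\<psi> j = ?g (Inr y)"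
      using \<psi>_cases by metis
    have "(- 1 :: 'k) ^ (gen_degree (Inr x :: 'x + 'y) * gen_degree (Inr y :: 'x + 'y)) = - 1" by simp
    then show ?thesis
      using supercomm_gen_commute[of "Inr x" U W "Inr y", where 'k='k] xy(1,3) unfolding xy(2,4) by simp
  qed
  have \<psi>_odds: "word_prod ?P \<psi> (odds w) = word_prod ?P ?g (map Inr (rights w))" if "w \<in> lists ?Z" for w
  proof -
    have "word_prod ?P \<psi> (map to_nat v) = word_prod ?P ?g (map Inr v)" if "v \<in> lists W" for v
      using that by (induction v) (simp_all add: \<psi>_to_nat)
    then show ?thesis using lefts_rights_in[OF that] by (simp add: odds_def)
  qed
  have power: "(\<Oplus>\<^bsub>?P\<^esub>w\<in>keys f. (lookup f w * \<nu> w ^ k) \<odot>\<^bsub>?P\<^esub>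
      word_prod ?P ?g (map Inr (rights w))) = \<zero>\<^bsub>?P\<^esub>" for k
  proof -
    (* The substitution a is graded and turns a word w into \<nu> w ^ k times its odd letters. *)
    define a where "a z = (case z of Inl x \<Rightarrow> of_nat (prime_code x ^ k) \<odot>\<^bsub>?G\<^esub> \<one>\<^bsub>?G\<^esub> | Inr y \<Rightarrow> ?e (to_nat y))"
      for z :: "'x + 'y"
    have "a z \<in> grassmann_part (gen_degree z)" for z
      using grassmann_gen_part G.subspace_of_smult[OF grassmann_part_subspace one_grassmann_part]
      by (cases z) (simp_all add: a_def)
    then have zero: "eval_poly ?G a f = \<zero>\<^bsub>?G\<^esub>" using identity by blast
    have e_closed: "word_prod ?G ?e v \<in> carrier ?G" for v by (rule G.word_prod_closed[of _ UNIV]) simp_all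
    have word: "word_prod ?G a w = \<nu> w ^ k \<odot>\<^bsub>?G\<^esub> word_prod ?G ?e (odds w)" for w
    proof (induction w)
      case Nil
      then show ?case by (simp add: \<nu>_def N_def odds_def)
    next
      case (Cons z w)
      show ?case
      proof (cases z)
        case (Inl x)
        then show ?thesis
          using Cons e_closed[of "odds w"]
          by (simp add: a_def \<nu>_def N_def odds_def G.smult_mult_left G.smult_smult power_mult_distrib)
      next
        case (Inr y)
        then show ?thesis
          using Cons e_closed[of "odds w"]
          by (simp add: a_def \<nu>_def N_def odds_def G.smult_mult_right)
      qed
    qed
    let ?q = "\<Sum>w\<in>keys f. single (odds w) (lookup f w * \<nu> w ^ k)"
    have e: "?e \<in> UNIV \<rightarrow> carrier ?G" and \<psi>: "\<psi> \<in> UNIV \<rightarrow> carrier ?P" using \<psi>_closed by simp_all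
    have "eval_poly ?G ?e ?q
        = (\<Oplus>\<^bsub>?G\<^esub>w\<in>keys f. (lookup f w * \<nu> w ^ k) \<odot>\<^bsub>?G\<^esub> word_prod ?G ?e (odds w))"
      by (rule G.eval_poly_sum_single[OF e]) simp_all
    also have "\<dots> = (\<Oplus>\<^bsub>?G\<^esub>w\<in>keys f. lookup f w \<odot>\<^bsub>?G\<^esub> word_prod ?G a w)"
      unfolding word
      by (intro G.finsum_cong' refl Pi_I G.smult_in e_closed G.smult_smult[symmetric])
    also have "\<dots> = \<zero>\<^bsub>?G\<^esub>" using zero unfolding eval_poly_def .
    finally have q: "?q \<in> grassmann_ideal" unfolding eval_poly_grassmann_gen_zero_iff .
    have two: "(2::'k) \<noteq> 0" by simp
    have "eval_poly ?P \<psi> ?q = \<zero>\<^bsub>?P\<^esub>"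
      by (rule grassmann_ideal_vanishes[OF kalgebra_free_supercomm two \<psi>_closed \<psi>_comm q])
    moreover have "eval_poly ?P \<psi> ?q
        = (\<Oplus>\<^bsub>?P\<^esub>w\<in>keys f. (lookup f w * \<nu> w ^ k) \<odot>\<^bsub>?P\<^esub> word_prod ?P \<psi> (odds w))"
      by (rule P.eval_poly_sum_single[OF \<psi>]) simp_all
    moreover have "(\<Oplus>\<^bsub>?P\<^esub>w\<in>keys f. (lookup f w * \<nu> w ^ k) \<odot>\<^bsub>?P\<^esub> word_prod ?P \<psi> (odds w))
      = (\<Oplus>\<^bsub>?P\<^esub>w\<in>keys f. (lookup f w * \<nu> w ^ k) \<odot>\<^bsub>?P\<^esub> word_prod ?P ?g (map Inr (rights w)))"
    proof (intro P.finsum_cong' refl Pi_I)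
      fix w assume w: "w \<in> keys f"
      show "(lookup f w * \<nu> w ^ k) \<odot>\<^bsub>?P\<^esub> word_prod ?P ?g (map Inr (rights w)) \<in> carrier ?P"
        by (rule P.smult_in[OF P.word_prod_closed[OF g lr(2)[OF w]]])
      show "(lookup f w * \<nu> w ^ k) \<odot>\<^bsub>?P\<^esub> word_prod ?P \<psi> (odds w)
        = (lookup f w * \<nu> w ^ k) \<odot>\<^bsub>?P\<^esub> word_prod ?P ?g (map Inr (rights w))"
        using \<psi>_odds[OF keysZ[OF w]] by simp
    qed
    ultimately show ?thesis by simp
  qed
  (* Words with the same value of \<nu> have the same even letters up to order, so E n is the product of
     the even letters of any word w with \<nu> w = n. *)
  define E where "E n = (if \<exists>w\<in>keys f. \<nu> w = n
      then word_prod ?P ?g (map Inl (lefts (SOME w. w \<in> keys f \<and> \<nu> w = n))) else \<zero>\<^bsub>?P\<^esub>)" for n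
  have E_eq: "E (\<nu> w) = word_prod ?P ?g (map Inl (lefts w))" if w: "w \<in> keys f" for w
  proof -
    define w' where "w' = (SOME w'. w' \<in> keys f \<and> \<nu> w' = \<nu> w)"
    have w': "w' \<in> keys f" "\<nu> w' = \<nu> w"
      using someI[of "\<lambda>w'. w' \<in> keys f \<and> \<nu> w' = \<nu> w" w] w by (auto simp: w'_def)
    then have "mset (lefts w') = mset (lefts w)"
      by (intro prod_prime_code_inj) (simp add: \<nu>_def N_def)
    then have "word_prod ?P ?g (map Inl (lefts w')) = word_prod ?P ?g (map Inl (lefts w))"
    proof (intro P.word_prod_commute_perm[of ?g "Inl ` U"])
      show "?g \<in> Inl ` U \<rightarrow> carrier ?P" using g by auto
      show "map Inl (lefts w') \<in> lists (Inl ` U)" using lefts_rights_in[OF keysZ[OF w'(1)]] by auto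
      show "?g x \<otimes>\<^bsub>?P\<^esub> ?g y = ?g y \<otimes>\<^bsub>?P\<^esub> ?g x" if xy: "x \<in> Inl ` U" "y \<in> Inl ` U" for x y
      proof -
        have Z: "x \<in> ?Z" "y \<in> ?Z" and deg: "gen_degree x = 0" using xy by auto
        have "?g y \<otimes>\<^bsub>?P\<^esub> ?g x \<in> carrier ?P" by (intro P.m_closed Pi_mem[OF g] Z)
        then have one: "1 \<odot>\<^bsub>?P\<^esub> (?g y \<otimes>\<^bsub>?P\<^esub> ?g x) = ?g y \<otimes>\<^bsub>?P\<^esub> ?g x" by (rule P.one_smult)
        have "?g x \<otimes>\<^bsub>?P\<^esub> ?g y = 1 \<odot>\<^bsub>?P\<^esub> (?g y \<otimes>\<^bsub>?P\<^esub> ?g x)"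
          using supercomm_gen_commute[OF Z, where 'k='k] unfolding deg mult_zero_left power_0 .
        then show ?thesis unfolding one .
      qed
      show "mset (map Inl (lefts w')) = mset (map Inl (lefts w))"
        unfolding mset_map \<open>mset (lefts w') = mset (lefts w)\<close> ..
    qed
    moreover have "E (\<nu> w) = word_prod ?P ?g (map Inl (lefts w'))"
      unfolding E_def w'_def using w by (subst if_P) blast+
    ultimately show ?thesis by (simp only:)
  qed
  have E_closed: "E n \<in> carrier ?P" for n
  proof (cases "\<exists>w\<in>keys f. \<nu> w = n")
    case True
    then obtain w where "w \<in> keys f" "\<nu> w = n" by blast
    then show ?thesis using E_eq P.word_prod_closed[OF g lr(1)] by metis
  qed (simp add: E_def)
  have "(\<Oplus>\<^bsub>?P\<^esub>w\<in>keys f. lookup f w \<odot>\<^bsub>?P\<^esub>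
      (E (\<nu> w) \<otimes>\<^bsub>?P\<^esub> word_prod ?P ?g (map Inr (rights w)))) = \<zero>\<^bsub>?P\<^esub>"
    by (rule P.power_sums_coefficients[OF finite_keys _ E_closed power])
      (rule Pi_I, rule P.word_prod_closed[OF g lr(2)])
  moreover have "eval_poly ?P ?g f = (\<Oplus>\<^bsub>?P\<^esub>w\<in>keys f. lookup f w \<odot>\<^bsub>?P\<^esub>
      (E (\<nu> w) \<otimes>\<^bsub>?P\<^esub> word_prod ?P ?g (map Inr (rights w))))"
    unfolding eval_poly_def
  proof (intro P.finsum_cong' refl Pi_I)
    fix w assume w: "w \<in> keys f"
    show "lookup f w \<odot>\<^bsub>?P\<^esub> (E (\<nu> w) \<otimes>\<^bsub>?P\<^esub> word_prod ?P ?g (map Inr (rights w))) \<in> carrier ?P"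
      by (intro P.smult_in P.m_closed E_closed P.word_prod_closed[OF g lr(2)[OF w]])
    show "lookup f w \<odot>\<^bsub>?P\<^esub> word_prod ?P ?g w
        = lookup f w \<odot>\<^bsub>?P\<^esub> (E (\<nu> w) \<otimes>\<^bsub>?P\<^esub> word_prod ?P ?g (map Inr (rights w)))"
      unfolding E_eq[OF w]
      by (rule arg_cong[OF P.word_prod_split[OF g supercomm_gen_commute keysZ[OF w]]])
  qed
  ultimately have "eval_poly ?P ?g f = \<zero>\<^bsub>?P\<^esub>" by simp
  then show "f \<in> supercomm_ideal U W" using eval_poly_supercomm_gen_zero_iff[OF f] by simp
next
  assume "f \<in> supercomm_ideal U W"
  then show "\<forall>a. (\<forall>z\<in>Sum_Type.Plus U W. a z \<in> grassmann_part (gen_degree z)) \<longrightarrow> eval_poly grassmann a f = \<zero>\<^bsub>grassmann\<^esub>"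
    using supercomm_ideal_vanishes[where f=f and U=U and W=W] by metis
qed

section \<open>Bases of a superalgebra\<close>

lemma (in abelian_monoid) finsum_Plus:
  assumes "finite U" "finite W" "f \<in> Sum_Type.Plus U W \<rightarrow> carrier G"
  shows "(\<Oplus>k\<in>Sum_Type.Plus U W. f k) = (\<Oplus>i\<in>U. f (Inl i)) \<oplus> (\<Oplus>i\<in>W. f (Inr i))"
proof -
  have f: "f \<in> Inl ` U \<rightarrow> carrier G" "f \<in> Inr ` W \<rightarrow> carrier G" using assms(3) by auto
  have "(\<Oplus>k\<in>Sum_Type.Plus U W. f k) = (\<Oplus>k\<in>Inl ` U. f k) \<oplus> (\<Oplus>k\<in>Inr ` W. f k)"
    unfolding Plus_def using assms f by (intro finsum_Un_disjoint) auto
  also have "\<dots> = (\<Oplus>i\<in>U. f (Inl i)) \<oplus> (\<Oplus>i\<in>W. f (Inr i))"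
    using f by (simp add: finsum_reindex)
  finally show ?thesis .
qed

locale superalgebra_basis = K: kalgebra B
  for B :: "('k::field_char_0, 'b) module" (structure) +
  fixes B0 B1 :: "'b set" and r s :: nat and u v :: "nat \<Rightarrow> 'b"
  assumes super: "superalgebra B B0 B1"
    and even_basis: "basis_of B B0 r u" and odd_basis: "basis_of B B1 s v"
begin

lemmas even_subspace = superalgebra.even_subspace[OF super]
  and odd_subspace = superalgebra.odd_subspace[OF super]
  and sum_parts = superalgebra.sum_parts[OF super]
  and direct_parts = superalgebra.direct_parts[OF super]

definition indices :: "(nat + nat) set" where
  "indices = Sum_Type.Plus {1..r} {1..s}"

lemma in_indices [simp]: "Inl j \<in> indices \<longleftrightarrow> j \<in> {1..r}" "Inr j \<in> indices \<longleftrightarrow> j \<in> {1..s}"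
  by (auto simp: indices_def)

lemma finite_indices: "finite indices"
  by (simp add: indices_def)

abbreviation basis :: "nat + nat \<Rightarrow> 'b" where
  "basis \<equiv> case_sum u v"

definition part :: "nat \<Rightarrow> 'b set" where
  "part d = (if even d then B0 else B1)"

lemma part_subset: "part d \<subseteq> carrier B"
  using K.subspace_of_subset even_subspace odd_subspace by (simp add: part_def)

lemma part_mult: "x \<in> part d \<Longrightarrow> y \<in> part e \<Longrightarrow> x \<otimes> y \<in> part (d + e)"
  using superalgebra.even_even[OF super] superalgebra.even_odd[OF super]
    superalgebra.odd_even[OF super] superalgebra.odd_odd[OF super]
  by (auto simp: part_def)

lemma basis_part: "k \<in> indices \<Longrightarrow> basis k \<in> part (gen_degree k)"
  using even_basis odd_basis by (cases k) (simp_all add: basis_of_def part_def)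

lemma basis_closed: "k \<in> indices \<Longrightarrow> basis k \<in> carrier B"
  using basis_part part_subset by blast

lemma uv_closed: "j \<in> {1..r} \<Longrightarrow> u j \<in> carrier B" "j \<in> {1..s} \<Longrightarrow> v j \<in> carrier B"
  using basis_closed[of "Inl j"] basis_closed[of "Inr j"] by auto

lemma sum_indices:
  "(\<Oplus>k\<in>indices. c k \<odot> basis k)
    = (\<Oplus>j\<in>{1..r}. c (Inl j) \<odot> u j) \<oplus> (\<Oplus>j\<in>{1..s}. c (Inr j) \<odot> v j)"
proof -
  have "c k \<odot> basis k \<in> carrier B" if "k \<in> indices" for k using basis_closed[OF that] by (rule K.smult_in)
  then show ?thesis
    unfolding indices_def by (subst K.finsum_Plus) auto
qed

lemma part_expansion:
  assumes "x \<in> part d"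
  obtains c where "x = (\<Oplus>k\<in>indices. c k \<odot> basis k)" "\<And>k. odd (d + gen_degree k) \<Longrightarrow> c k = 0"
proof (cases "even d")
  case True
  then obtain c where c: "x = (\<Oplus>j\<in>{1..r}. c j \<odot> u j)"
    using assms even_basis by (auto simp: part_def basis_of_def)
  have "(\<Oplus>j\<in>{1..s}. 0 \<odot> v j) = (\<Oplus>j\<in>{1..s}. \<zero>)"
    using uv_closed(2) by (intro K.finsum_cong') auto
  moreover have "x \<in> carrier B" using assms part_subset by blast
  ultimately have "x = (\<Oplus>k\<in>indices. (case_sum c (\<lambda>_. 0) k) \<odot> basis k)"
    unfolding sum_indices using c by simp
  moreover have "(case_sum c (\<lambda>_. 0)) k = 0" if "odd (d + gen_degree k)" for k
    using that \<open>even d\<close> by (cases k) simp_all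
  ultimately show ?thesis by (rule that)
next
  case False
  then obtain c where c: "x = (\<Oplus>j\<in>{1..s}. c j \<odot> v j)"
    using assms odd_basis by (auto simp: part_def basis_of_def)
  have "(\<Oplus>j\<in>{1..r}. 0 \<odot> u j) = (\<Oplus>j\<in>{1..r}. \<zero>)"
    using uv_closed(1) by (intro K.finsum_cong') auto
  moreover have "x \<in> carrier B" using assms part_subset by blast
  ultimately have "x = (\<Oplus>k\<in>indices. (case_sum (\<lambda>_. 0) c k) \<odot> basis k)"
    unfolding sum_indices using c by simp
  moreover have "(case_sum (\<lambda>_. 0) c) k = 0" if "odd (d + gen_degree k)" for k
    using that \<open>odd d\<close> by (cases k) simp_all
  ultimately show ?thesis by (rule that)
qed

lemma based: "based_algebra B indices basis"
proof (intro based_algebra.intro based_algebra_axioms.intro K.kalgebra_axioms)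
  show "basis \<in> indices \<rightarrow> carrier B" using basis_closed by blast
  fix x assume x: "x \<in> carrier B"
  then obtain x0 x1 where x01: "x0 \<in> B0" "x1 \<in> B1" "x = x0 \<oplus> x1"
    using sum_parts unfolding set_add_def' by blast
  obtain c0 c1 where "x0 = (\<Oplus>j\<in>{1..r}. c0 j \<odot> u j)" "x1 = (\<Oplus>j\<in>{1..s}. c1 j \<odot> v j)"
    using x01 even_basis odd_basis unfolding basis_of_def by meson
  then have "x = (\<Oplus>k\<in>indices. case_sum c0 c1 k \<odot> basis k)"
    unfolding sum_indices x01 by simp
  then show "\<exists>c. x = (\<Oplus>k\<in>indices. c k \<odot> basis k)" by blast
next
  fix c i assume zero: "(\<Oplus>k\<in>indices. c k \<odot> basis k) = \<zero>" and i: "i \<in> indices"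
  let ?x0 = "\<Oplus>j\<in>{1..r}. c (Inl j) \<odot> u j" and ?x1 = "\<Oplus>j\<in>{1..s}. c (Inr j) \<odot> v j"
  have x0: "?x0 \<in> B0"
    using even_basis K.subspace_of_smult[OF even_subspace]
    by (intro K.subspace_of_finsum[OF even_subspace]) (auto simp: basis_of_def)
  have x1: "?x1 \<in> B1"
    using odd_basis K.subspace_of_smult[OF odd_subspace]
    by (intro K.subspace_of_finsum[OF odd_subspace]) (auto simp: basis_of_def)
  have cl: "?x0 \<in> carrier B" "?x1 \<in> carrier B"
    using x0 x1 K.subspace_of_subset even_subspace odd_subspace by blast+
  have "?x0 \<oplus> ?x1 = \<zero>" using zero unfolding sum_indices .
  then have eq: "?x0 = (- 1) \<odot> ?x1" using cl K.add_zero_imp_neg by blast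
  then have "?x0 \<in> B1" using K.subspace_of_smult[OF odd_subspace x1] by simp
  then have "?x0 \<in> {\<zero>}" unfolding direct_parts[symmetric] using x0 by blast
  then have z0: "?x0 = \<zero>" by simp
  then have z1: "?x1 = \<zero>" using K.smult_eq_zeroD[OF cl(2), of "- 1"] eq by simp
  show "c i = 0"
  proof (cases i)
    case (Inl j)
    have "\<forall>c. (\<Oplus>j\<in>{1..r}. c j \<odot> u j) = \<zero> \<longrightarrow> (\<forall>j\<in>{1..r}. c j = 0)"
      using even_basis unfolding basis_of_def by blast
    from mp[OF spec[OF this, of "\<lambda>j. c (Inl j)"] z0] show ?thesis using i Inl by simp
  next
    case (Inr j)
    have "\<forall>c. (\<Oplus>j\<in>{1..s}. c j \<odot> v j) = \<zero> \<longrightarrow> (\<forall>j\<in>{1..s}. c j = 0)"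
      using odd_basis unfolding basis_of_def by blast
    from mp[OF spec[OF this, of "\<lambda>j. c (Inr j)"] z1] show ?thesis using i Inr by simp
  qed
qed (rule finite_indices)

sublocale based_algebra B indices basis by (rule based)

lemma coord_part:
  assumes "x \<in> part d" "k \<in> indices" "odd (d + gen_degree k)"
  shows "coord x k = 0"
proof -
  obtain c where c: "x = (\<Oplus>k\<in>indices. c k \<odot> basis k)" "\<And>k. odd (d + gen_degree k) \<Longrightarrow> c k = 0"
    using part_expansion[OF assms(1)] by blast
  then show ?thesis using coord_unique[OF c(1) assms(2)] assms(3) by simp
qed

text \<open>
  Write \<open>\<one> = e + f\<close> with \<open>e\<close> even and \<open>f\<close> odd. In the odd coordinates, \<open>f = e f + f f\<close> reads \<open>f = e f\<close> and
  \<open>e = e e + e f\<close> reads \<open>\<zero> = e f\<close>. Hence \<open>f = \<zero>\<close>.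
\<close>

lemma one_even: "\<one> \<in> part 0"
proof -
  obtain e f where "e \<in> B0" "f \<in> B1" and "\<one> = e \<oplus> f"
    using sum_parts K.one_closed unfolding set_add_def' by blast
  then have ef: "e \<in> part 0" "f \<in> part 1" "\<one> = e \<oplus> f" by (simp_all add: part_def)
  have cl: "e \<in> carrier B" "f \<in> carrier B" using ef part_subset by blast+
  have "e = e \<otimes> (e \<oplus> f)" "f = (e \<oplus> f) \<otimes> f" using ef(3) cl K.r_one K.l_one by metis+
  then have eqs: "e = e \<otimes> e \<oplus> e \<otimes> f" "f = e \<otimes> f \<oplus> f \<otimes> f"
    using cl by (simp_all add: K.r_distr K.l_distr)
  have "coord f k = 0" if k: "k \<in> indices" for k
  proof (cases "odd (gen_degree k)")
    case True
    have "coord e k = coord (e \<otimes> e) k + coord (e \<otimes> f) k" "coord f k = coord (e \<otimes> f) k + coord (f \<otimes> f) k"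
      using coord_add[of "e \<otimes> e" "e \<otimes> f" k] coord_add[of "e \<otimes> f" "f \<otimes> f" k] cl k eqs by simp_all
    moreover have "coord e k = 0" "coord (e \<otimes> e) k = 0" "coord (f \<otimes> f) k = 0"
      using coord_part[OF ef(1) k] coord_part[OF part_mult[OF ef(1,1)] k]
        coord_part[OF part_mult[OF ef(2,2)] k] True by simp_all
    ultimately show ?thesis by simp
  qed (simp add: coord_part[OF ef(2) k])
  then have "f = (\<Oplus>k\<in>indices. \<zero>)"
    using coord_expansion[OF cl(2)] basis_closed by (simp cong: K.finsum_cong add: Pi_def)
  then show ?thesis using ef(1,3) cl by simp
qed

end

section \<open>The Grassmann envelope in coordinates\<close>

text \<open>The coefficients of the basis elements in a tensor can be collected in the factor from \<open>U\<close>.\<close>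

lemma (in coefficient_extension) span_of_\<tau>:
  assumes U: "subspace_of U A" and W: "W \<subseteq> carrier B" and N: "finite N" and w: "w \<in> N \<rightarrow> W"
    and span: "\<And>x. x \<in> W \<Longrightarrow> \<exists>c. x = (\<Oplus>\<^bsub>B\<^esub>j\<in>N. c j \<odot>\<^bsub>B\<^esub> w j)"
  shows "span_of T {\<tau> x a | a x. a \<in> U \<and> x \<in> W} = {\<Oplus>j\<in>N. \<tau> (w j) (f j) | f. f \<in> N \<rightarrow> U}"
    (is "_ = ?R")
proof
  have UA: "a \<in> carrier A" if "a \<in> U" for a using A.subspace_of_subset[OF U] that by blast
  have wB: "w j \<in> carrier B" "w j \<in> W" if "j \<in> N" for j using W w that by auto
  have "subspace_of ?R T"
  proof (rule T.subspace_ofI)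
    show "?R \<subseteq> carrier T" using UA wB by (auto simp: Pi_iff intro!: T.finsum_closed)
    have "(\<Oplus>j\<in>N. \<tau> (w j) \<zero>\<^bsub>A\<^esub>) = (\<Oplus>j\<in>N. \<zero>)" using wB by (intro T.finsum_cong') auto
    then have "\<zero> = (\<Oplus>j\<in>N. \<tau> (w j) \<zero>\<^bsub>A\<^esub>)" by simp
    moreover have "(\<lambda>_. \<zero>\<^bsub>A\<^esub>) \<in> N \<rightarrow> U" using A.subspace_of_zero[OF U] by simp
    ultimately show "\<zero> \<in> ?R" by (intro CollectI exI[of _ "\<lambda>_. \<zero>\<^bsub>A\<^esub>"] conjI)
  next
    fix x y assume "x \<in> ?R" "y \<in> ?R"
    then obtain f g where f: "x = (\<Oplus>j\<in>N. \<tau> (w j) (f j))" "f \<in> N \<rightarrow> U"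
      and g: "y = (\<Oplus>j\<in>N. \<tau> (w j) (g j))" "g \<in> N \<rightarrow> U" by blast
    have fg: "f j \<in> U" "g j \<in> U" if "j \<in> N" for j using f g that by auto
    have "x \<oplus> y = (\<Oplus>j\<in>N. \<tau> (w j) (f j) \<oplus> \<tau> (w j) (g j))"
      unfolding f(1) g(1) using fg UA wB by (intro T.finsum_addf[symmetric]) auto
    also have "\<dots> = (\<Oplus>j\<in>N. \<tau> (w j) (f j \<oplus>\<^bsub>A\<^esub> g j))"
      using fg UA wB by (intro T.finsum_cong') (auto simp: \<tau>_add_right)
    finally show "x \<oplus> y \<in> ?R"
      using fg A.subspace_of_add[OF U] by (intro CollectI exI[of _ "\<lambda>j. f j \<oplus>\<^bsub>A\<^esub> g j"] conjI) auto
  next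
    fix c x assume "x \<in> ?R"
    then obtain f where f: "x = (\<Oplus>j\<in>N. \<tau> (w j) (f j))" "f \<in> N \<rightarrow> U" by blast
    have fU: "f j \<in> U" if "j \<in> N" for j using f that by auto
    have "c \<odot> x = (\<Oplus>j\<in>N. c \<odot> \<tau> (w j) (f j))"
      unfolding f(1) using fU UA wB N by (intro T.smult_finsum) auto
    also have "\<dots> = (\<Oplus>j\<in>N. \<tau> (w j) (c \<odot>\<^bsub>A\<^esub> f j))"
      using fU UA wB by (intro T.finsum_cong') (auto simp: \<tau>_smult_right)
    finally show "c \<odot> x \<in> ?R"
      using fU A.subspace_of_smult[OF U] by (intro CollectI exI[of _ "\<lambda>j. c \<odot>\<^bsub>A\<^esub> f j"] conjI) auto
  qed
  moreover have "{\<tau> x a | a x. a \<in> U \<and> x \<in> W} \<subseteq> ?R"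
  proof
    fix y assume "y \<in> {\<tau> x a | a x. a \<in> U \<and> x \<in> W}"
    then obtain x a where y: "y = \<tau> x a" "a \<in> U" "x \<in> W" by blast
    obtain c where c: "x = (\<Oplus>\<^bsub>B\<^esub>j\<in>N. c j \<odot>\<^bsub>B\<^esub> w j)" using span[OF y(3)] by blast
    have "y = (\<Oplus>j\<in>N. \<tau> (c j \<odot>\<^bsub>B\<^esub> w j) a)"
      unfolding y(1) c using wB UA[OF y(2)] N by (intro \<tau>_finsum_left) auto
    also have "\<dots> = (\<Oplus>j\<in>N. \<tau> (w j) (c j \<odot>\<^bsub>A\<^esub> a))"
      using wB UA[OF y(2)] by (intro T.finsum_cong') (auto simp: \<tau>_smult_left \<tau>_smult_right)
    finally show "y \<in> ?R"
      using y(2) A.subspace_of_smult[OF U] by (intro CollectI exI[of _ "\<lambda>j. c j \<odot>\<^bsub>A\<^esub> a"] conjI) auto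
  qed
  ultimately show "span_of T {\<tau> x a | a x. a \<in> U \<and> x \<in> W} \<subseteq> ?R"
    unfolding span_of_def by blast
  show "?R \<subseteq> span_of T {\<tau> x a | a x. a \<in> U \<and> x \<in> W}"
  proof
    fix y assume "y \<in> ?R"
    then obtain f where f: "y = (\<Oplus>j\<in>N. \<tau> (w j) (f j))" "f \<in> N \<rightarrow> U" by blast
    have gen: "\<tau> (w j) (f j) \<in> {\<tau> x a | a x. a \<in> U \<and> x \<in> W}" if "j \<in> N" for j
      using f(2) wB(2)[OF that] that by blast
    have "y \<in> H" if H: "subspace_of H T" "{\<tau> x a | a x. a \<in> U \<and> x \<in> W} \<subseteq> H" for H
      unfolding f(1) using gen H(2) by (intro T.subspace_of_finsum[OF H(1) N] Pi_I) blast
    then show "y \<in> span_of T {\<tau> x a | a x. a \<in> U \<and> x \<in> W}" unfolding span_of_def by blast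
  qed
qed

context superalgebra_basis
begin

abbreviation "G \<equiv> grassmann :: ('k, (nat list \<Rightarrow>\<^sub>0 'k) set) module"

sublocale GB: coefficient_extension "tensor_algebra G B" G B indices basis "\<lambda>x a. pure_tensor G B a x"
  by (rule coefficient_extension_tensor[OF kalgebra_grassmann])

definition graded :: "(nat + nat \<Rightarrow> (nat list \<Rightarrow>\<^sub>0 'k) set) \<Rightarrow> bool" where
  "graded a \<longleftrightarrow> (\<forall>k\<in>indices. a k \<in> grassmann_part (gen_degree k))"

lemma grassmann_part_closed: "a \<in> grassmann_part d \<Longrightarrow> a \<in> carrier G"
  using GB.A.subspace_of_subset[OF grassmann_part_subspace] by blast

lemma graded_closed: "graded a \<Longrightarrow> a \<in> indices \<rightarrow> carrier G"
  using grassmann_part_closed by (auto simp: graded_def)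

lemma comb_indices:
  assumes "a \<in> indices \<rightarrow> carrier G"
  shows "GB.comb a = (\<Oplus>\<^bsub>tensor_algebra G B\<^esub>j\<in>{1..r}. pure_tensor G B (a (Inl j)) (u j))
    \<oplus>\<^bsub>tensor_algebra G B\<^esub> (\<Oplus>\<^bsub>tensor_algebra G B\<^esub>j\<in>{1..s}. pure_tensor G B (a (Inr j)) (v j))"
proof -
  have "pure_tensor G B (a k) (basis k) \<in> carrier (tensor_algebra G B)" if "k \<in> indices" for k
    using assms basis_closed[OF that] that by (intro GB.\<tau>_closed) auto
  then show ?thesis
    unfolding GB.comb_def unfolding indices_def by (subst GB.T.finsum_Plus) auto
qed

lemma tensor_subspace_even:
  "tensor_subspace G B grassmann_even B0
    = {\<Oplus>\<^bsub>tensor_algebra G B\<^esub>j\<in>{1..r}. pure_tensor G B (f j) (u j) | f. f \<in> {1..r} \<rightarrow> grassmann_part 0}"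
proof -
  have "grassmann_part 0 = (grassmann_even :: (_ \<Rightarrow>\<^sub>0 'k) set set)" by (simp add: grassmann_part_def)
  then show ?thesis
    unfolding tensor_subspace_def
    using GB.span_of_\<tau>[OF grassmann_part_subspace[of 0], of B0 "{1..r}" u]
      even_basis K.subspace_of_subset[OF even_subspace]
    by (simp add: basis_of_def Pi_iff)
qed

lemma tensor_subspace_odd:
  "tensor_subspace G B grassmann_odd B1
    = {\<Oplus>\<^bsub>tensor_algebra G B\<^esub>j\<in>{1..s}. pure_tensor G B (f j) (v j) | f. f \<in> {1..s} \<rightarrow> grassmann_part 1}"
proof -
  have "grassmann_part 1 = (grassmann_odd :: (_ \<Rightarrow>\<^sub>0 'k) set set)" by (simp add: grassmann_part_def)
  then show ?thesis
    unfolding tensor_subspace_def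
    using GB.span_of_\<tau>[OF grassmann_part_subspace[of 1], of B1 "{1..s}" v]
      odd_basis K.subspace_of_subset[OF odd_subspace]
    by (simp add: basis_of_def Pi_iff)
qed

lemma envelope_carrier:
  "carrier (grassmann_envelope B B0 B1) = GB.comb ` {a. graded a}"
proof -
  let ?T = "tensor_algebra G B"
  have "carrier (grassmann_envelope B B0 B1) = {x \<oplus>\<^bsub>?T\<^esub> y | x y.
      x \<in> tensor_subspace G B grassmann_even B0 \<and> y \<in> tensor_subspace G B grassmann_odd B1}"
    unfolding grassmann_envelope_def by (auto simp: set_add_def')
  also have "\<dots> = GB.comb ` {a. graded a}"
  proof (intro equalityI subsetI)
    fix z assume "z \<in> {x \<oplus>\<^bsub>?T\<^esub> y | x y. x \<in> tensor_subspace G B grassmann_even B0 \<and> y \<in> tensor_subspace G B grassmann_odd B1}"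
    then obtain f g where z: "z = (\<Oplus>\<^bsub>?T\<^esub>j\<in>{1..r}. pure_tensor G B (f j) (u j)) \<oplus>\<^bsub>?T\<^esub> (\<Oplus>\<^bsub>?T\<^esub>j\<in>{1..s}. pure_tensor G B (g j) (v j))"
      and fg: "f \<in> {1..r} \<rightarrow> grassmann_part 0" "g \<in> {1..s} \<rightarrow> grassmann_part 1"
      unfolding tensor_subspace_even tensor_subspace_odd by blast
    have gr: "graded (case_sum f g)" using fg by (auto simp: graded_def indices_def)
    have "z = GB.comb (case_sum f g)" unfolding z comb_indices[OF graded_closed[OF gr]] by simp
    then show "z \<in> GB.comb ` {a. graded a}" using gr by blast
  next
    fix z assume "z \<in> GB.comb ` {a. graded a}"
    then obtain a where a: "graded a" "z = GB.comb a" by blast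
    have "a (Inl j) \<in> grassmann_part 0" if "j \<in> {1..r}" for j
      using a(1) that unfolding graded_def by (metis gen_degree_simps(1) in_indices(1))
    moreover have "a (Inr j) \<in> grassmann_part 1" if "j \<in> {1..s}" for j
      using a(1) that unfolding graded_def by (metis gen_degree_simps(2) in_indices(2))
    ultimately have parts: "(\<lambda>j. a (Inl j)) \<in> {1..r} \<rightarrow> grassmann_part 0" "(\<lambda>j. a (Inr j)) \<in> {1..s} \<rightarrow> grassmann_part 1"
      by (auto simp del: One_nat_def)
    show "z \<in> {x \<oplus>\<^bsub>?T\<^esub> y | x y. x \<in> tensor_subspace G B grassmann_even B0 \<and> y \<in> tensor_subspace G B grassmann_odd B1}"
      unfolding a(2) comb_indices[OF graded_closed[OF a(1)]] tensor_subspace_even tensor_subspace_odd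
    proof (rule CollectI, rule exI, rule exI, rule conjI[OF refl], rule conjI)
      show "(\<Oplus>\<^bsub>?T\<^esub>j\<in>{1..r}. pure_tensor G B (a (Inl j)) (u j))
          \<in> {\<Oplus>\<^bsub>?T\<^esub>j\<in>{1..r}. pure_tensor G B (f j) (u j) | f. f \<in> {1..r} \<rightarrow> grassmann_part 0}"
        by (rule CollectI, rule exI[of _ "\<lambda>j. a (Inl j)"], rule conjI[OF refl parts(1)])
      show "(\<Oplus>\<^bsub>?T\<^esub>j\<in>{1..s}. pure_tensor G B (a (Inr j)) (v j))
          \<in> {\<Oplus>\<^bsub>?T\<^esub>j\<in>{1..s}. pure_tensor G B (f j) (v j) | f. f \<in> {1..s} \<rightarrow> grassmann_part 1}"
        by (rule CollectI, rule exI[of _ "\<lambda>j. a (Inr j)"], rule conjI[OF refl parts(2)])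
    qed
  qed
  finally show ?thesis .
qed

lemma grassmann_part_cong: "even d = even e \<Longrightarrow> grassmann_part d = grassmann_part e"
  by (simp add: grassmann_part_def)

lemma graded_add: "graded a \<Longrightarrow> graded a' \<Longrightarrow> graded (\<lambda>k. a k \<oplus>\<^bsub>G\<^esub> a' k)"
  using GB.A.subspace_of_add[OF grassmann_part_subspace] by (auto simp: graded_def)

lemma graded_smult: "graded a \<Longrightarrow> graded (\<lambda>k. c \<odot>\<^bsub>G\<^esub> a k)"
  using GB.A.subspace_of_smult[OF grassmann_part_subspace] by (auto simp: graded_def)

lemma graded_mult:
  assumes "graded a" "graded a'"
  shows "graded (\<lambda>j. \<Oplus>\<^bsub>G\<^esub>k\<in>indices. \<Oplus>\<^bsub>G\<^esub>l\<in>indices. coord (basis k \<otimes>\<^bsub>B\<^esub> basis l) j \<odot>\<^bsub>G\<^esub> (a k \<otimes>\<^bsub>G\<^esub> a' l))"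
  unfolding graded_def
proof (intro ballI GB.A.subspace_of_finsum[OF grassmann_part_subspace] finite_S Pi_I)
  fix j k l assume jkl: "j \<in> indices" "k \<in> indices" "l \<in> indices"
  have ak: "a k \<in> grassmann_part (gen_degree k)" "a' l \<in> grassmann_part (gen_degree l)"
    using assms jkl by (auto simp: graded_def)
  have prod: "a k \<otimes>\<^bsub>G\<^esub> a' l \<in> grassmann_part (gen_degree k + gen_degree l)"
    by (rule grassmann_part_mult[OF ak])
  show "coord (basis k \<otimes>\<^bsub>B\<^esub> basis l) j \<odot>\<^bsub>G\<^esub> (a k \<otimes>\<^bsub>G\<^esub> a' l) \<in> grassmann_part (gen_degree j)"
  proof (cases "odd ((gen_degree k + gen_degree l) + gen_degree j)")
    case True
    then have "coord (basis k \<otimes>\<^bsub>B\<^esub> basis l) j = 0"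
      using jkl by (intro coord_part[of _ "gen_degree k + gen_degree l"] part_mult basis_part)
    then show ?thesis
      using GB.A.zero_smult[OF grassmann_part_closed[OF prod]] GB.A.subspace_of_zero[OF grassmann_part_subspace]
      by simp
  next
    case False
    then have "grassmann_part (gen_degree k + gen_degree l) = (grassmann_part (gen_degree j) :: (_ \<Rightarrow>\<^sub>0 'k) set set)"
      by (intro grassmann_part_cong) simp
    then show ?thesis using GB.A.subspace_of_smult[OF grassmann_part_subspace prod] by simp
  qed
qed

lemma one_graded: "graded (\<lambda>j. coord \<one>\<^bsub>B\<^esub> j \<odot>\<^bsub>G\<^esub> \<one>\<^bsub>G\<^esub>)"
  unfolding graded_def
proof
  fix j assume j: "j \<in> indices"
  have one: "\<one>\<^bsub>G\<^esub> \<in> grassmann_part 0" by (rule one_grassmann_part)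
  show "coord \<one>\<^bsub>B\<^esub> j \<odot>\<^bsub>G\<^esub> \<one>\<^bsub>G\<^esub> \<in> grassmann_part (gen_degree j)"
  proof (cases "odd (gen_degree j)")
    case True
    then have "coord \<one>\<^bsub>B\<^esub> j = 0" using coord_part[OF one_even j] by simp
    then show ?thesis
      using GB.A.zero_smult[OF grassmann_part_closed[OF one]] GB.A.subspace_of_zero[OF grassmann_part_subspace]
      by simp
  next
    case False
    then have "grassmann_part 0 = (grassmann_part (gen_degree j) :: (_ \<Rightarrow>\<^sub>0 'k) set set)"
      by (intro grassmann_part_cong) simp
    then show ?thesis using GB.A.subspace_of_smult[OF grassmann_part_subspace one] by simp
  qed
qed

text \<open>
  Needed before identities of the envelope can be discussed: sums in a record with a restricted carrier
  are meaningful only if that carrier is closed. Closure under products is \<open>graded_mult\<close>,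
  where the structure constants between indices of mismatched parity vanish.
\<close>

lemma envelope_subalgebra:
  "subring (GB.comb ` {a. graded a}) (tensor_algebra G B)"
  "subspace_of (GB.comb ` {a. graded a}) (tensor_algebra G B)"
proof -
  let ?T = "tensor_algebra G B" and ?E = "GB.comb ` {a. graded a}"
  have subset: "?E \<subseteq> carrier ?T" using graded_closed GB.comb_closed by blast
  have in_E: "GB.comb a \<in> ?E" if "graded a" for a using that by blast
  have add: "x \<oplus>\<^bsub>?T\<^esub> y \<in> ?E" if "x \<in> ?E" "y \<in> ?E" for x y
  proof -
    from that obtain a a' where a: "graded a" "graded a'" "x = GB.comb a" "y = GB.comb a'" by blast
    show ?thesis
      unfolding a(3,4) GB.comb_add[OF graded_closed[OF a(1)] graded_closed[OF a(2)]]
      by (rule in_E[OF graded_add[OF a(1,2)]])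
  qed
  have mult: "x \<otimes>\<^bsub>?T\<^esub> y \<in> ?E" if "x \<in> ?E" "y \<in> ?E" for x y
  proof -
    from that obtain a a' where a: "graded a" "graded a'" "x = GB.comb a" "y = GB.comb a'" by blast
    show ?thesis
      unfolding a(3,4) GB.comb_mult[OF graded_closed[OF a(1)] graded_closed[OF a(2)]]
      by (rule in_E[OF graded_mult[OF a(1,2)]])
  qed
  have smult: "c \<odot>\<^bsub>?T\<^esub> x \<in> ?E" if "x \<in> ?E" for c x
  proof -
    from that obtain a where a: "graded a" "x = GB.comb a" by blast
    show ?thesis
      unfolding a(2) GB.comb_smult[OF graded_closed[OF a(1)]] by (rule in_E[OF graded_smult[OF a(1)]])
  qed
  have one: "\<one>\<^bsub>?T\<^esub> \<in> ?E"
    unfolding GB.\<tau>_one[symmetric] GB.\<tau>_eq_comb[OF K.one_closed GB.A.one_closed] by (rule in_E[OF one_graded])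
  have zero: "\<zero>\<^bsub>?T\<^esub> \<in> ?E" using smult[OF one, of 0] GB.T.zero_smult[OF GB.T.one_closed] by (simp only:)
  show ss: "subspace_of ?E ?T" by (rule GB.T.subspace_ofI[OF subset zero add smult])
  show "subring ?E ?T"
  proof (rule GB.T.subringI[OF subset one _ mult add])
    fix x assume x: "x \<in> ?E"
    then have "(- 1) \<odot>\<^bsub>?T\<^esub> x = \<ominus>\<^bsub>?T\<^esub> x" using GB.T.uminus_smult subset by blast
    with smult[OF x, of "- 1"] show "\<ominus>\<^bsub>?T\<^esub> x \<in> ?E" by (simp only:)
  qed
qed

lemma eval_poly_envelope:
  assumes "\<phi> \<in> V \<rightarrow> carrier (grassmann_envelope B B0 B1)" "keys f \<subseteq> lists V"
  shows "eval_poly (grassmann_envelope B B0 B1) \<phi> f = eval_poly (tensor_algebra G B) \<phi> f"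
proof -
  let ?T = "tensor_algebra G B" and ?E = "grassmann_envelope B B0 B1"
  have E: "?E = ?T\<lparr>carrier := GB.comb ` {a. graded a}\<rparr>"
    unfolding envelope_carrier[symmetric] by (simp add: grassmann_envelope_def)
  have ops: "\<one>\<^bsub>?E\<^esub> = \<one>\<^bsub>?T\<^esub>" "x \<oplus>\<^bsub>?E\<^esub> y = x \<oplus>\<^bsub>?T\<^esub> y" "x \<otimes>\<^bsub>?E\<^esub> y = x \<otimes>\<^bsub>?T\<^esub> y"
    "c \<odot>\<^bsub>?E\<^esub> x = c \<odot>\<^bsub>?T\<^esub> x" for c x y
    by (simp_all add: grassmann_envelope_def)
  have "kalgebra ?E"
    unfolding E by (rule GB.T.subalgebra_kalgebra[OF envelope_subalgebra])
  moreover have "(\<lambda>x. x) \<in> ring_hom ?E ?T"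
  proof (rule ring_hom_memI)
    show "x \<in> carrier ?T" if "x \<in> carrier ?E" for x
      using that GB.T.subspace_of_subset[OF envelope_subalgebra(2)] unfolding envelope_carrier by (rule rev_subsetD)
  qed (rule ops)+
  ultimately interpret incl: algebra_hom ?E ?T "\<lambda>x. x"
    by (intro algebra_hom.intro algebra_hom_axioms.intro GB.T.kalgebra_axioms ops)
  show ?thesis using incl.hom_eval_poly[OF assms] .
qed

section \<open>Generic elements\<close>

abbreviation "letters \<equiv> Sum_Type.Plus (gen_indices r) (gen_indices s)"
abbreviation "P \<equiv> generic_coeffs r s :: ('k, ((nat \<times> nat + nat \<times> nat) list \<Rightarrow>\<^sub>0 'k) set) module"
abbreviation letter :: "nat \<Rightarrow> nat + nat \<Rightarrow> nat \<times> nat + nat \<times> nat" where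
  "letter i \<equiv> map_sum (Pair i) (Pair i)"

sublocale BP: coefficient_extension "tensor_algebra B P" P B indices basis "pure_tensor B P"
  by (rule coefficient_extension_tensor[OF kalgebra_free_supercomm])

lemma letter_in: "i \<in> {1..} \<Longrightarrow> k \<in> indices \<Longrightarrow> letter i k \<in> letters"
  by (cases k) auto

lemma gen_closed: "supercomm_gen (gen_indices r) (gen_indices s) \<in> letters \<rightarrow> carrier P"
  by (rule Pi_I, rule supercomm_gen_closed)

lemma generic_element_comb:
  assumes "i \<in> {1..}"
  shows "generic_element B r u s v i = BP.comb (\<lambda>k. supercomm_gen (gen_indices r) (gen_indices s) (letter i k))"
proof -
  let ?t = "\<lambda>k. pure_tensor B P (basis k) (supercomm_gen (gen_indices r) (gen_indices s) (letter i k))"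
  have "?t \<in> indices \<rightarrow> carrier (tensor_algebra B P)"
    using basis_closed Pi_mem[OF gen_closed letter_in[OF assms]] by (intro Pi_I BP.\<tau>_closed)
  then have "(\<Oplus>\<^bsub>tensor_algebra B P\<^esub>k\<in>indices. ?t k)
      = (\<Oplus>\<^bsub>tensor_algebra B P\<^esub>j\<in>{1..r}. ?t (Inl j)) \<oplus>\<^bsub>tensor_algebra B P\<^esub>
        (\<Oplus>\<^bsub>tensor_algebra B P\<^esub>j\<in>{1..s}. ?t (Inr j))"
    unfolding indices_def by (rule BP.T.finsum_Plus[OF finite_atLeastAtMost finite_atLeastAtMost])
  then show ?thesis
    unfolding BP.comb_def generic_element_def Let_def by (simp only: sum.case map_sum.simps)
qed

text \<open>
  Families of elements of the envelope correspond to graded substitutions into the letters, via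
  coordinates; both sides then say that all coordinate polynomials of \<open>f\<close> are graded identities of the
  Grassmann algebra.
\<close>

theorem generic_element_identity:
  assumes f: "keys f \<subseteq> lists {1..}"
  shows "eval_poly (tensor_algebra B P) (generic_element B r u s v) f = \<zero>\<^bsub>tensor_algebra B P\<^esub>
    \<longleftrightarrow> (\<forall>\<phi>\<in>{1..} \<rightarrow> carrier (grassmann_envelope B B0 B1).
          eval_poly (grassmann_envelope B B0 B1) \<phi> f = \<zero>\<^bsub>grassmann_envelope B B0 B1\<^esub>)"
proof -
  let ?E = "grassmann_envelope B B0 B1" and ?T = "tensor_algebra G B"
  let ?gen = "supercomm_gen (gen_indices r) (gen_indices s) :: _ \<Rightarrow> (_ \<Rightarrow>\<^sub>0 'k) set"
  let ?p = "coord_poly letters letter f"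
  let ?super = "\<lambda>a. \<forall>z\<in>letters. a z \<in> (grassmann_part (gen_degree z) :: (_ \<Rightarrow>\<^sub>0 'k) set set)"
  have p: "keys (?p j) \<subseteq> lists letters" for j
    using coord_poly_closed[of "{1..}" letter letters f j] letter_in f by blast
  have zeroE: "\<zero>\<^bsub>?E\<^esub> = \<zero>\<^bsub>?T\<^esub>" by (simp add: grassmann_envelope_def)
  have super_closed: "a \<in> letters \<rightarrow> carrier G" if "?super a" for a
    using that grassmann_part_closed by blast
  have super_graded: "graded (\<lambda>k. a (letter i k))" if "?super a" "i \<in> {1..}" for a i
  proof -
    have "gen_degree (letter i k) = gen_degree k" for k by (cases k) simp_all
    then show ?thesis using that letter_in[OF that(2)] unfolding graded_def by metis
  qed
  have comb_zero: "eval_poly ?T (\<lambda>i. GB.comb (\<lambda>k. a (letter i k))) f = \<zero>\<^bsub>?T\<^esub>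
      \<longleftrightarrow> (\<forall>j\<in>indices. eval_poly G a (?p j) = \<zero>\<^bsub>G\<^esub>)" if "?super a" for a
    by (rule GB.eval_poly_zero_iff[of "{1..}" letter letters a "\<lambda>i. GB.comb (\<lambda>k. a (letter i k))" f,
          OF letter_in super_closed[OF that] refl f])
  have "eval_poly (tensor_algebra B P) (generic_element B r u s v) f = \<zero>\<^bsub>tensor_algebra B P\<^esub>
      \<longleftrightarrow> (\<forall>j\<in>indices. eval_poly P ?gen (?p j) = \<zero>\<^bsub>P\<^esub>)"
    by (rule BP.eval_poly_zero_iff[of "{1..}" letter letters ?gen "generic_element B r u s v" f,
          OF letter_in gen_closed generic_element_comb f])
  also have "\<dots> \<longleftrightarrow> (\<forall>j\<in>indices. ?p j \<in> supercomm_ideal (gen_indices r) (gen_indices s))"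
    using eval_poly_supercomm_gen_zero_iff[OF p] by (simp only:)
  also have "\<dots> \<longleftrightarrow> (\<forall>j\<in>indices. \<forall>a. ?super a \<longrightarrow> eval_poly G a (?p j) = \<zero>\<^bsub>G\<^esub>)"
    using supercomm_ideal_iff_grassmann_identity[OF p] by (simp only:)
  also have "\<dots> \<longleftrightarrow> (\<forall>a. ?super a \<longrightarrow> (\<forall>j\<in>indices. eval_poly G a (?p j) = \<zero>\<^bsub>G\<^esub>))"
    by blast
  also have "\<dots> \<longleftrightarrow> (\<forall>a. ?super a \<longrightarrow> eval_poly ?T (\<lambda>i. GB.comb (\<lambda>k. a (letter i k))) f = \<zero>\<^bsub>?T\<^esub>)"
    using comb_zero by blast
  also have "\<dots> \<longleftrightarrow> (\<forall>\<phi>\<in>{1..} \<rightarrow> carrier ?E. eval_poly ?E \<phi> f = \<zero>\<^bsub>?E\<^esub>)"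
  proof (intro iffI ballI allI impI)
    fix \<phi> :: "nat \<Rightarrow> _" assume *: "\<forall>a. ?super a \<longrightarrow> eval_poly ?T (\<lambda>i. GB.comb (\<lambda>k. a (letter i k))) f = \<zero>\<^bsub>?T\<^esub>"
      and \<phi>: "\<phi> \<in> {1..} \<rightarrow> carrier ?E"
    have "\<forall>i\<in>{1..}. \<exists>\<alpha>. graded \<alpha> \<and> \<phi> i = GB.comb \<alpha>"
      using \<phi> unfolding envelope_carrier by blast
    then obtain \<alpha> where \<alpha>: "graded (\<alpha> i)" "\<phi> i = GB.comb (\<alpha> i)" if "i \<in> {1..}" for i
      unfolding bchoice_iff by blast
    define a where "a z = (case z of Inl (i, j) \<Rightarrow> \<alpha> i (Inl j) | Inr (i, j) \<Rightarrow> \<alpha> i (Inr j))"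
      for z :: "nat \<times> nat + nat \<times> nat"
    have a_letter: "a (letter i k) = \<alpha> i k" for i k by (cases k) (simp_all add: a_def)
    have "a z \<in> grassmann_part (gen_degree z)" if "z \<in> letters" for z
    proof -
      obtain i k where ik: "z = letter i k" "i \<in> {1..}" "k \<in> indices"
      proof (cases z)
        case (Inl x)
        with \<open>z \<in> letters\<close> show ?thesis using that[of "fst x" "Inl (snd x)"] by auto
      next
        case (Inr x)
        with \<open>z \<in> letters\<close> show ?thesis using that[of "fst x" "Inr (snd x)"] by auto
      qed
      have "gen_degree z = gen_degree k" unfolding ik(1) by (cases k) simp_all
      then show ?thesis using \<alpha>(1)[OF ik(2)] ik(3) unfolding ik(1) a_letter graded_def by simp
    qed
    then have super: "?super a" by blast
    have "eval_poly ?E \<phi> f = eval_poly ?T \<phi> f" by (rule eval_poly_envelope[OF \<phi> f])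
    also have "\<dots> = \<zero>\<^bsub>?T\<^esub>"
    proof -
      have \<phi>_comb: "\<phi> i = GB.comb (\<lambda>k. a (letter i k))" if "i \<in> {1..}" for i
        unfolding a_letter by (rule \<alpha>(2)[OF that])
      have "eval_poly ?T \<phi> f = \<zero>\<^bsub>?T\<^esub> \<longleftrightarrow> (\<forall>j\<in>indices. eval_poly G a (?p j) = \<zero>\<^bsub>G\<^esub>)"
        by (rule GB.eval_poly_zero_iff[of "{1..}" letter letters a \<phi> f, OF letter_in super_closed[OF super] \<phi>_comb f])
      then show ?thesis using * super comb_zero[OF super] by blast
    qed
    finally show "eval_poly ?E \<phi> f = \<zero>\<^bsub>?E\<^esub>" unfolding zeroE .
  next
    fix a assume *: "\<forall>\<phi>\<in>{1..} \<rightarrow> carrier ?E. eval_poly ?E \<phi> f = \<zero>\<^bsub>?E\<^esub>" and a: "?super a"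
    have \<phi>: "(\<lambda>i. GB.comb (\<lambda>k. a (letter i k))) \<in> {1..} \<rightarrow> carrier ?E"
      unfolding envelope_carrier using super_graded[OF a] by blast
    have "eval_poly ?E (\<lambda>i. GB.comb (\<lambda>k. a (letter i k))) f = \<zero>\<^bsub>?E\<^esub>" using * \<phi> by blast
    then show "eval_poly ?T (\<lambda>i. GB.comb (\<lambda>k. a (letter i k))) f = \<zero>\<^bsub>?T\<^esub>"
      unfolding zeroE eval_poly_envelope[OF \<phi> f] .
  qed
  finally show ?thesis .
qed

corollary T_ideal_envelope:
  "T_ideal (grassmann_envelope B B0 B1) = {f \<in> carrier (free_algebra {1..}).
    eval_poly (tensor_algebra B P) (generic_element B r u s v) f = \<zero>\<^bsub>tensor_algebra B P\<^esub>}"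
  unfolding T_ideal_def
proof (rule Collect_cong, rule conj_cong[OF refl], rule generic_element_identity[symmetric])
  fix f :: "nat list \<Rightarrow>\<^sub>0 'k" assume "f \<in> carrier (free_algebra {1..})"
  then show "keys f \<subseteq> lists {1..}" unfolding free_algebra_simps by (rule CollectD)
qed

lemma generic_subalgebra_iso:
  assumes V: "V \<subseteq> {1..}"
  shows "generated_subalgebra (tensor_algebra B P) (generic_element B r u s v ` V)
    \<cong>\<^sub>a free_algebra V Quota (T_ideal (grassmann_envelope B B0 B1) \<inter> carrier (free_algebra V))"
proof -
  have closed: "generic_element B r u s v \<in> V \<rightarrow> carrier (tensor_algebra B P)"
  proof
    fix i assume "i \<in> V"
    then have i: "i \<in> {1..}" using V by blast
    show "generic_element B r u s v i \<in> carrier (tensor_algebra B P)"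
      unfolding generic_element_comb[OF i]
      by (intro BP.comb_closed Pi_I Pi_mem[OF gen_closed] letter_in[OF i])
  qed
  have "carrier (free_algebra V) \<subseteq> (carrier (free_algebra {1..}) :: (_ \<Rightarrow>\<^sub>0 'k) set)"
    unfolding free_algebra_simps using lists_mono[OF V] by blast
  then have eq: "{f \<in> carrier (free_algebra V). eval_poly (tensor_algebra B P) (generic_element B r u s v) f = \<zero>\<^bsub>tensor_algebra B P\<^esub>}
      = T_ideal (grassmann_envelope B B0 B1) \<inter> carrier (free_algebra V)"
    unfolding T_ideal_envelope by blast
  show ?thesis using BP.T.generated_subalgebra_iso[OF closed] unfolding eq .
qed

end

theorem proposition2:
  fixes B :: "('k::field_char_0, 'b) module"
    and B0 B1 :: "'b set"
    and r s n :: nat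
    and u v :: "nat \<Rightarrow> 'b"
  assumes "superalgebra B B0 B1"
    and "finite_dimensional B"
    and "basis_of B B0 r u"
    and "basis_of B B1 s v"
  shows "generated_subalgebra (tensor_algebra B (generic_coeffs r s))
             (generic_element B r u s v ` {1..})
           \<cong>\<^sub>a relatively_free (grassmann_envelope B B0 B1)
       \<and> generated_subalgebra (tensor_algebra B (generic_coeffs r s))
             (generic_element B r u s v ` {1..n})
           \<cong>\<^sub>a relatively_free_rank n (grassmann_envelope B B0 B1)"
proof -
  interpret superalgebra_basis B B0 B1 r s u v
    using assms superalgebra.axioms(1) assoc_algebra_iff_kalgebra
    by (intro superalgebra_basis.intro superalgebra_basis_axioms.intro) blast+
  have "T_ideal (grassmann_envelope B B0 B1) \<inter> carrier (free_algebra {1..}) = T_ideal (grassmann_envelope B B0 B1)"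
    unfolding T_ideal_def by blast
  then have "generated_subalgebra (tensor_algebra B P) (generic_element B r u s v ` {1..})
      \<cong>\<^sub>a relatively_free (grassmann_envelope B B0 B1)"
    using generic_subalgebra_iso[of "{1..}"] unfolding relatively_free_def by simp
  moreover have "{1..n} \<subseteq> {1..}" by auto
  then have "generated_subalgebra (tensor_algebra B P) (generic_element B r u s v ` {1..n})
      \<cong>\<^sub>a relatively_free_rank n (grassmann_envelope B B0 B1)"
    unfolding relatively_free_rank_def by (rule generic_subalgebra_iso)
  ultimately show ?thesis by (rule conjI)
qed

end
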